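(* Let $\Omega$ be an infinite set. Then there are $0,1$-lattice embeddings from $(\operatorname{Eq}\Omega)^{\mathrm{op}}\amalg^1(\operatorname{Eq}\Omega)^{\mathrm{op}}$ into $(\operatorname{Eq}\Omega)^{\mathrm{op}}$ and from $(\operatorname{Eq}\Omega)^{\mathrm{op}}\amalg(\operatorname{Eq}\Omega)^{\mathrm{op}}$ into $(\operatorname{Eq}\Omega)^{\mathrm{op}}$.
   Context: $\operatorname{Eq}\Omega$ denotes the lattice of all equivalence relations on the set $\Omega$, ordered by inclusion. For a lattice $L$, $L^{\mathrm{op}}$ is the dual lattice (same underlying set, reversed order). For lattices with a unit (greatest element) $L_1,L_2$, $L_1\amalg^1L_2$ denotes their coproduct in the category of lattices with unit and unit-preserving lattice homomorphisms; $L_1\amalg L_2$ denotes their coproduct (free product) in the variety of all lattices. A $0,1$-lattice embedding is a one-to-one lattice homomorphism preserving least and greatest elements. *)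

theory Defs
  imports Main
begin

datatype 'g lterm = Gen 'g | LMeet "'g lterm" "'g lterm" | LJoin "'g lterm" "'g lterm"

primrec lt_gens :: "'g lterm \<Rightarrow> 'g set" where
  "lt_gens (Gen g) = {g}"
| "lt_gens (LMeet s t) = lt_gens s \<union> lt_gens t"
| "lt_gens (LJoin s t) = lt_gens s \<union> lt_gens t"

primrec lt_eval :: "('g \<Rightarrow> 'b) \<Rightarrow> ('b \<Rightarrow> 'b \<Rightarrow> 'b) \<Rightarrow> ('b \<Rightarrow> 'b \<Rightarrow> 'b) \<Rightarrow> 'g lterm \<Rightarrow> 'b" where
  "lt_eval h m j (Gen g) = h g"
| "lt_eval h m j (LMeet s t) = m (lt_eval h m j s) (lt_eval h m j t)"
| "lt_eval h m j (LJoin s t) = j (lt_eval h m j s) (lt_eval h m j t)"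

text \<open>The least congruence on lattice terms over generators G that contains the
  defining relations Rel and the lattice axioms (commutativity, associativity,
  absorption).  The quotient of the terms over G by it is the lattice presented
  by generators G and relations Rel.\<close>
inductive_set lat_cong :: "'g set \<Rightarrow> ('g lterm \<times> 'g lterm) set \<Rightarrow> ('g lterm \<times> 'g lterm) set"
  for G :: "'g set" and Rel :: "('g lterm \<times> 'g lterm) set" where
  rel: "(s, t) \<in> Rel \<Longrightarrow> (s, t) \<in> lat_cong G Rel"
| refl: "lt_gens t \<subseteq> G \<Longrightarrow> (t, t) \<in> lat_cong G Rel"
| sym: "(s, t) \<in> lat_cong G Rel \<Longrightarrow> (t, s) \<in> lat_cong G Rel"
| trans: "(s, t) \<in> lat_cong G Rel \<Longrightarrow> (t, u) \<in> lat_cong G Rel \<Longrightarrow> (s, u) \<in> lat_cong G Rel"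
| meet_cong: "(s, t) \<in> lat_cong G Rel \<Longrightarrow> (s', t') \<in> lat_cong G Rel \<Longrightarrow>
     (LMeet s s', LMeet t t') \<in> lat_cong G Rel"
| join_cong: "(s, t) \<in> lat_cong G Rel \<Longrightarrow> (s', t') \<in> lat_cong G Rel \<Longrightarrow>
     (LJoin s s', LJoin t t') \<in> lat_cong G Rel"
| meet_comm: "lt_gens s \<subseteq> G \<Longrightarrow> lt_gens t \<subseteq> G \<Longrightarrow> (LMeet s t, LMeet t s) \<in> lat_cong G Rel"
| join_comm: "lt_gens s \<subseteq> G \<Longrightarrow> lt_gens t \<subseteq> G \<Longrightarrow> (LJoin s t, LJoin t s) \<in> lat_cong G Rel"
| meet_assoc: "lt_gens s \<subseteq> G \<Longrightarrow> lt_gens t \<subseteq> G \<Longrightarrow> lt_gens u \<subseteq> G \<Longrightarrow>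
     (LMeet (LMeet s t) u, LMeet s (LMeet t u)) \<in> lat_cong G Rel"
| join_assoc: "lt_gens s \<subseteq> G \<Longrightarrow> lt_gens t \<subseteq> G \<Longrightarrow> lt_gens u \<subseteq> G \<Longrightarrow>
     (LJoin (LJoin s t) u, LJoin s (LJoin t u)) \<in> lat_cong G Rel"
| meet_absorb: "lt_gens s \<subseteq> G \<Longrightarrow> lt_gens t \<subseteq> G \<Longrightarrow> (LMeet s (LJoin s t), s) \<in> lat_cong G Rel"
| join_absorb: "lt_gens s \<subseteq> G \<Longrightarrow> lt_gens t \<subseteq> G \<Longrightarrow> (LJoin s (LMeet s t), s) \<in> lat_cong G Rel"

definition coprod_gens :: "'b set \<Rightarrow> 'c set \<Rightarrow> ('b + 'c) set" where
  "coprod_gens A1 A2 = Inl ` A1 \<union> Inr ` A2"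

text \<open>Relations: the operation tables of both factors (coproduct in the variety of lattices).\<close>
definition coprod_rels ::
  "'b set \<Rightarrow> ('b \<Rightarrow> 'b \<Rightarrow> 'b) \<Rightarrow> ('b \<Rightarrow> 'b \<Rightarrow> 'b) \<Rightarrow>
   'c set \<Rightarrow> ('c \<Rightarrow> 'c \<Rightarrow> 'c) \<Rightarrow> ('c \<Rightarrow> 'c \<Rightarrow> 'c) \<Rightarrow> (('b + 'c) lterm \<times> ('b + 'c) lterm) set" where
  "coprod_rels A1 m1 j1 A2 m2 j2 =
     {(Gen (Inl (m1 x y)), LMeet (Gen (Inl x)) (Gen (Inl y))) | x y. x \<in> A1 \<and> y \<in> A1}
   \<union> {(Gen (Inl (j1 x y)), LJoin (Gen (Inl x)) (Gen (Inl y))) | x y. x \<in> A1 \<and> y \<in> A1}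
   \<union> {(Gen (Inr (m2 x y)), LMeet (Gen (Inr x)) (Gen (Inr y))) | x y. x \<in> A2 \<and> y \<in> A2}
   \<union> {(Gen (Inr (j2 x y)), LJoin (Gen (Inr x)) (Gen (Inr y))) | x y. x \<in> A2 \<and> y \<in> A2}"

text \<open>Coproduct in the category of lattices with unit: additionally identify the units.\<close>
definition coprod1_rels ::
  "'b set \<Rightarrow> ('b \<Rightarrow> 'b \<Rightarrow> 'b) \<Rightarrow> ('b \<Rightarrow> 'b \<Rightarrow> 'b) \<Rightarrow> 'b \<Rightarrow>
   'c set \<Rightarrow> ('c \<Rightarrow> 'c \<Rightarrow> 'c) \<Rightarrow> ('c \<Rightarrow> 'c \<Rightarrow> 'c) \<Rightarrow> 'c \<Rightarrow> (('b + 'c) lterm \<times> ('b + 'c) lterm) set" where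
  "coprod1_rels A1 m1 j1 u1 A2 m2 j2 u2 =
     coprod_rels A1 m1 j1 A2 m2 j2 \<union> {(Gen (Inl u1), Gen (Inr u2))}"

definition Eq :: "'a set \<Rightarrow> 'a rel set" where
  "Eq \<Omega> = {R. equiv \<Omega> R}"

text \<open>In (Eq \<Omega>)^op the meet is the join of equivalence relations and vice versa.\<close>
definition eqop_meet :: "'a rel \<Rightarrow> 'a rel \<Rightarrow> 'a rel" where
  "eqop_meet R S = trancl (R \<union> S)"

definition eqop_join :: "'a rel \<Rightarrow> 'a rel \<Rightarrow> 'a rel" where
  "eqop_join R S = R \<inter> S"

definition eqop_bot :: "'a set \<Rightarrow> 'a rel" where "eqop_bot \<Omega> = \<Omega> \<times> \<Omega>"
definition eqop_top :: "'a set \<Rightarrow> 'a rel" where "eqop_top \<Omega> = Id_on \<Omega>"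

definition eqop_eval :: "('a rel \<Rightarrow> 'a rel) \<Rightarrow> ('a rel \<Rightarrow> 'a rel) \<Rightarrow> ('a rel + 'a rel) lterm \<Rightarrow> 'a rel" where
  "eqop_eval h1 h2 = lt_eval (case_sum h1 h2) eqop_meet eqop_join"

text \<open>A 0,1-lattice embedding of the lattice presented by Rel (over generators
  coprod_gens) into (Eq \<Omega>)^op, determined by the images h1, h2 of the two factors:
  evaluation is well defined and injective on congruence classes (kernel = congruence),
  and the given bottom/top terms are sent to the bottom/top of (Eq \<Omega>)^op.\<close>
definition eqop_pres_embedding ::
  "'a set \<Rightarrow> (('a rel + 'a rel) lterm \<times> ('a rel + 'a rel) lterm) set \<Rightarrow>
   ('a rel + 'a rel) lterm \<Rightarrow> ('a rel + 'a rel) lterm \<Rightarrow>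
   ('a rel \<Rightarrow> 'a rel) \<Rightarrow> ('a rel \<Rightarrow> 'a rel) \<Rightarrow> bool" where
  "eqop_pres_embedding \<Omega> Rel bt tp h1 h2 \<longleftrightarrow>
     h1 ` Eq \<Omega> \<subseteq> Eq \<Omega> \<and> h2 ` Eq \<Omega> \<subseteq> Eq \<Omega> \<and>
     (\<forall>s t. lt_gens s \<subseteq> coprod_gens (Eq \<Omega>) (Eq \<Omega>) \<longrightarrow> lt_gens t \<subseteq> coprod_gens (Eq \<Omega>) (Eq \<Omega>) \<longrightarrow>
        (eqop_eval h1 h2 s = eqop_eval h1 h2 t \<longleftrightarrow>
         (s, t) \<in> lat_cong (coprod_gens (Eq \<Omega>) (Eq \<Omega>)) Rel)) \<and>
     eqop_eval h1 h2 bt = eqop_bot \<Omega> \<and> eqop_eval h1 h2 tp = eqop_top \<Omega>"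

definition coprod_bot :: "'a set \<Rightarrow> ('a rel + 'a rel) lterm" where
  "coprod_bot \<Omega> = LMeet (Gen (Inl (eqop_bot \<Omega>))) (Gen (Inr (eqop_bot \<Omega>)))"

text \<open>Top of the plain coproduct: join of the two tops; of the unital coproduct: the common unit.\<close>
definition coprod_top :: "'a set \<Rightarrow> ('a rel + 'a rel) lterm" where
  "coprod_top \<Omega> = LJoin (Gen (Inl (eqop_top \<Omega>))) (Gen (Inr (eqop_top \<Omega>)))"

definition coprod1_top :: "'a set \<Rightarrow> ('a rel + 'a rel) lterm" where
  "coprod1_top \<Omega> = Gen (Inl (eqop_top \<Omega>))"

end

(*
  In the order of equivalence relations the claim is that Eq embeds the free product (with or
  without amalgamated zero) of two copies of itself.  That free product has more elements than
  the set \<Omega>, so it cannot simply be represented on \<Omega> by Whitman's theorem.  However, Eq is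
  algebraic, and every term has approximations with compact generators, of which there are only
  as many as elements of \<Omega>.  The solution of the word problem (Whitman, Dean, Graetzer) shows
  that a term is determined by the compact terms below it, and that a compact term below t is
  below some approximation of t.  A Jonsson-style construction then yields a set of size |\<Omega>|
  with a metric whose values are compact terms: t is sent to the relation dist x y \<le> t.
  Meets are preserved automatically, joins because for dist x y \<le> s \<or> t a path from x to y
  with distances s, t, s, t has been added, and the faithfulness on all terms follows from the
  two approximation properties.  The case without amalgamation is the one with a new zero below
  both factors, and the least element of Eq is reached by passing to a quotient.
*)
theory Submission
  imports Defs "HOL-Library.Equipollence"
begin

section \<open>The word problem for free products with common zero\<close>

text \<open>Compactness enters twice. Faithfulness compares arbitrary terms although only compact
  ones occur as distances, so a term must be recovered from its compact approximations; and a
  distance below the supremum of arbitrary \<open>s\<close> and \<open>t\<close> must already lie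
  below a supremum of compact ones, since only compact terms label new points. Both facts rest on
  the continuity of the lower and upper covers of a term. The compact elements of Eq, the relations
  with finite nontrivial part, are moreover closed under intersection, so compact terms may contain
  infima and their upper covers stay compact. The path has four steps because the way back through
  \<open>x\<close> and \<open>y\<close> must never be shorter than a direct step between its inner
  points: with distances \<open>s\<close>, \<open>t\<close>, \<open>s\<close> the middle step would
  force \<open>t\<close> below the supremum of \<open>s\<close> and \<open>dist x y\<close>, whereas
  with four steps every way back uses both \<open>s\<close> and \<open>t\<close>. In the plain
  coproduct the least element is the infimum of the two diagonals, which lies strictly above the
  adjoined zero; this is the term by which the quotient is taken.\<close>

text \<open>Since the meet of the dual lattice is the join of equivalence relations, \<open>LMeet\<close> denotes
  the supremum and \<open>LJoin\<close> the infimum throughout.\<close>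

definition terms :: "'l set \<Rightarrow> ('l + 'l) lterm set" where
  "terms S = {t. lt_gens t \<subseteq> coprod_gens S S}"

lemma terms_simps [simp]:
  "Gen (Inl x) \<in> terms S \<longleftrightarrow> x \<in> S"
  "Gen (Inr x) \<in> terms S \<longleftrightarrow> x \<in> S"
  "LMeet s t \<in> terms S \<longleftrightarrow> s \<in> terms S \<and> t \<in> terms S"
  "LJoin s t \<in> terms S \<longleftrightarrow> s \<in> terms S \<and> t \<in> terms S"
  by (auto simp: terms_def coprod_gens_def)

lemma terms_mono: "S \<subseteq> S' \<Longrightarrow> terms S \<subseteq> terms S'"
  unfolding terms_def coprod_gens_def by blast

text \<open>This is the greatest element below the term in the factor selected by \<open>b\<close>
  (\<open>True\<close> for \<open>Inl\<close>). A generator of the other factor has only the common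
  zero below it.\<close>

primrec low :: "('l + 'l) lterm \<Rightarrow> bool \<Rightarrow> 'l::bounded_lattice" where
  "low (Gen g) b = (case g of Inl x \<Rightarrow> if b then x else bot | Inr x \<Rightarrow> if b then bot else x)"
| "low (LMeet s t) b = sup (low s b) (low t b)"
| "low (LJoin s t) b = inf (low s b) (low t b)"

text \<open>The value \<open>top\<close> encodes the absence of an upper cover.  Since the least elements
  of the two factors are identified, a term whose cover on one side vanishes is zero.\<close>
primrec up :: "('l + 'l) lterm \<Rightarrow> bool \<Rightarrow> 'l::bounded_lattice" where
  "up (Gen g) b = (case g of Inl x \<Rightarrow> if b \<or> x = bot then x else top
                           | Inr x \<Rightarrow> if b \<and> x \<noteq> bot then top else x)"
| "up (LMeet s t) b = sup (up s b) (up t b)"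
| "up (LJoin s t) b =
     (if inf (up s (\<not> b)) (up t (\<not> b)) = bot then bot else inf (up s b) (up t b))"

text \<open>Besides the lattice rules, an inequality can hold because the least element of a factor
  above \<open>p\<close> lies below the greatest element of the same factor below \<open>q\<close>.\<close>
inductive word_le :: "('l::bounded_lattice + 'l) lterm \<Rightarrow> ('l + 'l) lterm \<Rightarrow> bool" where
  cov: "up p b \<le> low q b \<Longrightarrow> word_le p q"
| MeetL: "word_le p r \<Longrightarrow> word_le q r \<Longrightarrow> word_le (LMeet p q) r"
| JoinR: "word_le r p \<Longrightarrow> word_le r q \<Longrightarrow> word_le r (LJoin p q)"
| MeetR1: "word_le r p \<Longrightarrow> word_le r (LMeet p q)"
| MeetR2: "word_le r q \<Longrightarrow> word_le r (LMeet p q)"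
| JoinL1: "word_le p r \<Longrightarrow> word_le (LJoin p q) r"
| JoinL2: "word_le q r \<Longrightarrow> word_le (LJoin p q) r"

text \<open>The exceptional clause of \<open>up\<close> for infima makes both covers vanish
  together, so being zero is visible from either factor. This lets \<open>up_mono\<close> cross from
  one factor to the other.\<close>

lemma up_eq_bot_iff: "up t b = bot \<longleftrightarrow> up t (\<not> b) = bot"
proof (induction t arbitrary: b)
  case (Gen g)
  have "top = (bot :: 'a) \<Longrightarrow> x = bot" for x :: 'a
    by (metis bot.extremum_uniqueI top_greatest)
  then show ?case by (cases g) auto
next
  case (LMeet s t)
  have *: "sup x y = bot \<longleftrightarrow> x = bot \<and> y = bot" for x y :: 'a
    using sup_eq_bot_iff by blast
  show ?case using LMeet by (simp add: *)
qed auto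

text \<open>The two claims need a joint induction: for an infimum with nonzero lower cover, the
  second claim makes the covers of both parts on the other side \<open>top\<close>, so the
  exceptional clause of \<open>up\<close> does not fire.\<close>

lemma low_le_up_aux:
  "low t b \<le> up t b \<and> (low t b \<noteq> bot \<longrightarrow> up t (\<not> b) = top)"
proof (induction t arbitrary: b)
  case (Gen g)
  then show ?case by (cases g) auto
next
  case (LMeet s t)
  then have "low s b \<le> up s b" "low t b \<le> up t b" by auto
  then have "low (LMeet s t) b \<le> up (LMeet s t) b" by (simp add: le_supI1 le_supI2)
  moreover have "up (LMeet s t) (\<not> b) = top" if "low (LMeet s t) b \<noteq> bot"
    using that LMeet[of b] by (cases "low s b = bot") auto
  ultimately show ?case by blast
next
  case (LJoin s t)
  show ?case
  proof (cases "low (LJoin s t) b = bot")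
    case False
    then have ne: "inf (low s b) (low t b) \<noteq> bot" by simp
    then have "low s b \<noteq> bot" "low t b \<noteq> bot" by auto
    then have top: "up s (\<not> b) = top" "up t (\<not> b) = top" using LJoin by auto
    have "inf (low s b) (low t b) \<le> inf (up s b) (up t b)"
      using LJoin by (meson inf_mono)
    moreover from this have "inf (up s b) (up t b) \<noteq> bot"
      using ne by (metis bot.extremum_uniqueI)
    moreover have "(top :: 'a) \<noteq> bot"
      using ne by (metis bot.extremum_uniqueI top_greatest)
    ultimately show ?thesis using top by simp
  qed simp
qed

lemma low_le_up: "low t b \<le> up t b"
  and up_eq_top: "low t b \<noteq> bot \<Longrightarrow> up t (\<not> b) = top"
  using low_le_up_aux by auto

text \<open>Keeping \<open>top\<close> outside \<open>A\<close> frees it to encode a missing upper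
  cover, and lower covers of terms over \<open>A\<close> never reach it.\<close>

locale proper_sublattice =
  fixes A :: "'l::bounded_lattice set"
  assumes bot_in: "bot \<in> A"
    and top_notin: "top \<notin> A"
    and sup_in: "x \<in> A \<Longrightarrow> y \<in> A \<Longrightarrow> sup x y \<in> A"
    and inf_in: "x \<in> A \<Longrightarrow> y \<in> A \<Longrightarrow> inf x y \<in> A"
begin

lemma low_in: "t \<in> terms A \<Longrightarrow> low t b \<in> A"
proof (induction t)
  case (Gen g)
  then show ?case by (cases g) (auto simp: bot_in)
qed (auto simp: sup_in inf_in)

text \<open>A cover rule in the opposite factor does no harm: if \<open>low p b\<close> is nonzero,
  \<open>p\<close> has no upper cover there, and the rule would force a lower cover of
  \<open>q\<close> to be \<open>top\<close>.\<close>

lemma low_mono: "word_le p q \<Longrightarrow> q \<in> terms A \<Longrightarrow> low p b \<le> low q b"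
proof (induction rule: word_le.induct)
  case (cov p c q)
  show ?case
  proof (cases "c = b")
    case True
    then show ?thesis using cov low_le_up order_trans by blast
  next
    case False
    then have c: "c = (\<not> b)" by auto
    show ?thesis
    proof (cases "low p b = bot")
      case ne: False
      then have "up p c = top" using up_eq_top c by blast
      then have "low q c = top" using cov by (simp add: top_unique)
      then show ?thesis using low_in cov top_notin by metis
    qed simp
  qed
qed (auto intro: le_supI1 le_supI2 le_infI1 le_infI2)

text \<open>For a cover rule in the opposite factor there are two cases: if the lower cover of
  \<open>q\<close> is zero there, then \<open>p\<close> is zero in both factors; otherwise
  \<open>q\<close> has no upper cover on the side of \<open>b\<close>.\<close>

lemma up_mono: "word_le p q \<Longrightarrow> up p b \<le> up q b"
proof (induction arbitrary: b rule: word_le.induct)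
  case (cov p c q)
  show ?case
  proof (cases "c = b")
    case True
    then show ?thesis using cov low_le_up order_trans by blast
  next
    case False
    then have c: "c = (\<not> b)" by auto
    show ?thesis
    proof (cases "low q c = bot")
      case True
      then have "up p c = bot" using cov by (simp add: bot_unique)
      then have "up p b = bot" using up_eq_bot_iff c by blast
      then show ?thesis by simp
    next
      case False
      then show ?thesis using up_eq_top[of q c] c by simp
    qed
  qed
next
  case (JoinR r p q)
  show ?case
  proof (cases "inf (up p (\<not> b)) (up q (\<not> b)) = bot")
    case True
    have "up r (\<not> b) \<le> inf (up p (\<not> b)) (up q (\<not> b))" using JoinR by simp
    then have "up r (\<not> b) = bot" using True by (simp add: bot_unique)
    then have "up r b = bot" using up_eq_bot_iff by blast
    then show ?thesis by simp
  next
    case False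
    then show ?thesis using JoinR by simp
  qed
qed (auto intro: le_supI1 le_supI2 le_infI1 le_infI2)

text \<open>Cut elimination: the middle term is decomposed unless one of the two derivations
  ends with a cover, and covers are monotone.\<close>
lemma word_le_trans:
  "word_le p q \<Longrightarrow> word_le q r \<Longrightarrow> p \<in> terms A \<Longrightarrow> q \<in> terms A \<Longrightarrow> r \<in> terms A \<Longrightarrow> word_le p r"
proof (induction "size p + size q + size r" arbitrary: p q r rule: less_induct)
  case less
  note IH = less.hyps and pq = less.prems(1) and qr = less.prems(2) and t = less.prems(3-5)
  from pq show ?case
  proof cases
    case (cov b)
    then show ?thesis using low_mono[OF qr t(3)] order_trans word_le.cov by blast
  next
    case (MeetL p0 p1)
    then show ?thesis using IH[of p0 q r] IH[of p1 q r] qr t by (auto intro: word_le.MeetL)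
  next
    case (JoinL1 p0 p1)
    then show ?thesis using IH[of p0 q r] qr t by (auto intro: word_le.JoinL1)
  next
    case (JoinL2 p1 p0)
    then show ?thesis using IH[of p1 q r] qr t by (auto intro: word_le.JoinL2)
  next
    case q: (JoinR q0 q1)
    from qr show ?thesis
    proof cases
      case (cov b)
      then show ?thesis using up_mono[OF pq] order_trans word_le.cov by blast
    next
      case (JoinR r0 r1)
      then show ?thesis using IH[of p q r0] IH[of p q r1] pq t by (auto intro: word_le.JoinR)
    next
      case (MeetR1 r0 r1)
      then show ?thesis using IH[of p q r0] pq t by (auto intro: word_le.MeetR1)
    next
      case (MeetR2 r1 r0)
      then show ?thesis using IH[of p q r1] pq t by (auto intro: word_le.MeetR2)
    next
      case (JoinL1 q0' q1')
      then show ?thesis using IH[of p q0 r] q t by auto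
    next
      case (JoinL2 q1' q0')
      then show ?thesis using IH[of p q1 r] q t by auto
    qed (use q in auto)
  next
    case q: (MeetR1 q0 q1)
    from qr show ?thesis
    proof cases
      case (cov b)
      then show ?thesis using up_mono[OF pq] order_trans word_le.cov by blast
    next
      case (JoinR r0 r1)
      then show ?thesis using IH[of p q r0] IH[of p q r1] pq t by (auto intro: word_le.JoinR)
    next
      case (MeetR1 r0 r1)
      then show ?thesis using IH[of p q r0] pq t by (auto intro: word_le.MeetR1)
    next
      case (MeetR2 r1 r0)
      then show ?thesis using IH[of p q r1] pq t by (auto intro: word_le.MeetR2)
    next
      case (MeetL q0' q1')
      then show ?thesis using IH[of p q0 r] q t by auto
    qed (use q in auto)
  next
    case q: (MeetR2 q1 q0)
    from qr show ?thesis
    proof cases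
      case (cov b)
      then show ?thesis using up_mono[OF pq] order_trans word_le.cov by blast
    next
      case (JoinR r0 r1)
      then show ?thesis using IH[of p q r0] IH[of p q r1] pq t by (auto intro: word_le.JoinR)
    next
      case (MeetR1 r0 r1)
      then show ?thesis using IH[of p q r0] pq t by (auto intro: word_le.MeetR1)
    next
      case (MeetR2 r1 r0)
      then show ?thesis using IH[of p q r1] pq t by (auto intro: word_le.MeetR2)
    next
      case (MeetL q0' q1')
      then show ?thesis using IH[of p q1 r] q t by auto
    qed (use q in auto)
  qed
qed

lemma word_le_refl: "word_le p p"
proof (induction p)
  case (Gen g)
  show ?case
  proof (cases g)
    case (Inl x)
    then show ?thesis using cov[of "Gen g" True "Gen g"] by simp
  next
    case (Inr x)
    then show ?thesis using cov[of "Gen g" False "Gen g"] by simp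
  qed
qed (auto intro: word_le.intros)

lemma word_le_Meet_iff:
  assumes "p \<in> terms A" "q \<in> terms A" "r \<in> terms A"
  shows "word_le (LMeet p q) r \<longleftrightarrow> word_le p r \<and> word_le q r"
  using assms word_le_trans[of p "LMeet p q" r] word_le_trans[of q "LMeet p q" r]
  by (auto intro: MeetL MeetR1 MeetR2 word_le_refl)

lemma word_le_Join_iff:
  assumes "p \<in> terms A" "q \<in> terms A" "r \<in> terms A"
  shows "word_le r (LJoin p q) \<longleftrightarrow> word_le r p \<and> word_le r q"
  using assms word_le_trans[of r "LJoin p q" p] word_le_trans[of r "LJoin p q" q]
  by (auto intro: JoinR JoinL1 JoinL2 word_le_refl)

lemma word_le_Gen_bot: "word_le (Gen (Inl bot)) p" "word_le (Gen (Inr bot)) p"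
  by (auto intro: cov[of _ True])

end

section \<open>Approximation by compact terms\<close>

text \<open>A common upper bound of two counterexamples, one for each property, satisfies one of the
  properties, which then passes down to its counterexample.\<close>

lemma directed_disj:
  assumes "\<And>c d. D c \<Longrightarrow> D d \<Longrightarrow> \<exists>e. D e \<and> R c e \<and> R d e"
    and "\<And>c e. D c \<Longrightarrow> D e \<Longrightarrow> R c e \<Longrightarrow> P e \<Longrightarrow> P c"
    and "\<And>c e. D c \<Longrightarrow> D e \<Longrightarrow> R c e \<Longrightarrow> Q e \<Longrightarrow> Q c"
    and "\<And>c. D c \<Longrightarrow> P c \<or> Q c"
  shows "(\<forall>c. D c \<longrightarrow> P c) \<or> (\<forall>c. D c \<longrightarrow> Q c)"
proof (rule ccontr)
  assume "\<not> ?thesis"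
  then obtain c d where cd: "D c" "\<not> P c" "D d" "\<not> Q d" by blast
  obtain e where e: "D e" "R c e" "R d e" using assms(1) cd by blast
  show False using assms(2)[OF cd(1) e(1,2)] assms(3)[OF cd(3) e(1,3)] assms(4)[OF e(1)] cd by blast
qed

text \<open>\<open>dense\<close> and \<open>compact\<close> are the two halves of algebraicity, the
  latter for binary suprema. Closure of \<open>K\<close> under infima is not automatic in algebraic
  lattices; it keeps the upper covers of compact terms in \<open>K\<close>, apart from
  \<open>top\<close>.\<close>

locale compact_sublattice = proper_sublattice A for A :: "'l::bounded_lattice set" +
  fixes K :: "'l set"
  assumes K_subset: "K \<subseteq> A"
    and bot_in_K: "bot \<in> K"
    and sup_in_K: "x \<in> K \<Longrightarrow> y \<in> K \<Longrightarrow> sup x y \<in> K"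
    and inf_in_K: "x \<in> K \<Longrightarrow> y \<in> K \<Longrightarrow> inf x y \<in> K"
    and dense: "x \<in> A \<Longrightarrow> (\<And>k. k \<in> K \<Longrightarrow> k \<le> x \<Longrightarrow> k \<le> y) \<Longrightarrow> x \<le> y"
    and compact: "k \<in> K \<Longrightarrow> x \<in> A \<Longrightarrow> y \<in> A \<Longrightarrow> k \<le> sup x y \<Longrightarrow>
      \<exists>k1\<in>K. \<exists>k2\<in>K. k1 \<le> x \<and> k2 \<le> y \<and> k \<le> sup k1 k2"
begin

text \<open>Keeping the shape of the term makes its approximations a directed family whose covers
  can be compared with those of the term by structural induction.\<close>

inductive apx :: "('l + 'l) lterm \<Rightarrow> ('l + 'l) lterm \<Rightarrow> bool" where
  Inl: "k \<in> K \<Longrightarrow> k \<le> x \<Longrightarrow> apx (Gen (Inl k)) (Gen (Inl x))"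
| Inr: "k \<in> K \<Longrightarrow> k \<le> x \<Longrightarrow> apx (Gen (Inr k)) (Gen (Inr x))"
| Meet: "apx c s \<Longrightarrow> apx d t \<Longrightarrow> apx (LMeet c d) (LMeet s t)"
| Join: "apx c s \<Longrightarrow> apx d t \<Longrightarrow> apx (LJoin c d) (LJoin s t)"

inductive_cases apx_InlE: "apx c (Gen (Inl x))"
inductive_cases apx_InrE: "apx c (Gen (Inr x))"
inductive_cases apx_MeetE: "apx c (LMeet s t)"
inductive_cases apx_JoinE: "apx c (LJoin s t)"

lemma word_le_Gen_mono:
  assumes "x \<le> y"
  shows "word_le (Gen (Inl x)) (Gen (Inl y))" "word_le (Gen (Inr x)) (Gen (Inr y))"
  using assms cov[of "Gen (Inl x)" True "Gen (Inl y)"] cov[of "Gen (Inr x)" False "Gen (Inr y)"]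
  by auto

lemma apx_in: "apx c t \<Longrightarrow> c \<in> terms K"
  by (induction rule: apx.induct) auto

lemma terms_K_A: "t \<in> terms K \<Longrightarrow> t \<in> terms A"
  using terms_mono[OF K_subset] by blast

lemma apx_in_A: "apx c t \<Longrightarrow> c \<in> terms A"
  using apx_in terms_K_A by blast

lemma word_le_LMeet_mono: "word_le c s \<Longrightarrow> word_le d t \<Longrightarrow> word_le (LMeet c d) (LMeet s t)"
  by (simp add: MeetL MeetR1 MeetR2)

lemma word_le_LJoin_mono: "word_le c s \<Longrightarrow> word_le d t \<Longrightarrow> word_le (LJoin c d) (LJoin s t)"
  by (simp add: JoinR JoinL1 JoinL2)

lemma apx_le: "apx c t \<Longrightarrow> word_le c t"
  by (induction rule: apx.induct) (auto intro: word_le_Gen_mono word_le_LMeet_mono word_le_LJoin_mono)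

lemma apx_ex: "\<exists>c. apx c t"
proof (induction t)
  case (Gen g)
  then show ?case using apx.intros(1,2)[OF bot_in_K bot_least] by (cases g) blast+
qed (auto intro: apx.intros)

lemma apx_directed: "apx c t \<Longrightarrow> apx d t \<Longrightarrow> \<exists>e. apx e t \<and> word_le c e \<and> word_le d e"
proof (induction c t arbitrary: d rule: apx.induct)
  case (Inl k x)
  then obtain k' where d: "d = Gen (Inl k')" "k' \<in> K" "k' \<le> x" by (auto elim: apx_InlE)
  then have "apx (Gen (Inl (sup k k'))) (Gen (Inl x))"
    using Inl by (auto intro!: apx.Inl sup_in_K)
  then show ?case using d word_le_Gen_mono(1)[of _ "sup k k'"] by (metis sup_ge1 sup_ge2)
next
  case (Inr k x)
  then obtain k' where d: "d = Gen (Inr k')" "k' \<in> K" "k' \<le> x" by (auto elim: apx_InrE)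
  then have "apx (Gen (Inr (sup k k'))) (Gen (Inr x))"
    using Inr by (auto intro!: apx.Inr sup_in_K)
  then show ?case using d word_le_Gen_mono(2)[of _ "sup k k'"] by (metis sup_ge1 sup_ge2)
next
  case (Meet c s c' t)
  then show ?case by (metis apx.Meet word_le_LMeet_mono apx_MeetE)
next
  case (Join c s c' t)
  then show ?case by (metis apx.Join word_le_LJoin_mono apx_JoinE)
qed

text \<open>Lower covers are continuous: \<open>compact\<close> splits an element below a supremum
  between the two parts, and for an infimum the same element serves both.\<close>

lemma low_apx:
  "t \<in> terms A \<Longrightarrow> k \<in> K \<Longrightarrow> k \<le> low t b \<Longrightarrow> \<exists>c. apx c t \<and> k \<le> low c b"
proof (induction t arbitrary: k)
  case (Gen g)
  show ?case
  proof (cases g)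
    case (Inl x)
    then show ?thesis using Gen bot_in_K
      by (intro exI[of _ "Gen (Inl (if b then k else bot))"]) (auto intro: apx.Inl)
  next
    case (Inr x)
    then show ?thesis using Gen bot_in_K
      by (intro exI[of _ "Gen (Inr (if b then bot else k))"]) (auto intro: apx.Inr)
  qed
next
  case (LMeet s t)
  then obtain k1 k2 where k: "k1 \<in> K" "k2 \<in> K" "k1 \<le> low s b" "k2 \<le> low t b" "k \<le> sup k1 k2"
    using compact[of k "low s b" "low t b"] low_in by auto
  then obtain c d where "apx c s" "k1 \<le> low c b" "apx d t" "k2 \<le> low d b"
    using LMeet by (metis terms_simps(3))
  then show ?case using k
    by (intro exI[of _ "LMeet c d"]) (auto intro: apx.Meet order_trans[OF k(5) sup_mono])
next
  case (LJoin s t)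
  then obtain c d where "apx c s" "k \<le> low c b" "apx d t" "k \<le> low d b"
    by (metis terms_simps(4) low.simps(3) le_inf_iff)
  then show ?case
    by (intro exI[of _ "LJoin c d"]) (auto intro: apx.Join)
qed

lemma up_in: "t \<in> terms A \<Longrightarrow> up t b \<in> insert top A"
proof (induction t arbitrary: b)
  case (Gen g)
  then show ?case by (cases g) auto
next
  case (LMeet s t)
  then have "up s b \<in> insert top A" "up t b \<in> insert top A" by auto
  then show ?case using sup_in by (auto simp: sup_top_left sup_top_right)
next
  case (LJoin s t)
  then have "up s b \<in> insert top A" "up t b \<in> insert top A" by auto
  then show ?case using inf_in bot_in by auto
qed

lemma up_in_K: "t \<in> terms K \<Longrightarrow> up t b \<in> insert top K"
proof (induction t arbitrary: b)
  case (Gen g)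
  then show ?case by (cases g) auto
next
  case (LMeet s t)
  then have "up s b \<in> insert top K" "up t b \<in> insert top K" by auto
  then show ?case using sup_in_K by (auto simp: sup_top_left sup_top_right)
next
  case (LJoin s t)
  then have "up s b \<in> insert top K" "up t b \<in> insert top K" by auto
  then show ?case using inf_in_K bot_in_K by auto
qed

lemma nonbot_compact:
  assumes "x \<in> insert top A" "x \<noteq> bot"
  obtains k where "k \<in> insert top K" "k \<le> x" "k \<noteq> bot"
  using assms dense[of x bot] by (metis bot.extremum_unique insert_iff order_refl)

text \<open>Upper covers are continuous as well. The value \<open>top\<close> for \<open>k\<close>
  is allowed because a missing upper cover must already be missing for some approximation.\<close>

lemma up_apx:
  "t \<in> terms A \<Longrightarrow> k \<in> insert top K \<Longrightarrow> k \<le> up t b \<Longrightarrow> \<exists>c. apx c t \<and> k \<le> up c b"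
proof (induction t arbitrary: k b)
  case (Gen g)
  have K: "k \<in> K" if "x \<in> A" "k \<le> x" for x
  proof -
    have "k \<noteq> top" using that top_notin top_unique by metis
    then show ?thesis using Gen.prems(2) by blast
  qed
  show ?case
  proof (cases g)
    case (Inl x)
    then have x: "x \<in> A" using Gen.prems(1) by simp
    show ?thesis
    proof (cases "b \<or> x = bot")
      case True
      then have kx: "k \<le> x" using Gen.prems(3) Inl by (auto split: if_splits)
      then have "apx (Gen (Inl k)) (Gen g)" using apx.Inl[OF K[OF x kx] kx] Inl by simp
      moreover have "k \<le> up (Gen (Inl k)) b"
        using Gen.prems(3) Inl True kx by (cases "x = bot") (auto simp: bot_unique)
      ultimately show ?thesis by blast
    next
      case False
      then have "x \<noteq> bot" by blast
      \<comment> \<open>Any nonzero compact part of the generator has cover \<open>top\<close> on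
        the other side, whatever \<open>k\<close> is.\<close>
      then obtain k' where k': "k' \<in> insert top K" "k' \<le> x" "k' \<noteq> bot"
        using nonbot_compact[of x] x by blast
      moreover have "k' \<noteq> top" using x k'(2) top_notin top_unique by metis
      ultimately have "k' \<in> K" by blast
      then show ?thesis using k'(2,3) Inl False by (intro exI[of _ "Gen (Inl k')"]) (simp add: apx.Inl)
    qed
  next
    case (Inr x)
    then have x: "x \<in> A" using Gen.prems(1) by simp
    show ?thesis
    proof (cases "b \<and> x \<noteq> bot")
      case False
      then have kx: "k \<le> x" using Gen.prems(3) Inr by (auto split: if_splits)
      then have "apx (Gen (Inr k)) (Gen g)" using apx.Inr[OF K[OF x kx] kx] Inr by simp
      moreover have "k \<le> up (Gen (Inr k)) b"
        using Gen.prems(3) Inr False kx by (cases "x = bot") (auto simp: bot_unique)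
      ultimately show ?thesis by blast
    next
      case True
      then have "x \<noteq> bot" by blast
      then obtain k' where k': "k' \<in> insert top K" "k' \<le> x" "k' \<noteq> bot"
        using nonbot_compact[of x] x by blast
      moreover have "k' \<noteq> top" using x k'(2) top_notin top_unique by metis
      ultimately have "k' \<in> K" by blast
      then show ?thesis using k'(2,3) Inr True by (intro exI[of _ "Gen (Inr k')"]) (simp add: apx.Inr)
    qed
  qed
next
  case (LMeet s t)
  have st: "s \<in> terms A" "t \<in> terms A" using LMeet by auto
  obtain c0 d0 where 0: "apx c0 s" "apx d0 t" using apx_ex by blast
  show ?case
  proof (cases "up s b = top \<or> up t b = top")
    case True
    then show ?thesis
    proof
      assume "up s b = top"
      then obtain c where "apx c s" "k \<le> up c b"
        using LMeet.IH(1)[OF st(1) LMeet.prems(2), of b] by auto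
      then show ?thesis using 0 by (intro exI[of _ "LMeet c d0"]) (auto intro: apx.Meet le_supI1)
    next
      assume "up t b = top"
      then obtain d where "apx d t" "k \<le> up d b"
        using LMeet.IH(2)[OF st(2) LMeet.prems(2), of b] by auto
      then show ?thesis using 0 by (intro exI[of _ "LMeet c0 d"]) (auto intro: apx.Meet le_supI2)
    qed
  next
    case False
    then have A: "up s b \<in> A" "up t b \<in> A" using up_in st by (metis insert_iff)+
    then have "sup (up s b) (up t b) \<noteq> top" using sup_in top_notin by metis
    then have "k \<in> K" using LMeet.prems top_unique by auto
    then obtain k1 k2 where k: "k1 \<in> K" "k2 \<in> K" "k1 \<le> up s b" "k2 \<le> up t b" "k \<le> sup k1 k2"
      using compact[OF _ A, of k] LMeet.prems(3) unfolding up.simps by blast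
    then obtain c d where "apx c s" "k1 \<le> up c b" "apx d t" "k2 \<le> up d b"
      using LMeet.IH(1)[OF st(1), of k1 b] LMeet.IH(2)[OF st(2), of k2 b] by blast
    then show ?thesis using k
      by (intro exI[of _ "LMeet c d"]) (auto intro: apx.Meet order_trans[OF k(5) sup_mono])
  qed
next
  case (LJoin s t)
  have st: "s \<in> terms A" "t \<in> terms A" using LJoin by auto
  let ?z = "inf (up s (\<not> b)) (up t (\<not> b))"
  show ?case
  proof (cases "?z = bot")
    case True
    then have "k \<le> bot" using LJoin.prems(3) by simp
    then have "k = bot" by (rule bot.extremum_uniqueI)
    moreover obtain c where "apx c (LJoin s t)" using apx_ex by blast
    ultimately show ?thesis by (intro exI[of _ c]) simp
  next
    case False
    have "?z \<in> insert top A" using up_in[OF st(1), of "\<not> b"] up_in[OF st(2), of "\<not> b"] inf_in by auto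
    \<comment> \<open>An approximation could be zero although the infimum is not. A nonzero
      \<open>k'\<close> below the opposite cover is therefore approximated too, which keeps the
      exceptional clause of \<open>up\<close> from firing.\<close>
    from nonbot_compact[OF this False]
    obtain k' where k': "k' \<in> insert top K" "k' \<le> ?z" "k' \<noteq> bot" .
    have k: "k \<le> up s b" "k \<le> up t b" using LJoin.prems(3) False by simp_all
    have z: "k' \<le> up s (\<not> b)" "k' \<le> up t (\<not> b)" using k'(2) by simp_all
    obtain c1 c2 where c: "apx c1 s" "k' \<le> up c1 (\<not> b)" "apx c2 s" "k \<le> up c2 b"
      using LJoin.IH(1)[OF st(1) k'(1) z(1)] LJoin.IH(1)[OF st(1) LJoin.prems(2) k(1)] by blast
    obtain d1 d2 where d: "apx d1 t" "k' \<le> up d1 (\<not> b)" "apx d2 t" "k \<le> up d2 b"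
      using LJoin.IH(2)[OF st(2) k'(1) z(2)] LJoin.IH(2)[OF st(2) LJoin.prems(2) k(2)] by blast
    obtain c where c': "apx c s" "word_le c1 c" "word_le c2 c" using apx_directed c by blast
    obtain d' where d': "apx d' t" "word_le d1 d'" "word_le d2 d'" using apx_directed d by blast
    have 1: "k' \<le> inf (up c (\<not> b)) (up d' (\<not> b))"
      using order_trans[OF c(2) up_mono[OF c'(2)]] order_trans[OF d(2) up_mono[OF d'(2)]]
      by (rule le_infI)
    have 2: "k \<le> inf (up c b) (up d' b)"
      using order_trans[OF c(4) up_mono[OF c'(3)]] order_trans[OF d(4) up_mono[OF d'(3)]]
      by (rule le_infI)
    have "inf (up c (\<not> b)) (up d' (\<not> b)) \<noteq> bot"
      using 1 k'(3) bot.extremum_uniqueI by metis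
    then have "k \<le> up (LJoin c d') b" using 2 by simp
    then show ?thesis using apx.Join[OF c'(1) d'(1)] by blast
  qed
qed

text \<open>In the cover rule \<open>up k b\<close> is itself compact, so \<open>low_apx\<close>
  applies; the approximations found for the two parts of a supremum are merged by
  directedness.\<close>

lemma word_le_apx: "word_le k t \<Longrightarrow> k \<in> terms K \<Longrightarrow> t \<in> terms A \<Longrightarrow> \<exists>c. apx c t \<and> word_le k c"
proof (induction rule: word_le.induct)
  case (cov k b t)
  have "low t b \<noteq> top" using low_in cov top_notin by metis
  then have "up k b \<in> K" using up_in_K cov top_unique by (metis insert_iff)
  then show ?case using low_apx cov word_le.cov by meson
next
  case (MeetL p r q)
  then obtain c d where cd: "apx c r" "word_le p c" "apx d r" "word_le q d" by auto
  then obtain e where e: "apx e r" "word_le c e" "word_le d e" using apx_directed by blast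
  moreover have "word_le p e" "word_le q e"
    using word_le_trans[of p c e] word_le_trans[of q d e] cd e apx_in_A terms_K_A MeetL.prems by auto
  ultimately show ?case by (auto intro: word_le.MeetL)
next
  case (JoinR r p q)
  then show ?case by (metis apx.Join word_le.JoinR terms_simps(4))
next
  case (MeetR1 r p q)
  then show ?case using apx_ex by (metis apx.Meet word_le.MeetR1 terms_simps(3))
next
  case (MeetR2 r q p)
  then show ?case using apx_ex by (metis apx.Meet word_le.MeetR2 terms_simps(3))
qed (auto intro: word_le.intros)

text \<open>If the last rule used for the approximations of an infimum varies, then by directedness
  one of the six possibilities occurs for all of them.\<close>
lemma word_le_if_apx_le:
  "(\<And>c. apx c s \<Longrightarrow> word_le c t) \<Longrightarrow> s \<in> terms A \<Longrightarrow> t \<in> terms A \<Longrightarrow> word_le s t"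
proof (induction "size s + size t" arbitrary: s t rule: less_induct)
  case less
  note IH = less.hyps and apx = less.prems(1) and s = less.prems(2) and t = less.prems(3)
  show ?case
  proof (cases s)
    case (Gen g)
    show ?thesis
    proof (cases g)
      case (Inl x)
      have "k \<le> low t True" if k: "k \<in> K" "k \<le> x" for k
        using low_mono[OF apx t, of "Gen (Inl k)" True] k Gen Inl by (auto intro: apx.Inl)
      then have "x \<le> low t True" using dense s Gen Inl by auto
      then show ?thesis using Gen Inl by (auto intro: cov[of _ True])
    next
      case (Inr x)
      have "k \<le> low t False" if k: "k \<in> K" "k \<le> x" for k
        using low_mono[OF apx t, of "Gen (Inr k)" False] k Gen Inr by (auto intro: apx.Inr)
      then have "x \<le> low t False" using dense s Gen Inr by auto
      then show ?thesis using Gen Inr by (auto intro: cov[of _ False])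
    qed
  next
    case (LMeet s0 s1)
    obtain d0 d1 where 0: "apx d0 s0" "apx d1 s1" using apx_ex by blast
    have "word_le s0 t"
    proof (rule IH)
      fix c assume c: "apx c s0"
      then have "word_le (LMeet c d1) t" using apx LMeet 0 by (auto intro: apx.Meet)
      then show "word_le c t" using word_le_Meet_iff c 0 apx_in_A t by auto
    qed (use LMeet s t in auto)
    moreover have "word_le s1 t"
    proof (rule IH)
      fix c assume c: "apx c s1"
      then have "word_le (LMeet d0 c) t" using apx LMeet 0 by (auto intro: apx.Meet)
      then show "word_le c t" using word_le_Meet_iff c 0 apx_in_A t by auto
    qed (use LMeet s t in auto)
    ultimately show ?thesis using LMeet by (auto intro: word_le.MeetL)
  next
    case sJ: (LJoin s0 s1)
    show ?thesis
    proof (cases "\<exists>t0 t1. t = LJoin t0 t1")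
      case True
      then obtain t0 t1 where tJ: "t = LJoin t0 t1" by blast
      have "word_le c t0 \<and> word_le c t1" if "apx c s" for c
        using apx[OF that] word_le_Join_iff[of t0 t1 c] that apx_in_A t tJ by auto
      then have "word_le s t0" "word_le s t1"
        using IH[of s t0] IH[of s t1] s t tJ by auto
      then show ?thesis using tJ by (auto intro: word_le.JoinR)
    next
      case False
      define D where "D = (\<lambda>(c0, c1). apx c0 s0 \<and> apx c1 s1)"
      define R where "R = (\<lambda>(c0 :: ('l + 'l) lterm, c1 :: ('l + 'l) lterm) (d0, d1). word_le c0 d0 \<and> word_le c1 d1)"
      define J where "J = (\<lambda>(c0, c1). LJoin c0 c1 :: ('l + 'l) lterm)"
      have D: "apx (J c) s" "fst c \<in> terms A" "snd c \<in> terms A" "J c \<in> terms A" if "D c" for c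
        using that sJ apx_in_A by (auto simp: D_def J_def intro: apx.Join)
      have dir: "\<exists>e. D e \<and> R c e \<and> R d e" if "D c" "D d" for c d
      proof -
        have c: "apx (fst c) s0" "apx (snd c) s1" and d: "apx (fst d) s0" "apx (snd d) s1"
          using that by (auto simp: D_def split: prod.splits)
        obtain e0 where "apx e0 s0" "word_le (fst c) e0" "word_le (fst d) e0" using apx_directed[OF c(1) d(1)] by blast
        moreover obtain e1 where "apx e1 s1" "word_le (snd c) e1" "word_le (snd d) e1"
          using apx_directed[OF c(2) d(2)] by blast
        ultimately show ?thesis
          by (intro exI[of _ "(e0, e1)"]) (auto simp: D_def R_def split: prod.splits)
      qed
      have RJ: "word_le (J c) (J d)" if "R c d" for c d
        using that by (auto simp: R_def J_def intro: word_le_LJoin_mono)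
      \<comment> \<open>These are the six ways to end a derivation from an infimum to a term that is
        not an infimum: a cover in either factor, either part of the infimum on the left, either
        part of a supremum on the right.\<close>
      define P where "P = (\<lambda>i::nat. \<lambda>c.
         (i = 0 \<and> up (J c) True \<le> low t True) \<or> (i = 1 \<and> up (J c) False \<le> low t False)
         \<or> (i = 2 \<and> word_le (fst c) t) \<or> (i = 3 \<and> word_le (snd c) t)
         \<or> (i = 4 \<and> (\<exists>t0 t1. t = LMeet t0 t1 \<and> word_le (J c) t0))
         \<or> (i = 5 \<and> (\<exists>t0 t1. t = LMeet t0 t1 \<and> word_le (J c) t1)))"
      have anti: "P i c" if "D c" "D e" "R c e" "P i e" for i c e
      proof -
        have word_le: "word_le (J c) (J e)" "word_le (fst c) (fst e)" "word_le (snd c) (snd e)"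
          using that RJ by (auto simp: R_def)
        have tr: "word_le u r" if "word_le u v" "word_le v r" "u \<in> terms A" "v \<in> terms A" "r \<in> terms A" for u v r
          using that word_le_trans by blast
        note t' = D(2-4)[OF that(1)] D(2-4)[OF that(2)]
        have "up (J c) b \<le> low t b" if "up (J e) b \<le> low t b" for b
          using order_trans[OF up_mono[OF word_le(1)] that] .
        moreover have "word_le (J c) r" if "word_le (J e) r" "r \<in> terms A" for r
          using tr[OF word_le(1) that(1)] t' that(2) by blast
        moreover have "word_le (fst c) t" if "word_le (fst e) t" using tr[OF word_le(2) that] t' t by blast
        moreover have "word_le (snd c) t" if "word_le (snd e) t" using tr[OF word_le(3) that] t' t by blast
        ultimately show ?thesis
          using that(4) t unfolding P_def by (elim disjE) auto
      qed
      have cases: "\<exists>i<6. P i c" if c: "D c" for c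
      proof -
        obtain c0 c1 where c0: "c = (c0, c1)" by (cases c)
        have "word_le (LJoin c0 c1) t" using apx[of "J c"] D[OF c] by (simp add: c0 J_def)
        then show ?thesis
        proof cases
          case (cov b)
          then have "up (J c) b \<le> low t b" unfolding c0 J_def by (simp del: up.simps)
          then have "P (if b then 0 else 1) c" unfolding P_def by (cases "b = True") (simp_all del: up.simps)
          moreover have "(if b then 0 else 1) < (6::nat)" by simp
          ultimately show ?thesis by blast
        next
          case (JoinR p q)
          then show ?thesis using False by blast
        next
          case (JoinL1)
          then have "P 2 c" by (simp add: P_def c0)
          then show ?thesis by (intro exI[of _ 2]) simp
        next
          case (JoinL2)
          then have "P 3 c" by (simp add: P_def c0)
          then show ?thesis by (intro exI[of _ 3]) simp
        next
          case (MeetR1)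
          then have "P 4 c" by (simp add: P_def c0 J_def)
          then show ?thesis by (intro exI[of _ 4]) simp
        next
          case (MeetR2)
          then have "P 5 c" by (simp add: P_def c0 J_def)
          then show ?thesis by (intro exI[of _ 5]) simp
        qed
      qed
      have pigeonhole: "\<exists>i<n. \<forall>c. D c \<longrightarrow> P i c"
        if "\<And>c. D c \<Longrightarrow> \<exists>i<n. P i c" for n
        using that
      proof (induction n)
        case 0
        obtain c0 c1 where "apx c0 s0" "apx c1 s1" using apx_ex by blast
        then show ?case using 0[of "(c0, c1)"] by (auto simp: D_def)
      next
        case (Suc n)
        have anti': "\<exists>i<n. P i c" if "D c" "D e" "R c e" "\<exists>i<n. P i e" for c e
          using that anti by blast
        have disj: "(\<exists>i<n. P i c) \<or> P n c" if "D c" for c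
          using Suc.prems[OF that] less_Suc_eq by auto
        have "(\<forall>c. D c \<longrightarrow> (\<exists>i<n. P i c)) \<or> (\<forall>c. D c \<longrightarrow> P n c)"
          by (rule directed_disj[where R = R]) (fact dir anti' anti disj)+
        then show ?case using Suc.IH less_Suc_eq by blast
      qed
      obtain i where i: "i < 6" "\<And>c. D c \<Longrightarrow> P i c" using pigeonhole[OF cases] by blast
      have Pi: "P i (c0, c1)" if "apx c0 s0" "apx c1 s1" for c0 c1
        using i(2)[of "(c0, c1)"] that by (simp add: D_def)
      obtain a0 a1 where ap: "apx a0 s0" "apx a1 s1" using apx_ex by blast
      \<comment> \<open>If the same cover rule works for all approximations, continuity of
        \<open>up\<close> carries it over to \<open>s\<close>: every compact element below
        \<open>up s b\<close> is below \<open>low t b\<close>. The case \<open>top\<close> is tested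
        directly, the others by \<open>dense\<close>.\<close>
      have cov: "up s b \<le> low t b" if up: "\<And>c. D c \<Longrightarrow> up (J c) b \<le> low t b" for b
      proof -
        have below: "k \<le> low t b" if k: "k \<in> insert top K" "k \<le> up s b" for k
        proof -
          obtain c where c: "apx c s" "k \<le> up c b" using up_apx[OF s k] by blast
          from c(1) obtain c0 c1 where "c = J (c0, c1)" "D (c0, c1)"
            unfolding sJ by (rule apx_JoinE) (auto simp: D_def J_def)
          then show ?thesis using up[of "(c0, c1)"] c(2) by (metis order_trans)
        qed
        show ?thesis
        proof (cases "up s b = top")
          case True
          then show ?thesis using below[of top] by simp
        next
          case False
          then have "up s b \<in> A" using up_in s by (metis insert_iff)
          then show ?thesis by (rule dense) (use below in blast)
        qed
      qed
      consider "i = 0" | "i = 1" | "i = 2" | "i = 3" | "i = 4" | "i = 5" using i(1) by linarith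
      then show ?thesis
      proof cases
        case 1
        then show ?thesis using cov[of True] i by (auto simp: P_def intro: word_le.cov)
      next
        case 2
        then show ?thesis using cov[of False] i by (auto simp: P_def intro: word_le.cov)
      next
        case 3
        then have "word_le c t" if "apx c s0" for c
          using Pi[OF that] apx_ex[of s1] by (auto simp: P_def)
        then have "word_le s0 t" using IH[of s0 t] s t sJ by auto
        then show ?thesis using sJ by (auto intro: word_le.JoinL1)
      next
        case 4
        then have "word_le c t" if "apx c s1" for c
          using Pi[OF _ that] apx_ex[of s0] by (auto simp: P_def)
        then have "word_le s1 t" using IH[of s1 t] s t sJ by auto
        then show ?thesis using sJ by (auto intro: word_le.JoinL2)
      next
        case 5
        obtain t0 t1 where tM: "t = LMeet t0 t1"
          using 5 Pi[OF ap] by (auto simp: P_def)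
        have "word_le c t0" if "apx c s" for c
          using that Pi 5 tM sJ by (auto simp: P_def J_def elim!: apx_JoinE)
        then have "word_le s t0" using IH[of s t0] s t tM by auto
        then show ?thesis using tM by (auto intro: word_le.MeetR1)
      next
        case 6
        obtain t0 t1 where tM: "t = LMeet t0 t1"
          using 6 Pi[OF ap] by (auto simp: P_def)
        have "word_le c t1" if "apx c s" for c
          using that Pi 6 tM sJ by (auto simp: P_def J_def elim!: apx_JoinE)
        then have "word_le s t1" using IH[of s t1] s t tM by auto
        then show ?thesis using tM by (auto intro: word_le.MeetR2)
      qed
    qed
  qed
qed

end

section \<open>A metric with values in compact terms\<close>

text \<open>Points record how they were created, so the space is a set of finite trees that can be
  counted. \<open>Base k i\<close> is thought of as lying at distance \<open>k\<close> from an
  invisible centre; the index \<open>i\<close> supplies many copies.\<close>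

datatype ('t, 'i) pt = Base 't 'i | Mid nat "('t, 'i) pt" "('t, 'i) pt" 't 't

primrec level :: "('t, 'i) pt \<Rightarrow> nat" where
  "level (Base k i) = 0"
| "level (Mid j x y s t) = Suc (max (level x) (level y))"

abbreviation zero_term :: "('l::bounded_lattice + 'l) lterm" where
  "zero_term \<equiv> Gen (Inl bot)"

text \<open>For points \<open>x\<close>, \<open>y\<close> whose distance is at most the supremum of \<open>s\<close> and \<open>t\<close>, the three points
  \<open>Mid j x y s t\<close> form a path from \<open>x\<close> to \<open>y\<close> with successive distances \<open>s\<close>, \<open>t\<close>, \<open>s\<close>, \<open>t\<close>.
  A new point is joined to the rest of the space at \<open>anchor\<close>, at distance \<open>offset\<close>.\<close>
primrec anchor :: "nat \<Rightarrow> ('t, 'i) pt \<Rightarrow> ('t, 'i) pt" where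
  "anchor n (Base k i) = Base k i"
| "anchor n (Mid j x y s t) =
     (if max (level x) (level y) < n then Mid j x y s t else if j = 2 then y else x)"

primrec offset :: "nat \<Rightarrow> (('l::bounded_lattice + 'l) lterm, 'i) pt \<Rightarrow> ('l + 'l) lterm" where
  "offset n (Base k i) = zero_term"
| "offset n (Mid j x y s t) =
     (if max (level x) (level y) < n then zero_term
      else if j = 0 then s else if j = 1 then LMeet s t else t)"

text \<open>This is the path metric on the three inner points of a detour, whose steps are
  \<open>t\<close> from 0 to 1 and \<open>s\<close> from 1 to 2.\<close>

definition detour_dist :: "nat \<Rightarrow> nat \<Rightarrow> ('l::bounded_lattice + 'l) lterm \<Rightarrow> ('l + 'l) lterm \<Rightarrow> ('l + 'l) lterm"
  where "detour_dist j j' s t =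
    (if j = j' then zero_term else if j \<noteq> 2 \<and> j' \<noteq> 2 then t
     else if j \<noteq> 0 \<and> j' \<noteq> 0 then s else LMeet s t)"

definition detour :: "(('l::bounded_lattice + 'l) lterm, 'i) pt \<Rightarrow> (('l + 'l) lterm, 'i) pt
    \<Rightarrow> ('l + 'l) lterm option" where
  "detour z w = (case z of Base k i \<Rightarrow> None | Mid j x y s t \<Rightarrow>
     (case w of Base k i \<Rightarrow> None | Mid j' x' y' s' t' \<Rightarrow>
       if x = x' \<and> y = y' \<and> s = s' \<and> t = t' then Some (detour_dist j j' s t) else None))"

text \<open>All points of level \<open>Suc n\<close> are attached at once to the finished space of
  level \<open>n\<close>, and different detours meet only through their anchors. The values at
  \<open>Mid\<close> points in stage 0 are dummies.\<close>

primrec dist_upto :: "nat \<Rightarrow> (('l::bounded_lattice + 'l) lterm, 'i) pt \<Rightarrow> (('l + 'l) lterm, 'i) pt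
    \<Rightarrow> ('l + 'l) lterm" where
  "dist_upto 0 z w = (case z of Mid j x y s t \<Rightarrow> zero_term | Base k i \<Rightarrow>
     (case w of Mid j x y s t \<Rightarrow> zero_term | Base k' i' \<Rightarrow>
       if k = k' \<and> i = i' then zero_term else LMeet k k'))"
| "dist_upto (Suc n) z w =
     (if level z \<le> n \<and> level w \<le> n then dist_upto n z w
      else case detour z w of Some u \<Rightarrow> u
        | None \<Rightarrow> LMeet (LMeet (offset n z) (dist_upto n (anchor n z) (anchor n w))) (offset n w))"

definition dist :: "(('l::bounded_lattice + 'l) lterm, 'i) pt \<Rightarrow> (('l + 'l) lterm, 'i) pt
    \<Rightarrow> ('l + 'l) lterm" where
  "dist z w = dist_upto (max (level z) (level w)) z w"

lemma dist_upto_stable: "level z \<le> n \<Longrightarrow> level w \<le> n \<Longrightarrow> dist_upto n z w = dist z w"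
proof (induction n)
  case (Suc n)
  show ?case
  proof (cases "level z \<le> n \<and> level w \<le> n")
    case True
    then show ?thesis using Suc.IH by simp
  next
    case False
    then have "max (level z) (level w) = Suc n" using Suc.prems by (auto simp: max_def)
    then show ?thesis by (simp only: dist_def)
  qed
qed (simp add: dist_def)

lemma offset_old [simp]: "level z \<le> n \<Longrightarrow> offset n z = zero_term"
  by (cases z) auto

lemma anchor_old [simp]: "level z \<le> n \<Longrightarrow> anchor n z = z"
  by (cases z) auto

lemma level_anchor: "level z \<le> Suc n \<Longrightarrow> level (anchor n z) \<le> n"
  by (cases z) auto

lemma level_detour: "detour z w \<noteq> None \<Longrightarrow> level z = level w"
  by (auto simp: detour_def split: pt.splits if_splits)

context compact_sublattice
begin

text \<open>The condition on \<open>Mid\<close> says that the detour does not shorten the distance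
  from \<open>x\<close> to \<open>y\<close>. As \<open>dist\<close> is defined on all trees
  beforehand, no simultaneous recursion is needed.\<close>

inductive_set points :: "'i set \<Rightarrow> (('l + 'l) lterm, 'i) pt set" for I :: "'i set" where
  Base: "k \<in> terms K \<Longrightarrow> i \<in> I \<Longrightarrow> Base k i \<in> points I"
| Mid: "j < 3 \<Longrightarrow> x \<in> points I \<Longrightarrow> y \<in> points I \<Longrightarrow> s \<in> terms K \<Longrightarrow> t \<in> terms K
    \<Longrightarrow> word_le (dist x y) (LMeet s t) \<Longrightarrow> Mid j x y s t \<in> points I"

inductive_cases points_BaseE: "Base k i \<in> points I"
inductive_cases points_MidE: "Mid j x y s t \<in> points I"

lemma detour_dist_in: "s \<in> terms K \<Longrightarrow> t \<in> terms K \<Longrightarrow> detour_dist j j' s t \<in> terms K"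
  by (simp add: detour_dist_def bot_in_K)

lemma anchor_in: "z \<in> points I \<Longrightarrow> anchor n z \<in> points I"
  by (cases z) (auto elim: points_MidE)

lemma offset_in: "z \<in> points I \<Longrightarrow> offset n z \<in> terms K"
  by (cases z) (auto elim: points_MidE simp: bot_in_K)

lemma dist_upto_in: "z \<in> points I \<Longrightarrow> w \<in> points I \<Longrightarrow> dist_upto n z w \<in> terms K"
proof (induction n arbitrary: z w)
  case 0
  then show ?case by (auto simp: bot_in_K split: pt.splits elim: points_BaseE)
next
  case (Suc n)
  have "u \<in> terms K" if "detour z w = Some u" for u
    using that Suc.prems by (auto simp: detour_def detour_dist_in split: pt.splits if_splits elim: points_MidE)
  moreover have "dist_upto n (anchor n z) (anchor n w) \<in> terms K" "dist_upto n z w \<in> terms K"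
    using Suc by (auto intro: anchor_in)
  ultimately show ?case using Suc.prems by (auto simp: offset_in split: option.splits)
qed

lemma dist_in: "z \<in> points I \<Longrightarrow> w \<in> points I \<Longrightarrow> dist z w \<in> terms K"
  by (simp add: dist_def dist_upto_in)

text \<open>The metric axioms for \<open>dist_upto n\<close>, tested against every upper bound \<open>r\<close>.\<close>
lemma equiv_dist_upto:
  fixes I :: "'i set"
  assumes r: "r \<in> terms A"
  shows "equiv {z \<in> points I. level z \<le> n}
    {(z, w). z \<in> points I \<and> w \<in> points I \<and> level z \<le> n \<and> level w \<le> n \<and> word_le (dist_upto n z w) r}"
proof (induction n)
  case 0
  have lev0: "\<exists>k i. z = Base k i \<and> k \<in> terms A" if "z \<in> points I" "level z \<le> 0" for z
    using that by (cases z) (auto elim: points_BaseE intro: terms_K_A)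
  have [simp]: "word_le zero_term r" by (rule word_le_Gen_bot)
  define Y where "Y = {z \<in> points I. level z \<le> 0}"
  define E where "E = (\<lambda>z w :: (('l + 'l) lterm, 'i) pt. word_le (dist_upto 0 z w) r)"
  define B where "B = (\<lambda>z :: (('l + 'l) lterm, 'i) pt. case z of Base k i \<Rightarrow> word_le k r | _ \<Rightarrow> False)"
  \<comment> \<open>The base points within \<open>r\<close> of the invisible centre form one class,
    and all other base points are singletons.\<close>
  have E: "E z w \<longleftrightarrow> z = w \<or> B z \<and> B w" if zw: "z \<in> Y" "w \<in> Y" for z w
  proof -
    obtain k i where z: "z = Base k i" "k \<in> terms A" using lev0[of z] zw by (auto simp: Y_def)
    obtain k' i' where w: "w = Base k' i'" "k' \<in> terms A" using lev0[of w] zw by (auto simp: Y_def)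
    show ?thesis using r z(2) w(2) unfolding E_def B_def z(1) w(1) by (auto simp: word_le_Meet_iff)
  qed
  have "equiv Y {(z, w). z \<in> Y \<and> w \<in> Y \<and> E z w}"
  proof (rule equivI)
    show "refl_on Y {(z, w). z \<in> Y \<and> w \<in> Y \<and> E z w}" by (rule refl_onI) (simp add: E)
    show "sym {(z, w). z \<in> Y \<and> w \<in> Y \<and> E z w}" by (rule symI) (auto simp: E)
    show "trans {(z, w). z \<in> Y \<and> w \<in> Y \<and> E z w}" by (rule transI) (auto simp: E)
  qed blast
  also have "{(z, w). z \<in> Y \<and> w \<in> Y \<and> E z w} = {(z, w). z \<in> points I \<and> w \<in> points I
      \<and> level z \<le> 0 \<and> level w \<le> 0 \<and> word_le (dist_upto 0 z w) r}"
    by (auto simp: Y_def E_def)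
  finally show ?case by (simp only: Y_def)
next
  case (Suc n)
  define Y where "Y = {z \<in> points I. level z \<le> Suc n}"
  define D where "D = (\<lambda>z w :: (('l + 'l) lterm, 'i) pt. word_le (dist_upto n z w) r)"
  define E where "E = (\<lambda>z w :: (('l + 'l) lterm, 'i) pt. word_le (dist_upto (Suc n) z w) r)"
  \<comment> \<open>\<open>R\<close> describes connections within \<open>r\<close> through the
    anchors, and \<open>G\<close> the pairs on a common new detour, where the distance bypasses the
    anchors. Outside \<open>G\<close> the relation \<open>E\<close> agrees with
    \<open>R\<close>.\<close>
  define R where "R = (\<lambda>z w :: (('l + 'l) lterm, 'i) pt. word_le (offset n z) r \<and> D (anchor n z) (anchor n w) \<and> word_le (offset n w) r)"
  define G where "G = (\<lambda>z w :: (('l + 'l) lterm, 'i) pt. n < level z \<and> detour z w \<noteq> None)"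
  have [simp]: "word_le zero_term r" by (rule word_le_Gen_bot)
  define S where "S = {(z, w). z \<in> points I \<and> w \<in> points I \<and> level z \<le> n \<and> level w \<le> n \<and> D z w}"
  have S: "refl_on {z \<in> points I. level z \<le> n} S" "sym S" "trans S"
    using Suc.IH unfolding equiv_def S_def D_def by simp_all
  have Drefl: "D z z" if "z \<in> points I" "level z \<le> n" for z
    using refl_onD[OF S(1), of z] that by (simp add: S_def)
  have Dsym: "D w z" if "z \<in> points I" "level z \<le> n" "w \<in> points I" "level w \<le> n" "D z w" for z w
    using symD[OF S(2), of z w] that by (simp add: S_def)
  have Dtrans: "D z v" if "z \<in> points I" "level z \<le> n" "w \<in> points I" "level w \<le> n" "v \<in> points I" "level v \<le> n"
    "D z w" "D w v" for z w v
    using transD[OF S(3), of z w v] that by (simp add: S_def)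
  have anc: "anchor n z \<in> points I" "level (anchor n z) \<le> n" if "z \<in> Y" for z
    using that by (auto simp: Y_def intro: anchor_in level_anchor)
  have Rsym: "R w z" if "z \<in> Y" "w \<in> Y" "R z w" for z w
    using that(3) Dsym[OF anc[OF that(1)] anc[OF that(2)]] by (simp add: R_def)
  have Rtrans: "R z v" if "z \<in> Y" "w \<in> Y" "v \<in> Y" "R z w" "R w v" for z w v
    using that(4,5) Dtrans[OF anc[OF that(1)] anc[OF that(2)] anc[OF that(3)]] by (simp add: R_def)
  have E_R: "E z w \<longleftrightarrow> R z w" if "z \<in> Y" "w \<in> Y" "\<not> G z w" for z w
  proof (cases "level z \<le> n \<and> level w \<le> n")
    case True
    then show ?thesis by (simp add: E_def R_def D_def)
  next
    case False
    then have "detour z w = None" using that(3) level_detour[of z w] by (cases "detour z w") (auto simp: G_def)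
    moreover have "offset n z \<in> terms A" "offset n w \<in> terms A" "dist_upto n (anchor n z) (anchor n w) \<in> terms A"
      using that by (auto simp: Y_def intro!: offset_in dist_upto_in anchor_in terms_K_A)
    ultimately show ?thesis using False r by (simp add: E_def R_def D_def word_le_Meet_iff)
  qed
  have G: "\<exists>j j' x y s t. z = Mid j x y s t \<and> w = Mid j' x y s t \<and> j < 3 \<and> j' < 3
      \<and> x \<in> points I \<and> y \<in> points I \<and> level x \<le> n \<and> level y \<le> n
      \<and> (word_le s r \<and> word_le t r \<longrightarrow> D x y \<and> D y x) \<and> \<not> max (level x) (level y) < n
      \<and> s \<in> terms A \<and> t \<in> terms A
      \<and> (E z w \<longleftrightarrow> word_le (detour_dist j j' s t) r)" if zw: "z \<in> Y" "w \<in> Y" "G z w" for z w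
  proof -
    from zw(3) obtain j j' x y s t where eq: "z = Mid j x y s t" "w = Mid j' x y s t"
        "detour z w = Some (detour_dist j j' s t)"
      by (auto simp: G_def detour_def split: pt.splits if_splits)
    then have z: "j < 3" "x \<in> points I" "y \<in> points I" "s \<in> terms K" "t \<in> terms K" "word_le (dist x y) (LMeet s t)"
      and w: "j' < 3" using zw by (auto simp: Y_def elim: points_MidE)
    have level: "level x \<le> n" "level y \<le> n" "\<not> max (level x) (level y) < n"
      using zw eq by (auto simp: Y_def G_def)
    have "D x y" if "word_le s r" "word_le t r"
    proof -
      have "word_le (LMeet s t) r" using that by (rule MeetL)
      then have "word_le (dist x y) r"
        using word_le_trans[OF z(6) _ _ _ r] z terms_K_A[OF dist_in[OF z(2,3)]] terms_K_A by simp
      then show ?thesis using dist_upto_stable[OF level(1,2)] by (simp add: D_def)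
    qed
    then have D: "word_le s r \<and> word_le t r \<longrightarrow> D x y \<and> D y x" using Dsym z level by blast
    have E: "E z w \<longleftrightarrow> word_le (detour_dist j j' s t) r" using eq(3) zw(3) by (simp add: E_def G_def)
    have st: "s \<in> terms A" "t \<in> terms A" using z terms_K_A by blast+
    show ?thesis by (intro exI conjI) (fact eq(1,2) z(1-3) w level D E st)+
  qed
  have detour_dist: "word_le (detour_dist j j' s t) r \<longleftrightarrow> (if j = j' then True else if j \<noteq> 2 \<and> j' \<noteq> 2 then word_le t r
     else if j \<noteq> 0 \<and> j' \<noteq> 0 then word_le s r else word_le s r \<and> word_le t r)"
    if "s \<in> terms A" "t \<in> terms A" for j j' :: nat and s t
    using that r by (simp add: detour_dist_def word_le_Meet_iff)
  have lt3: "j = 0 \<or> j = 1 \<or> j = 2" if "j < (3::nat)" for j using that by linarith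
  \<comment> \<open>A round trip through the anchors is never shorter than the direct step: the
    offsets of two different points of a detour together always involve both \<open>s\<close> and
    \<open>t\<close>.\<close>
  have G_E: "E z w" if "z \<in> Y" "w \<in> Y" "G z w" "R z w" for z w
    using G[OF that(1-3)] that(4) by (auto simp: detour_dist R_def word_le_Meet_iff r dest!: lt3)
  \<comment> \<open>A step inside a detour is absorbed by a connection that leaves it. If this
    changes the anchor from one end to the other, both \<open>s\<close> and \<open>t\<close> are
    below \<open>r\<close>, and the condition on \<open>Mid\<close> gives
    \<open>D x y\<close>.\<close>
  have E_R_trans: "R z v" if zwv: "z \<in> Y" "w \<in> Y" "v \<in> Y" "G z w" "E z w" "R w v" for z w v
  proof -
    obtain j j' x y s t where g: "z = Mid j x y s t" "w = Mid j' x y s t" "j < 3" "j' < 3"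
      "x \<in> points I" "y \<in> points I" "level x \<le> n" "level y \<le> n"
      "word_le s r \<and> word_le t r \<longrightarrow> D x y \<and> D y x" "\<not> max (level x) (level y) < n"
      "s \<in> terms A" "t \<in> terms A" "E z w \<longleftrightarrow> word_le (detour_dist j j' s t) r"
      using G[OF zwv(1,2,4)] by (elim exE conjE) (rule that)
    then have g13: "word_le (detour_dist j j' s t) r" using zwv(5) by blast
    have "word_le (offset n w) r" using zwv(6) by (simp add: R_def)
    then have "word_le (offset n z) r \<and> D (anchor n z) (anchor n w)"
      using g(3,4,9-12) g13 r Drefl[OF g(5,7)] Drefl[OF g(6,8)] unfolding g(1,2)
      by (auto simp: detour_dist word_le_Meet_iff dest!: lt3)
    then have "R z w" using \<open>word_le (offset n w) r\<close> by (simp add: R_def)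
    then show ?thesis using Rtrans zwv by blast
  qed
  have Gsym: "G w z" if "G z w" for z w
    using that by (auto simp: G_def detour_def split: pt.splits if_splits)
  have Gtrans: "G z v" if "G z w" "G w v" for z w v
    using that by (auto simp: G_def detour_def split: pt.splits if_splits)
  have detour_dist_sym: "detour_dist j j' s t = detour_dist j' j s t" for j j' and s t :: "('l + 'l) lterm"
    by (auto simp: detour_dist_def)
  have G_Esym: "E w z" if zw: "z \<in> Y" "w \<in> Y" "G z w" "E z w" for z w
    using G[OF zw(1-3)] G[OF zw(2,1) Gsym[OF zw(3)]] zw(4) by (auto simp: detour_dist_sym)
  have Erefl: "E z z" if "z \<in> Y" for z
  proof (cases "level z \<le> n")
    case True
    then show ?thesis using Drefl that by (simp add: E_def D_def Y_def)
  next
    case False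
    then have "G z z" using that by (cases z) (auto simp: G_def detour_def)
    then show ?thesis using G[OF that that] by (auto simp: detour_dist_def)
  qed
  have Esym: "E w z" if zw: "z \<in> Y" "w \<in> Y" "E z w" for z w
  proof (cases "G z w")
    case True
    then show ?thesis using G_Esym zw by blast
  next
    case False
    then have "\<not> G w z" using Gsym by blast
    then show ?thesis using False zw E_R Rsym by blast
  qed
  have Etrans: "E z v" if zwv: "z \<in> Y" "w \<in> Y" "v \<in> Y" "E z w" "E w v" for z w v
  proof (cases "G z w")
    case zw: True
    show ?thesis
    proof (cases "G w v")
      case wv: True
      obtain j j' x y s t where zw': "z = Mid j x y s t" "w = Mid j' x y s t" "j < 3" "j' < 3"
        "\<not> max (level x) (level y) < n" "s \<in> terms A" "t \<in> terms A" "E z w \<longleftrightarrow> word_le (detour_dist j j' s t) r"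
        using G[OF zwv(1,2) zw] by (elim exE conjE) (rule that)
      obtain j2 where v: "v = Mid j2 x y s t" "j2 < 3"
        using G[OF zwv(2,3) wv] zw'(2) by (elim exE conjE) (simp add: that)
      have E: "E (Mid j x y s t) (Mid j' x y s t) \<longleftrightarrow> word_le (detour_dist j j' s t) r" for j j'
      proof -
        have "\<not> level (Mid j x y s t) \<le> n" using zw'(5) by (auto simp: max_def split: if_splits)
        then show ?thesis by (simp add: E_def detour_def del: level.simps)
      qed
      show ?thesis using zwv(4,5) zw'(3,4,6,7) v(2) unfolding zw'(1,2) v(1) E
        by (auto simp: detour_dist dest!: lt3)
    next
      case wv: False
      then have "\<not> G z v" using Gtrans Gsym zw by blast
      moreover have "R w v" using wv zwv E_R by blast
      ultimately show ?thesis using E_R_trans[of z w v] zwv zw E_R by blast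
    qed
  next
    case zw: False
    then have R: "R z w" using zwv E_R by blast
    show ?thesis
    proof (cases "G w v")
      case wv: True
      then have "\<not> G z v" using Gtrans Gsym zw by blast
      moreover have "R v z" using E_R_trans[of v w z] Gsym[OF wv] Esym R Rsym zwv by blast
      ultimately show ?thesis using E_R Rsym zwv by blast
    next
      case False
      then have "R z v" using E_R R Rtrans zwv by blast
      then show ?thesis using G_E E_R zwv by blast
    qed
  qed
  have "equiv Y {(z, w). z \<in> Y \<and> w \<in> Y \<and> E z w}"
  proof (rule equivI)
    show "refl_on Y {(z, w). z \<in> Y \<and> w \<in> Y \<and> E z w}" by (rule refl_onI) (use Erefl in blast)
    show "sym {(z, w). z \<in> Y \<and> w \<in> Y \<and> E z w}" by (rule symI) (use Esym in blast)
    show "trans {(z, w). z \<in> Y \<and> w \<in> Y \<and> E z w}" by (rule transI) (use Etrans in blast)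
  qed blast
  also have "{(z, w). z \<in> Y \<and> w \<in> Y \<and> E z w} = {(z, w). z \<in> points I \<and> w \<in> points I
      \<and> level z \<le> Suc n \<and> level w \<le> Suc n \<and> word_le (dist_upto (Suc n) z w) r}"
    by (auto simp: Y_def E_def)
  finally show ?case by (simp only: Y_def)
qed

definition rho :: "'i set \<Rightarrow> ('l + 'l) lterm \<Rightarrow> (('l + 'l) lterm, 'i) pt rel" where
  "rho I r = {(z, w). z \<in> points I \<and> w \<in> points I \<and> word_le (dist z w) r}"

lemma equiv_rho:
  assumes r: "r \<in> terms A"
  shows "equiv (points I) (rho I r)"
proof -
  let ?E = "\<lambda>n. {(z, w). z \<in> points I \<and> w \<in> points I \<and> level z \<le> n \<and> level w \<le> n \<and> word_le (dist_upto n z w) r}"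
  have E: "(z, w) \<in> rho I r \<longleftrightarrow> (z, w) \<in> ?E n" if "level z \<le> n" "level w \<le> n" for z w n
    using that by (auto simp: rho_def dist_upto_stable)
  show ?thesis
  proof (rule equivI)
    show "refl_on (points I) (rho I r)"
    proof (rule refl_onI)
      fix z assume "z \<in> points I"
      then show "(z, z) \<in> rho I r"
        using equiv_dist_upto[OF r, of I "level z"] E[of z "level z" z] unfolding equiv_def refl_on_def by simp
    qed
    show "sym (rho I r)"
    proof (rule symI)
      fix z w assume "(z, w) \<in> rho I r"
      then show "(w, z) \<in> rho I r"
        using equiv_dist_upto[OF r, of I "max (level z) (level w)"]
          E[of z "max (level z) (level w)" w] E[of w "max (level z) (level w)" z]
        unfolding equiv_def by (meson max.cobounded1 max.cobounded2 symD)
    qed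
    show "trans (rho I r)"
    proof (rule transI)
      fix z w v assume *: "(z, w) \<in> rho I r" "(w, v) \<in> rho I r"
      define n where "n = max (level z) (max (level w) (level v))"
      have n: "level z \<le> n" "level w \<le> n" "level v \<le> n" by (auto simp: n_def)
      have "trans (?E n)" using equiv_dist_upto[OF r, of I n] unfolding equiv_def by simp
      moreover have "(z, w) \<in> ?E n" "(w, v) \<in> ?E n" using * E n by blast+
      ultimately have "(z, v) \<in> ?E n" by (rule transD)
      then show "(z, v) \<in> rho I r" using E n by blast
    qed
  qed (auto simp: rho_def)
qed

lemma rho_Join: "s \<in> terms A \<Longrightarrow> t \<in> terms A \<Longrightarrow> rho I (LJoin s t) = rho I s \<inter> rho I t"
  by (auto simp: rho_def word_le_Join_iff dist_in terms_K_A)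

lemma rho_mono: "word_le s t \<Longrightarrow> s \<in> terms A \<Longrightarrow> t \<in> terms A \<Longrightarrow> rho I s \<subseteq> rho I t"
  by (auto simp: rho_def intro: word_le_trans dist_in terms_K_A)

lemma rho_Base:
  assumes "k \<in> terms K" "i \<in> I" "i' \<in> I" "t \<in> terms A"
  shows "(Base k i, Base zero_term i') \<in> rho I t \<longleftrightarrow> (k = zero_term \<and> i = i') \<or> word_le k t"
  using assms terms_K_A bot_in_K bot_in word_le_Gen_bot
  by (auto simp: rho_def dist_def word_le_Meet_iff intro!: points.Base)

lemma rho_Base_Base:
  assumes "k \<in> terms K" "i \<in> I" "i' \<in> I" "i \<noteq> i'" "t \<in> terms A"
  shows "(Base k i, Base k i') \<in> rho I t \<longleftrightarrow> word_le k t"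
  using assms terms_K_A by (auto simp: rho_def dist_def word_le_Meet_iff intro!: points.Base)

text \<open>Every compact term is realized as a distance, up to equivalence, between a base point
  and a copy of zero. Testing the approximations of \<open>s\<close> in this way suffices by
  \<open>word_le_if_apx_le\<close>.\<close>

lemma rho_subset_iff:
  assumes "I \<noteq> {}" "s \<in> terms A" "t \<in> terms A"
  shows "rho I s \<subseteq> rho I t \<longleftrightarrow> word_le s t"
proof
  assume sub: "rho I s \<subseteq> rho I t"
  obtain i where i: "i \<in> I" using assms by blast
  show "word_le s t"
  proof (rule word_le_if_apx_le)
    fix c assume c: "apx c s"
    then have "(Base c i, Base zero_term i) \<in> rho I s"
      using rho_Base[OF apx_in i i assms(2)] apx_le by blast
    then have "(Base c i, Base zero_term i) \<in> rho I t" using sub by blast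
    then show "word_le c t" using rho_Base[OF apx_in[OF c] i i assms(3)] word_le_Gen_bot by blast
  qed (use assms in auto)
qed (use rho_mono assms in blast)

lemma rho_path:
  assumes x: "x \<in> points I" and y: "y \<in> points I" and s: "s \<in> terms K" and t: "t \<in> terms K"
    and word_le: "word_le (dist x y) (LMeet s t)"
  shows "(x, Mid 0 x y s t) \<in> rho I s" "(Mid 0 x y s t, Mid 1 x y s t) \<in> rho I t"
    "(Mid 1 x y s t, Mid 2 x y s t) \<in> rho I s" "(Mid 2 x y s t, y) \<in> rho I t"
proof -
  define n where "n = max (level x) (level y)"
  have points: "Mid j x y s t \<in> points I" if "j < 3" for j using that assms by (auto intro: points.Mid)
  have A: "s \<in> terms A" "t \<in> terms A" using s t terms_K_A by auto
  have level: "level x \<le> n" "level y \<le> n" "level (Mid j x y s t) = Suc n" for j by (auto simp: n_def)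
  have detour: "detour x (Mid 0 x y s t) = None" "detour (Mid 2 x y s t) y = None"
    using level_detour[of x "Mid 0 x y s t"] level_detour[of "Mid 2 x y s t" y] level(1,2) level(3)[of 0] level(3)[of 2]
    by (metis Suc_n_not_le_n)+
  have refl: "word_le (dist_upto n z z) r" if "z \<in> points I" "r \<in> terms A" "level z \<le> n" for z r
    using equiv_dist_upto[OF that(2), of I n] that unfolding equiv_def refl_on_def by simp
  have offset: "offset n (Mid 0 x y s t) = s" "offset n (Mid 2 x y s t) = t"
    "anchor n (Mid 0 x y s t) = x" "anchor n (Mid 2 x y s t) = y" by (simp_all add: n_def)
  have max: "max (level x) (level (Mid j x y s t)) = Suc n" "max (level (Mid j x y s t)) (level y) = Suc n" for j
    using level by (simp_all del: level.simps)
  have "dist x (Mid 0 x y s t) = LMeet (LMeet zero_term (dist_upto n x x)) s"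
    unfolding dist_def max dist_upto.simps using level detour offset by (simp del: level.simps offset.simps anchor.simps)
  then have "word_le (dist x (Mid 0 x y s t)) s"
    using refl[OF x A(1) level(1)] by (simp add: MeetL word_le_Gen_bot word_le_refl)
  then show "(x, Mid 0 x y s t) \<in> rho I s" using points x by (simp add: rho_def)
  have "dist (Mid 2 x y s t) y = LMeet (LMeet t (dist_upto n y y)) zero_term"
    unfolding dist_def max dist_upto.simps using level detour offset by (simp del: level.simps offset.simps anchor.simps)
  then have "word_le (dist (Mid 2 x y s t) y) t"
    using refl[OF y A(2) level(2)] by (simp add: MeetL word_le_Gen_bot word_le_refl)
  then show "(Mid 2 x y s t, y) \<in> rho I t" using points y by (simp add: rho_def)
  have d: "dist (Mid j x y s t) (Mid j' x y s t) = detour_dist j j' s t" for j j'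
    using level by (simp add: dist_def detour_def del: level.simps)
  show "(Mid 0 x y s t, Mid 1 x y s t) \<in> rho I t" "(Mid 1 x y s t, Mid 2 x y s t) \<in> rho I s"
    using points by (auto simp: rho_def d detour_dist_def word_le_refl)
qed

text \<open>Detours exist only for compact labels, while \<open>s\<close> and \<open>t\<close> are
  arbitrary. Since \<open>dist x y\<close> is compact, \<open>word_le_apx\<close> replaces them by
  approximations \<open>c1\<close> and \<open>c2\<close>, whose detour stays inside the relations of
  \<open>s\<close> and \<open>t\<close>.\<close>

lemma rho_Meet:
  assumes s: "s \<in> terms A" and t: "t \<in> terms A"
  shows "rho I (LMeet s t) = trancl (rho I s \<union> rho I t)"
proof
  show "rho I (LMeet s t) \<subseteq> trancl (rho I s \<union> rho I t)"
  proof (rule subrelI)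
    fix x y assume xy: "(x, y) \<in> rho I (LMeet s t)"
    then have points: "x \<in> points I" "y \<in> points I" "word_le (dist x y) (LMeet s t)" by (auto simp: rho_def)
    from word_le_apx[OF points(3) dist_in[OF points(1,2)]] s t
    obtain c where c: "apx c (LMeet s t)" "word_le (dist x y) c" by auto
    then obtain c1 c2 where c12: "c = LMeet c1 c2" "apx c1 s" "apx c2 t" by (auto elim: apx_MeetE)
    have sub: "rho I c1 \<subseteq> rho I s" "rho I c2 \<subseteq> rho I t"
      using rho_mono apx_le apx_in_A c12 s t by blast+
    note path = rho_path[OF points(1,2) apx_in[OF c12(2)] apx_in[OF c12(3)] c(2)[unfolded c12(1)]]
    have "(x, Mid 0 x y c1 c2) \<in> trancl (rho I s \<union> rho I t)"
      "(Mid 0 x y c1 c2, Mid 1 x y c1 c2) \<in> trancl (rho I s \<union> rho I t)"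
      "(Mid 1 x y c1 c2, Mid 2 x y c1 c2) \<in> trancl (rho I s \<union> rho I t)"
      "(Mid 2 x y c1 c2, y) \<in> trancl (rho I s \<union> rho I t)"
      using path sub by blast+
    then show "(x, y) \<in> trancl (rho I s \<union> rho I t)" by (meson trancl_trans)
  qed
  have sub: "rho I s \<subseteq> rho I (LMeet s t)" "rho I t \<subseteq> rho I (LMeet s t)"
    by (rule rho_mono; simp add: s t MeetR1 MeetR2 word_le_refl)+
  have "trans (rho I (LMeet s t))"
    by (rule equivE[OF equiv_rho]) (use s t in simp_all)
  then have tr: "trancl (rho I (LMeet s t)) = rho I (LMeet s t)" by (rule trancl_id)
  have "(x, y) \<in> trancl (rho I (LMeet s t))" if "(x, y) \<in> trancl (rho I s \<union> rho I t)" for x y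
    by (rule trancl_mono[OF that Un_least[OF sub]])
  then show "trancl (rho I s \<union> rho I t) \<subseteq> rho I (LMeet s t)" unfolding tr by (rule subrelI)
qed

end

section \<open>Representation on a set of given infinite cardinality\<close>

primrec enc_term :: "('a \<Rightarrow> 'a \<Rightarrow> 'a) \<Rightarrow> (nat \<Rightarrow> 'a) \<Rightarrow> ('g \<Rightarrow> 'a) \<Rightarrow> 'g lterm \<Rightarrow> 'a" where
  "enc_term p c f (Gen g) = p (c 0) (f g)"
| "enc_term p c f (LMeet s t) = p (c 1) (p (enc_term p c f s) (enc_term p c f t))"
| "enc_term p c f (LJoin s t) = p (c 2) (p (enc_term p c f s) (enc_term p c f t))"

primrec enc_pt :: "('a \<Rightarrow> 'a \<Rightarrow> 'a) \<Rightarrow> (nat \<Rightarrow> 'a) \<Rightarrow> ('t \<Rightarrow> 'a) \<Rightarrow> ('t, 'a) pt \<Rightarrow> 'a" where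
  "enc_pt p c f (Base k i) = p (c 0) (p (f k) i)"
| "enc_pt p c f (Mid j x y s t) =
     p (c 1) (p (c j) (p (p (enc_pt p c f x) (enc_pt p c f y)) (p (f s) (f t))))"

locale pairing =
  fixes \<Omega> :: "'a set" and p :: "'a \<Rightarrow> 'a \<Rightarrow> 'a" and c :: "nat \<Rightarrow> 'a"
  assumes p_in: "x \<in> \<Omega> \<Longrightarrow> y \<in> \<Omega> \<Longrightarrow> p x y \<in> \<Omega>"
    and p_inj: "x \<in> \<Omega> \<Longrightarrow> y \<in> \<Omega> \<Longrightarrow> x' \<in> \<Omega> \<Longrightarrow> y' \<in> \<Omega> \<Longrightarrow>
      p x y = p x' y' \<longleftrightarrow> x = x' \<and> y = y'"
    and c_in: "c n \<in> \<Omega>"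
    and c_inj: "c n = c m \<longleftrightarrow> n = m"
begin

lemma enc_term_in: "f ` G \<subseteq> \<Omega> \<Longrightarrow> lt_gens s \<subseteq> G \<Longrightarrow> enc_term p c f s \<in> \<Omega>"
  by (induction s) (auto simp: p_in c_in)

lemma enc_term_inj:
  assumes f: "inj_on f G" "f ` G \<subseteq> \<Omega>"
  shows "lt_gens s \<subseteq> G \<Longrightarrow> lt_gens t \<subseteq> G \<Longrightarrow> enc_term p c f s = enc_term p c f t \<Longrightarrow> s = t"
proof (induction s arbitrary: t)
  case (Gen g)
  then have g: "f g \<in> \<Omega>" and "\<And>g'. g' \<in> G \<Longrightarrow> f g' \<in> \<Omega>" using f(2) by auto
  then show ?case using f(1) Gen enc_term_in[OF f(2)]
    by (cases t) (auto simp: p_in c_in p_inj c_inj inj_on_def)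
next
  case (LMeet s1 s2)
  then show ?case using f enc_term_in[OF f(2)]
    by (cases t) (auto simp: p_in c_in p_inj c_inj)
next
  case (LJoin s1 s2)
  then show ?case using f enc_term_in[OF f(2)]
    by (cases t) (auto simp: p_in c_in p_inj c_inj)
qed

text \<open>Folding the pairing is injective among lists of equal length, so the length is stored in
  front as a constant.\<close>

lemma lists_lepoll: "lists \<Omega> \<lesssim> \<Omega>"
proof -
  have g_in: "foldr p xs (c 0) \<in> \<Omega>" if "xs \<in> lists \<Omega>" for xs
    using that by (induction xs) (auto simp: p_in c_in)
  have g_inj: "xs = ys" if "xs \<in> lists \<Omega>" "ys \<in> lists \<Omega>" "length xs = length ys"
    "foldr p xs (c 0) = foldr p ys (c 0)" for xs ys
    using that(3,1,2,4) by (induction xs ys rule: list_induct2) (auto simp: p_inj g_in)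
  have "inj_on (\<lambda>xs. p (c (length xs)) (foldr p xs (c 0))) (lists \<Omega>)"
    by (rule inj_onI) (simp add: p_inj g_in c_in c_inj g_inj)
  moreover have "(\<lambda>xs. p (c (length xs)) (foldr p xs (c 0))) ` lists \<Omega> \<subseteq> \<Omega>"
    using p_in g_in c_in by blast
  ultimately show ?thesis unfolding lepoll_def by blast
qed

end

lemma infinite_pairing:
  assumes "infinite \<Omega>"
  obtains p c where "pairing \<Omega> p c"
proof -
  obtain q where q: "inj_on q (\<Omega> \<times> \<Omega>)" "q ` (\<Omega> \<times> \<Omega>) \<subseteq> \<Omega>"
    using card_of_ordLeq[of "\<Omega> \<times> \<Omega>" \<Omega>] card_of_Times_same_infinite[OF assms] ordIso_iff_ordLeq
    by blast
  obtain c :: "nat \<Rightarrow> 'a" where c: "inj c" "range c \<subseteq> \<Omega>"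
    using assms infinite_countable_subset by blast
  have "pairing \<Omega> (\<lambda>x y. q (x, y)) c"
    by unfold_locales (use q c in \<open>auto simp: inj_on_def inj_def\<close>)
  then show ?thesis using that by blast
qed

context compact_sublattice
begin

text \<open>Points are finite trees labelled by elements of \<open>K\<close> and of
  \<open>\<Omega>\<close>, so tagging the constructors and iterating the pairing codes them in
  \<open>\<Omega>\<close>.\<close>

lemma points_lepoll:
  fixes \<Omega> :: "'a set"
  assumes "infinite \<Omega>" and K: "K \<lesssim> \<Omega>"
  shows "points \<Omega> \<lesssim> \<Omega>"
proof -
  obtain p c where "pairing \<Omega> p c" using infinite_pairing[OF assms(1)] by blast
  then interpret pairing \<Omega> p c .
  obtain f where f: "inj_on f K" "f ` K \<subseteq> \<Omega>" using K by (auto simp: lepoll_def)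
  define F where "F = case_sum (\<lambda>k. p (c 0) (f k)) (\<lambda>k. p (c 1) (f k))"
  have f_in: "f k \<in> \<Omega>" if "k \<in> K" for k using f(2) that by blast
  have F_in: "F ` coprod_gens K K \<subseteq> \<Omega>"
    unfolding coprod_gens_def F_def image_Un by (auto intro!: p_in c_in f_in)
  have F_inj: "inj_on F (coprod_gens K K)"
  proof (rule inj_onI)
    fix g g' assume g: "g \<in> coprod_gens K K" "g' \<in> coprod_gens K K" "F g = F g'"
    have Inl: "F (Inl k) = p (c 0) (f k)" and Inr: "F (Inr k) = p (c 1) (f k)" for k
      by (simp_all add: F_def)
    from g(1,2) consider (LL) k k' where "g = Inl k" "g' = Inl k'" "k \<in> K" "k' \<in> K"
      | (LR) k k' where "g = Inl k" "g' = Inr k'" "k \<in> K" "k' \<in> K"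
      | (RL) k k' where "g = Inr k" "g' = Inl k'" "k \<in> K" "k' \<in> K"
      | (RR) k k' where "g = Inr k" "g' = Inr k'" "k \<in> K" "k' \<in> K"
      unfolding coprod_gens_def by blast
    then show "g = g'"
      by cases (use g(3) f_in c_in inj_onD[OF f(1)] in \<open>simp_all add: Inl Inr p_inj c_inj\<close>)
  qed
  define T where "T = enc_term p c F"
  have T_in: "T s \<in> \<Omega>" if "s \<in> terms K" for s
    using enc_term_in[OF F_in, of s] that by (simp add: T_def terms_def)
  have T_inj: "T s = T t \<longleftrightarrow> s = t" if "s \<in> terms K" "t \<in> terms K" for s t
    using enc_term_inj[OF F_inj F_in, of s t] that unfolding T_def terms_def by blast
  have in_\<Omega>: "enc_pt p c T x \<in> \<Omega>" if "x \<in> points \<Omega>" for x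
    using that by (induction rule: points.induct) (simp_all add: p_in c_in T_in)
  let ?e = "enc_pt p c T"
  have eq_Base: "?e (Base k i) = ?e (Base k' i') \<longleftrightarrow> k = k' \<and> i = i'"
    if "k \<in> terms K" "i \<in> \<Omega>" "k' \<in> terms K" "i' \<in> \<Omega>" for k i k' i'
    using that by (simp add: p_inj p_in c_in T_in T_inj)
  have eq_Mid: "?e (Mid j x y s t) = ?e (Mid j' x' y' s' t') \<longleftrightarrow>
      j = j' \<and> ?e x = ?e x' \<and> ?e y = ?e y' \<and> s = s' \<and> t = t'"
    if "x \<in> points \<Omega>" "y \<in> points \<Omega>" "s \<in> terms K" "t \<in> terms K"
      "x' \<in> points \<Omega>" "y' \<in> points \<Omega>" "s' \<in> terms K" "t' \<in> terms K" for j x y s t j' x' y' s' t'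
    using that by (simp add: p_inj p_in c_in T_in T_inj in_\<Omega> c_inj)
  have Base_Mid: "?e (Base k i) \<noteq> ?e (Mid j x y s t)"
    if "k \<in> terms K" "i \<in> \<Omega>" "x \<in> points \<Omega>" "y \<in> points \<Omega>" "s \<in> terms K" "t \<in> terms K"
    for k i j x y s t
    using that by (simp add: p_inj p_in c_in T_in in_\<Omega> c_inj)
  have inj: "x = y" if "x \<in> points \<Omega>" "y \<in> points \<Omega>" "?e x = ?e y" for x y
    using that
  proof (induction arbitrary: y rule: points.induct)
    case b: (Base k i)
    from b.prems(1) show ?case
    proof (cases rule: points.cases)
      case (Base k' i')
      then show ?thesis using eq_Base[of k i k' i'] b by blast
    next
      case (Mid j' x' y' s' t')
      then show ?thesis using Base_Mid[of k i x' y' s' t' j'] b by blast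
    qed
  next
    case m: (Mid j u v s t)
    from m.prems(1) show ?case
    proof (cases rule: points.cases)
      case (Base k' i')
      then have "?e (Base k' i') = ?e (Mid j u v s t)" using m.prems(2) by simp
      then show ?thesis using Base_Mid[of k' i' u v s t j] Base m.hyps by blast
    next
      case (Mid j' u' v' s' t')
      have "j = j' \<and> ?e u = ?e u' \<and> ?e v = ?e v' \<and> s = s' \<and> t = t'"
        using m.prems(2) eq_Mid[OF m.hyps(2-5) Mid(3-6)] unfolding Mid(1) by blast
      then show ?thesis using m.IH(1)[OF Mid(3)] m.IH(2)[OF Mid(4)] Mid(1) by blast
    qed
  qed
  show ?thesis unfolding lepoll_def
    by (rule exI[of _ "enc_pt p c T"]) (use in_\<Omega> inj in \<open>auto intro: inj_onI\<close>)
qed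

text \<open>Points are identified modulo the relation of the term \<open>\<beta>\<close>, which becomes the diagonal; the
  points \<open>Base \<kappa> i\<close> stay apart and make the quotient as large as \<open>\<Omega>\<close>.\<close>
lemma representation:
  fixes \<Omega> :: "'a set"
  assumes inf: "infinite \<Omega>" and K: "K \<lesssim> \<Omega>" and \<beta>: "\<beta> \<in> terms A"
    and \<kappa>: "\<kappa> \<in> terms K" "\<not> word_le \<kappa> \<beta>"
  obtains f where "f ` points \<Omega> = \<Omega>"
    and "\<And>x y. x \<in> points \<Omega> \<Longrightarrow> y \<in> points \<Omega> \<Longrightarrow> f x = f y \<longleftrightarrow> (x, y) \<in> rho \<Omega> \<beta>"
proof -
  let ?r = "rho \<Omega> \<beta>"
  have eq: "equiv (points \<Omega>) ?r" using equiv_rho[OF \<beta>] .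
  have "points \<Omega> // ?r = (\<lambda>x. ?r `` {x}) ` points \<Omega>" by (auto simp: quotient_def)
  then have "points \<Omega> // ?r \<lesssim> \<Omega>"
    using lepoll_trans[OF image_lepoll points_lepoll[OF inf K]] by metis
  moreover have "\<Omega> \<lesssim> points \<Omega> // ?r"
    unfolding lepoll_def
  proof (intro exI conjI)
    show "inj_on (\<lambda>i. ?r `` {Base \<kappa> i}) \<Omega>"
    proof (rule inj_onI)
      fix i i' assume i: "i \<in> \<Omega>" "i' \<in> \<Omega>" "?r `` {Base \<kappa> i} = ?r `` {Base \<kappa> i'}"
      then have "(Base \<kappa> i, Base \<kappa> i') \<in> ?r"
        using eq_equiv_class[OF i(3) eq] \<kappa>(1) by (blast intro: points.Base)
      then show "i = i'" using rho_Base_Base[OF \<kappa>(1) i(1,2) _ \<beta>] \<kappa>(2) by blast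
    qed
    show "(\<lambda>i. ?r `` {Base \<kappa> i}) ` \<Omega> \<subseteq> points \<Omega> // ?r"
      using \<kappa>(1) by (auto intro!: quotientI points.Base)
  qed
  ultimately have "points \<Omega> // ?r \<approx> \<Omega>" by (rule lepoll_antisym)
  then obtain h where h: "bij_betw h (points \<Omega> // ?r) \<Omega>" by (auto simp: eqpoll_def)
  show ?thesis
  proof (rule that)
    show "(\<lambda>x. h (?r `` {x})) ` points \<Omega> = \<Omega>"
      using bij_betw_imp_surj_on[OF h] by (auto simp: quotient_def)
    fix x y assume xy: "x \<in> points \<Omega>" "y \<in> points \<Omega>"
    then have "h (?r `` {x}) = h (?r `` {y}) \<longleftrightarrow> ?r `` {x} = ?r `` {y}"
      using inj_on_eq_iff[OF bij_betw_imp_inj_on[OF h]] quotientI by metis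
    then show "h (?r `` {x}) = h (?r `` {y}) \<longleftrightarrow> (x, y) \<in> ?r"
      using eq_equiv_class_iff[OF eq xy] by blast
  qed
qed

text \<open>The relation of a term is pushed forward along the quotient map \<open>f\<close>.
  Restricting to terms above \<open>\<beta>\<close> makes it a union of blocks of the kernel, so
  that nothing is lost. The last clause holds because all distances are compact terms.\<close>

theorem faithful_representation:
  fixes \<Omega> :: "'a set"
  assumes inf: "infinite \<Omega>" and K: "K \<lesssim> \<Omega>" and \<beta>: "\<beta> \<in> terms A"
    and \<kappa>: "\<kappa> \<in> terms K" "\<not> word_le \<kappa> \<beta>"
  obtains \<Phi> :: "('l + 'l) lterm \<Rightarrow> 'a rel" where
    "\<And>t. t \<in> terms A \<Longrightarrow> word_le \<beta> t \<Longrightarrow> equiv \<Omega> (\<Phi> t)"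
    and "\<And>s t. s \<in> terms A \<Longrightarrow> t \<in> terms A \<Longrightarrow> word_le \<beta> s \<Longrightarrow> word_le \<beta> t \<Longrightarrow>
      \<Phi> (LMeet s t) = trancl (\<Phi> s \<union> \<Phi> t)"
    and "\<And>s t. s \<in> terms A \<Longrightarrow> t \<in> terms A \<Longrightarrow> word_le \<beta> s \<Longrightarrow> word_le \<beta> t \<Longrightarrow> \<Phi> (LJoin s t) = \<Phi> s \<inter> \<Phi> t"
    and "\<And>s t. s \<in> terms A \<Longrightarrow> t \<in> terms A \<Longrightarrow> word_le \<beta> s \<Longrightarrow> word_le \<beta> t \<Longrightarrow> \<Phi> s \<subseteq> \<Phi> t \<longleftrightarrow> word_le s t"
    and "\<Phi> \<beta> = Id_on \<Omega>"
    and "\<And>t. t \<in> terms A \<Longrightarrow> (\<And>k. k \<in> terms K \<Longrightarrow> word_le k t) \<Longrightarrow> \<Phi> t = \<Omega> \<times> \<Omega>"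
proof -
  obtain f where f: "f ` points \<Omega> = \<Omega>"
    and ker: "\<And>x y. x \<in> points \<Omega> \<Longrightarrow> y \<in> points \<Omega> \<Longrightarrow> f x = f y \<longleftrightarrow> (x, y) \<in> rho \<Omega> \<beta>"
    using representation[OF assms] by blast
  define \<Phi> where "\<Phi> t = {(f x, f y) | x y. (x, y) \<in> rho \<Omega> t}" for t
  have rho_X: "x \<in> points \<Omega>" "y \<in> points \<Omega>" if "(x, y) \<in> rho \<Omega> t" for x y t
    using that by (auto simp: rho_def)
  have \<Phi>_iff: "(f x, f y) \<in> \<Phi> t \<longleftrightarrow> (x, y) \<in> rho \<Omega> t"
    if t: "t \<in> terms A" "word_le \<beta> t" and xy: "x \<in> points \<Omega>" "y \<in> points \<Omega>" for x y t
  proof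
    assume "(f x, f y) \<in> \<Phi> t"
    then obtain x' y' where x'y': "(x', y') \<in> rho \<Omega> t" "f x = f x'" "f y = f y'"
      by (auto simp: \<Phi>_def)
    have sub: "rho \<Omega> \<beta> \<subseteq> rho \<Omega> t" by (rule rho_mono) (use t \<beta> in auto)
    have "(x, x') \<in> rho \<Omega> t" "(y', y) \<in> rho \<Omega> t"
      using ker[OF xy(1) rho_X(1)[OF x'y'(1)]] ker[OF rho_X(2)[OF x'y'(1)] xy(2)] x'y' sub by auto
    moreover have "trans (rho \<Omega> t)" by (rule equivE[OF equiv_rho[OF t(1)]])
    ultimately show "(x, y) \<in> rho \<Omega> t" using x'y'(1) by (meson transD)
  qed (auto simp: \<Phi>_def)
  have surj: "\<exists>x \<in> points \<Omega>. a = f x" if "a \<in> \<Omega>" for a using that f by blast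
  have \<Phi>_sub: "\<Phi> t \<subseteq> \<Omega> \<times> \<Omega>" for t using f rho_X by (auto simp: \<Phi>_def)
  have refl: "(x, x) \<in> rho \<Omega> t" if "x \<in> points \<Omega>" "t \<in> terms A" for x t
    by (rule equivE[OF equiv_rho[OF that(2)]]) (rule refl_onD[OF _ that(1)])
  have equiv: "equiv \<Omega> (\<Phi> t)" if t: "t \<in> terms A" "word_le \<beta> t" for t
  proof (rule equivI)
    have rho: "sym (rho \<Omega> t)" "trans (rho \<Omega> t)"
      by (rule equivE[OF equiv_rho[OF t(1)]], assumption)+
    show "\<Phi> t \<subseteq> \<Omega> \<times> \<Omega>" by (rule \<Phi>_sub)
    show "refl_on \<Omega> (\<Phi> t)"
    proof (rule refl_onI)
      fix a assume "a \<in> \<Omega>"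
      then obtain x where "x \<in> points \<Omega>" "a = f x" using surj by blast
      then show "(a, a) \<in> \<Phi> t" using refl[OF _ t(1)] by (auto simp: \<Phi>_def)
    qed
    show "sym (\<Phi> t)"
    proof (rule symI)
      fix a b assume "(a, b) \<in> \<Phi> t"
      then obtain x y where "(x, y) \<in> rho \<Omega> t" "a = f x" "b = f y" by (auto simp: \<Phi>_def)
      then show "(b, a) \<in> \<Phi> t" using symD[OF rho(1)] unfolding \<Phi>_def by blast
    qed
    show "trans (\<Phi> t)"
    proof (rule transI)
      fix a b d assume ab: "(a, b) \<in> \<Phi> t" and bd: "(b, d) \<in> \<Phi> t"
      obtain x y z where x: "x \<in> points \<Omega>" "a = f x" and y: "y \<in> points \<Omega>" "b = f y"
        and z: "z \<in> points \<Omega>" "d = f z"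
        using surj[of a] surj[of b] surj[of d] subsetD[OF \<Phi>_sub ab] subsetD[OF \<Phi>_sub bd] by blast
      have "(x, y) \<in> rho \<Omega> t" "(y, z) \<in> rho \<Omega> t"
        using ab bd \<Phi>_iff[OF t] x y z by blast+
      then have "(x, z) \<in> rho \<Omega> t" using transD[OF rho(2)] by blast
      then show "(a, d) \<in> \<Phi> t" using x z by (auto simp: \<Phi>_def)
    qed
  qed
  have sub_iff: "\<Phi> s \<subseteq> \<Phi> t \<longleftrightarrow> word_le s t"
    if s: "s \<in> terms A" and t: "t \<in> terms A" and word_le: "word_le \<beta> s" "word_le \<beta> t" for s t
  proof -
    have "\<Phi> s \<subseteq> \<Phi> t \<longleftrightarrow> rho \<Omega> s \<subseteq> rho \<Omega> t"
    proof
      assume sub: "\<Phi> s \<subseteq> \<Phi> t"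
      show "rho \<Omega> s \<subseteq> rho \<Omega> t"
      proof (rule subrelI)
        fix x y assume xy: "(x, y) \<in> rho \<Omega> s"
        then have "(f x, f y) \<in> \<Phi> s" unfolding \<Phi>_def by blast
        then have "(f x, f y) \<in> \<Phi> t" using sub by blast
        then show "(x, y) \<in> rho \<Omega> t" using \<Phi>_iff[OF t word_le(2) rho_X[OF xy]] by simp
      qed
    next
      assume "rho \<Omega> s \<subseteq> rho \<Omega> t"
      then show "\<Phi> s \<subseteq> \<Phi> t" unfolding \<Phi>_def by blast
    qed
    moreover have "\<Omega> \<noteq> {}" using inf by auto
    from rho_subset_iff[OF this s t] have "rho \<Omega> s \<subseteq> rho \<Omega> t \<longleftrightarrow> word_le s t" .
    ultimately show ?thesis by simp
  qed
  show ?thesis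
  proof (rule that)
    show "equiv \<Omega> (\<Phi> t)" if "t \<in> terms A" "word_le \<beta> t" for t using equiv that by blast
    show "\<Phi> s \<subseteq> \<Phi> t \<longleftrightarrow> word_le s t"
      if "s \<in> terms A" "t \<in> terms A" "word_le \<beta> s" "word_le \<beta> t" for s t using sub_iff that by blast
    show "\<Phi> (LJoin s t) = \<Phi> s \<inter> \<Phi> t"
      if s: "s \<in> terms A" and t: "t \<in> terms A" and word_le: "word_le \<beta> s" "word_le \<beta> t" for s t
    proof
      show "\<Phi> (LJoin s t) \<subseteq> \<Phi> s \<inter> \<Phi> t" by (auto simp: \<Phi>_def rho_Join[OF s t])
      show "\<Phi> s \<inter> \<Phi> t \<subseteq> \<Phi> (LJoin s t)"
      proof (rule subrelI)
        fix a b assume ab: "(a, b) \<in> \<Phi> s \<inter> \<Phi> t"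
        then have "(a, b) \<in> \<Omega> \<times> \<Omega>" using \<Phi>_sub by blast
        then obtain x y where xy: "x \<in> points \<Omega>" "a = f x" "y \<in> points \<Omega>" "b = f y"
          using surj[of a] surj[of b] by blast
        then have "(x, y) \<in> rho \<Omega> s \<inter> rho \<Omega> t"
          using ab \<Phi>_iff[OF s word_le(1)] \<Phi>_iff[OF t word_le(2)] by blast
        then show "(a, b) \<in> \<Phi> (LJoin s t)" using xy by (auto simp: \<Phi>_def rho_Join[OF s t])
      qed
    qed
    show "\<Phi> (LMeet s t) = trancl (\<Phi> s \<union> \<Phi> t)"
      if s: "s \<in> terms A" and t: "t \<in> terms A" and word_le: "word_le \<beta> s" "word_le \<beta> t" for s t
    proof
      have "(f x, f y) \<in> trancl (\<Phi> s \<union> \<Phi> t)" if "(x, y) \<in> trancl (rho \<Omega> s \<union> rho \<Omega> t)" for x y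
        using that
      proof (induction rule: trancl_induct)
        case (base y)
        then have "(f x, f y) \<in> \<Phi> s \<union> \<Phi> t" unfolding \<Phi>_def by blast
        then show ?case by (rule r_into_trancl)
      next
        case (step y z)
        then have "(f y, f z) \<in> \<Phi> s \<union> \<Phi> t" unfolding \<Phi>_def by blast
        with step.IH show ?case by (rule trancl_into_trancl)
      qed
      then show "\<Phi> (LMeet s t) \<subseteq> trancl (\<Phi> s \<union> \<Phi> t)"
        unfolding \<Phi>_def[of "LMeet s t"] rho_Meet[OF s t] by blast
      have M: "LMeet s t \<in> terms A" "word_le \<beta> (LMeet s t)" using s t word_le by (auto intro: MeetR1)
      have sub: "\<Phi> s \<union> \<Phi> t \<subseteq> \<Phi> (LMeet s t)"
        using sub_iff[OF s M(1) word_le(1) M(2)] sub_iff[OF t M(1) word_le(2) M(2)]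
        by (simp add: MeetR1 MeetR2 word_le_refl)
      have "trans (\<Phi> (LMeet s t))" by (rule equivE[OF equiv[OF M]])
      then have tr: "trancl (\<Phi> (LMeet s t)) = \<Phi> (LMeet s t)" by (rule trancl_id)
      have "(a, b) \<in> trancl (\<Phi> (LMeet s t))" if "(a, b) \<in> trancl (\<Phi> s \<union> \<Phi> t)" for a b
        by (rule trancl_mono[OF that sub])
      then show "trancl (\<Phi> s \<union> \<Phi> t) \<subseteq> \<Phi> (LMeet s t)" unfolding tr by (rule subrelI)
    qed
    show "\<Phi> \<beta> = Id_on \<Omega>"
    proof
      show "\<Phi> \<beta> \<subseteq> Id_on \<Omega>"
      proof (rule subrelI)
        fix a b assume ab: "(a, b) \<in> \<Phi> \<beta>"
        then obtain x y where xy: "(x, y) \<in> rho \<Omega> \<beta>" "a = f x" "b = f y" by (auto simp: \<Phi>_def)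
        then have "f x = f y" using ker[OF rho_X[OF xy(1)]] by blast
        then show "(a, b) \<in> Id_on \<Omega>" using xy subsetD[OF \<Phi>_sub ab] by (simp add: Id_on_iff)
      qed
      show "Id_on \<Omega> \<subseteq> \<Phi> \<beta>"
        using equiv[OF \<beta> word_le_refl] unfolding equiv_def refl_on_def by (auto simp: Id_on_iff)
    qed
    show "\<Phi> t = \<Omega> \<times> \<Omega>" if t: "t \<in> terms A" "\<And>k. k \<in> terms K \<Longrightarrow> word_le k t" for t
    proof
      show "\<Omega> \<times> \<Omega> \<subseteq> \<Phi> t"
      proof (rule subrelI)
        fix a b assume "(a, b) \<in> \<Omega> \<times> \<Omega>"
        then obtain x y where xy: "x \<in> points \<Omega>" "a = f x" "y \<in> points \<Omega>" "b = f y"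
          using surj[of a] surj[of b] by blast
        then have "(x, y) \<in> rho \<Omega> t" by (simp add: rho_def t(2) dist_in)
        then show "(a, b) \<in> \<Phi> t" using xy by (auto simp: \<Phi>_def)
      qed
    qed (rule \<Phi>_sub)
  qed
qed

end

section \<open>The lattice of equivalence relations\<close>

lemma equiv_trancl_Un:
  assumes "equiv A R" "equiv A S"
  shows "equiv A (trancl (R \<union> S))"
proof (rule equivI)
  show "trancl (R \<union> S) \<subseteq> A \<times> A"
    using assms by (intro trancl_subset_Sigma) (auto simp: equiv_def)
  show "refl_on A (trancl (R \<union> S))"
    using assms by (auto simp: equiv_def refl_on_def)
  show "sym (trancl (R \<union> S))"
    using assms by (intro sym_trancl sym_Un) (auto simp: equiv_def)
qed (rule trans_trancl)

lemma equiv_Int: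
  assumes "equiv A R" "equiv A S"
  shows "equiv A (R \<inter> S)"
proof (rule equivI)
  show "R \<inter> S \<subseteq> A \<times> A" using assms by (auto simp: equiv_def)
  show "refl_on A (R \<inter> S)" using assms by (auto simp: equiv_def refl_on_def)
  show "sym (R \<inter> S)" using assms by (intro sym_Int) (auto simp: equiv_def)
  show "trans (R \<inter> S)" using assms by (intro trans_Int) (auto simp: equiv_def)
qed

lemma trancl_Un_least:
  assumes "R \<subseteq> T" "S \<subseteq> T" "trans T"
  shows "trancl (R \<union> S) \<subseteq> T"
proof (rule subrelI)
  fix x y assume "(x, y) \<in> trancl (R \<union> S)"
  then have "(x, y) \<in> trancl T" by (rule trancl_mono) (use assms in simp)
  then show "(x, y) \<in> T" using trancl_id[OF assms(3)] by simp
qed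

text \<open>The word problem is stated over the class \<open>bounded_lattice\<close>, which needs a
  type all of whose elements are equivalence relations; \<open>Eq \<Omega>\<close> enters it through
  \<open>iota\<close>.\<close>

typedef 'b eqv = "{R :: 'b rel. equiv UNIV R}"
  by (rule exI[of _ UNIV]) (auto simp: equiv_def refl_on_def sym_def trans_def)

lemma equiv_Rep_eqv: "equiv UNIV (Rep_eqv R)"
  using Rep_eqv by blast

lemma equiv_UNIV: "equiv UNIV (UNIV :: 'b rel)"
  by (auto simp: equiv_def refl_on_def sym_def trans_def)

lemma equiv_Id: "equiv UNIV (Id :: 'b rel)"
  by (auto simp: equiv_def refl_on_def sym_def trans_def)

instantiation eqv :: (type) bounded_lattice
begin

definition less_eq_eqv :: "'a eqv \<Rightarrow> 'a eqv \<Rightarrow> bool" where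
  "R \<le> S \<longleftrightarrow> Rep_eqv R \<subseteq> Rep_eqv S"
definition less_eqv :: "'a eqv \<Rightarrow> 'a eqv \<Rightarrow> bool" where
  "R < S \<longleftrightarrow> Rep_eqv R \<subset> Rep_eqv S"
definition inf_eqv :: "'a eqv \<Rightarrow> 'a eqv \<Rightarrow> 'a eqv" where
  "inf R S = Abs_eqv (Rep_eqv R \<inter> Rep_eqv S)"
definition sup_eqv :: "'a eqv \<Rightarrow> 'a eqv \<Rightarrow> 'a eqv" where
  "sup R S = Abs_eqv (trancl (Rep_eqv R \<union> Rep_eqv S))"
definition bot_eqv :: "'a eqv" where "bot = Abs_eqv Id"
definition top_eqv :: "'a eqv" where "top = Abs_eqv UNIV"

lemma Rep_eqv_simps:
  "Rep_eqv (inf R S) = Rep_eqv R \<inter> Rep_eqv S"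
  "Rep_eqv (sup R S) = trancl (Rep_eqv R \<union> Rep_eqv S)"
  "Rep_eqv (bot :: 'a eqv) = Id"
  "Rep_eqv (top :: 'a eqv) = UNIV"
  by (simp_all add: inf_eqv_def sup_eqv_def bot_eqv_def top_eqv_def Abs_eqv_inverse
      equiv_Int equiv_trancl_Un equiv_Rep_eqv equiv_Id equiv_UNIV)

instance
proof
  fix R S T :: "'a eqv"
  show "R < S \<longleftrightarrow> R \<le> S \<and> \<not> S \<le> R" by (auto simp: less_eqv_def less_eq_eqv_def)
  show "R \<le> R" by (simp add: less_eq_eqv_def)
  show "R \<le> S \<Longrightarrow> S \<le> T \<Longrightarrow> R \<le> T" by (auto simp: less_eq_eqv_def)
  show "R \<le> S \<Longrightarrow> S \<le> R \<Longrightarrow> R = S" by (simp add: less_eq_eqv_def Rep_eqv_inject)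
  show "inf R S \<le> R" "inf R S \<le> S" "R \<le> S \<Longrightarrow> R \<le> T \<Longrightarrow> R \<le> inf S T"
    by (auto simp: less_eq_eqv_def Rep_eqv_simps)
  show "R \<le> sup R S" "S \<le> sup R S" by (auto simp: less_eq_eqv_def Rep_eqv_simps)
  show "sup R S \<le> T" if "R \<le> T" "S \<le> T"
    using that trancl_Un_least[of "Rep_eqv R" "Rep_eqv T" "Rep_eqv S"] equiv_Rep_eqv[of T]
    by (simp add: less_eq_eqv_def Rep_eqv_simps equiv_def)
  show "bot \<le> R" using equiv_Rep_eqv[of R]
    by (auto simp: less_eq_eqv_def Rep_eqv_simps equiv_def refl_on_def)
  show "R \<le> top" by (simp add: less_eq_eqv_def Rep_eqv_simps)
qed

end

text \<open>The summand \<open>bool\<close> leaves room for a new greatest element, and, if \<open>b\<close> holds,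
  also for a new least one: then the two additional points are related in every \<open>iota b R\<close>.\<close>
definition iota_rel :: "bool \<Rightarrow> 'a rel \<Rightarrow> ('a + bool) rel" where
  "iota_rel b R = {(Inl x, Inl y) | x y. (x, y) \<in> R} \<union> {(Inr u, Inr v) | u v. b} \<union> Id"

definition iota :: "bool \<Rightarrow> 'a rel \<Rightarrow> ('a + bool) eqv" where
  "iota b R = Abs_eqv (iota_rel b R)"

lemma iota_rel_iff [simp]:
  "(Inl x, Inl y) \<in> iota_rel b R \<longleftrightarrow> x = y \<or> (x, y) \<in> R"
  "(Inr u, Inr v) \<in> iota_rel b R \<longleftrightarrow> u = v \<or> b"
  "(Inl x, Inr v) \<notin> iota_rel b R"
  "(Inr u, Inl y) \<notin> iota_rel b R"
  by (auto simp: iota_rel_def)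

lemma EqD:
  assumes "R \<in> Eq \<Omega>"
  shows "R \<subseteq> \<Omega> \<times> \<Omega>" "refl_on \<Omega> R" "sym R" "trans R"
  using assms by (auto simp: Eq_def equiv_def)

lemma Id_on_subset_Eq: "R \<in> Eq \<Omega> \<Longrightarrow> Id_on \<Omega> \<subseteq> R"
  using EqD(2)[of R \<Omega>] by (auto simp: refl_on_def)

lemma Eq_closed:
  assumes "R \<in> Eq \<Omega>" "S \<in> Eq \<Omega>"
  shows "R \<inter> S \<in> Eq \<Omega>" "trancl (R \<union> S) \<in> Eq \<Omega>"
  using assms by (simp_all add: Eq_def equiv_Int equiv_trancl_Un)

lemma Id_on_in_Eq: "Id_on \<Omega> \<in> Eq \<Omega>" and full_in_Eq: "\<Omega> \<times> \<Omega> \<in> Eq \<Omega>"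
  by (auto simp: Eq_def equiv_def refl_on_def sym_def trans_def)

lemma equiv_iota_rel:
  assumes "R \<in> Eq \<Omega>"
  shows "equiv UNIV (iota_rel b R)"
proof (rule equivI)
  show "refl_on UNIV (iota_rel b R)" by (rule refl_onI) (simp add: iota_rel_def)
  show "sym (iota_rel b R)"
  proof (rule symI)
    fix z w assume "(z, w) \<in> iota_rel b R"
    then show "(w, z) \<in> iota_rel b R"
      using symD[OF EqD(3)[OF assms]] unfolding iota_rel_def by blast
  qed
  show "trans (iota_rel b R)"
  proof (rule transI)
    fix z w v assume "(z, w) \<in> iota_rel b R" "(w, v) \<in> iota_rel b R"
    then show "(z, v) \<in> iota_rel b R"
      using transD[OF EqD(4)[OF assms]] unfolding iota_rel_def by blast
  qed
qed simp

lemma Rep_iota: "R \<in> Eq \<Omega> \<Longrightarrow> Rep_eqv (iota b R) = iota_rel b R"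
  using equiv_iota_rel[of R \<Omega> b] by (simp add: iota_def Abs_eqv_inverse)

lemma iota_le_iff:
  assumes "R \<in> Eq \<Omega>" "S \<in> Eq \<Omega>"
  shows "iota b R \<le> iota b S \<longleftrightarrow> R \<subseteq> S"
proof
  assume word_le: "iota b R \<le> iota b S"
  show "R \<subseteq> S"
  proof (rule subrelI)
    fix x y assume xy: "(x, y) \<in> R"
    then have "(Inl x, Inl y) \<in> iota_rel b R" by simp
    moreover have "iota_rel b R \<subseteq> iota_rel b S"
      using word_le by (simp add: less_eq_eqv_def Rep_iota[OF assms(1)] Rep_iota[OF assms(2)])
    ultimately have "(Inl x, Inl y) \<in> iota_rel b S" by blast
    then have "x = y \<or> (x, y) \<in> S" by simp
    moreover have "x \<in> \<Omega>" using EqD(1)[OF assms(1)] xy by blast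
    ultimately show "(x, y) \<in> S" using Id_on_subset_Eq[OF assms(2)] by blast
  qed
qed (auto simp: less_eq_eqv_def Rep_iota[OF assms(1)] Rep_iota[OF assms(2)] iota_rel_def)

lemma iota_inj: "inj_on (iota b) (Eq \<Omega>)"
proof (rule inj_onI)
  fix R S assume "R \<in> Eq \<Omega>" "S \<in> Eq \<Omega>" "iota b R = iota b S"
  then show "R = S" using iota_le_iff[of R \<Omega> S b] iota_le_iff[of S \<Omega> R b] by auto
qed

lemma iota_inf:
  assumes "R \<in> Eq \<Omega>" "S \<in> Eq \<Omega>"
  shows "iota b (R \<inter> S) = inf (iota b R) (iota b S)"
proof -
  have "iota_rel b (R \<inter> S) = iota_rel b R \<inter> iota_rel b S" by (auto simp: iota_rel_def)
  then have "Rep_eqv (iota b (R \<inter> S)) = Rep_eqv (inf (iota b R) (iota b S))"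
    using assms Eq_closed(1)[OF assms] by (simp add: Rep_eqv_simps Rep_iota)
  then show ?thesis by (simp only: Rep_eqv_inject)
qed

lemma iota_sup:
  assumes "R \<in> Eq \<Omega>" "S \<in> Eq \<Omega>"
  shows "iota b (trancl (R \<union> S)) = sup (iota b R) (iota b S)"
proof (rule antisym)
  let ?U = "trancl (iota_rel b R \<union> iota_rel b S)"
  have "(Inl x, Inl y) \<in> ?U" if "(x, y) \<in> trancl (R \<union> S)" for x y
    using that
  proof (induction rule: trancl_induct)
    case (base y)
    then have "(Inl x, Inl y) \<in> iota_rel b R \<union> iota_rel b S" by auto
    then show ?case by (rule r_into_trancl)
  next
    case (step y z)
    then have "(Inl y, Inl z) \<in> iota_rel b R \<union> iota_rel b S" by auto
    with step.IH show ?case by (rule trancl_into_trancl)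
  qed
  moreover have "(Inr u, Inr v) \<in> ?U" if b for u v
    using that by (intro r_into_trancl) simp
  moreover have "(z, z) \<in> ?U" for z by (intro r_into_trancl) (simp add: iota_rel_def)
  ultimately have "iota_rel b (trancl (R \<union> S)) \<subseteq> ?U"
    unfolding iota_rel_def[of b "trancl (R \<union> S)"] by blast
  then show "iota b (trancl (R \<union> S)) \<le> sup (iota b R) (iota b S)"
    by (simp add: less_eq_eqv_def Rep_eqv_simps Rep_iota[OF assms(1)] Rep_iota[OF assms(2)]
        Rep_iota[OF Eq_closed(2)[OF assms]])
  have "R \<subseteq> trancl (R \<union> S)" "S \<subseteq> trancl (R \<union> S)" by auto
  then show "sup (iota b R) (iota b S) \<le> iota b (trancl (R \<union> S))"
    using iota_le_iff[OF assms(1) Eq_closed(2)[OF assms]]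
      iota_le_iff[OF assms(2) Eq_closed(2)[OF assms]] by simp
qed

lemma iota_neq_top: "R \<in> Eq \<Omega> \<Longrightarrow> iota b R \<noteq> top"
proof
  assume "R \<in> Eq \<Omega>" "iota b R = top"
  then have "iota_rel b R = UNIV" using Rep_iota[of R \<Omega> b] by (simp add: Rep_eqv_simps)
  then show False using iota_rel_iff(3)[of undefined True b R] by blast
qed

lemma iota_False_bot: "iota False (Id_on \<Omega>) = bot"
proof -
  have "iota_rel False (Id_on \<Omega>) = Id" by (auto simp: iota_rel_def)
  then show ?thesis by (simp add: iota_def bot_eqv_def)
qed

lemma iota_True_neq_bot: "R \<in> Eq \<Omega> \<Longrightarrow> iota True R \<noteq> bot"
proof
  assume "R \<in> Eq \<Omega>" "iota True R = bot"
  then have "iota_rel True R = Id" using Rep_iota[of R \<Omega> True] by (simp add: Rep_eqv_simps)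
  moreover have "(Inr True, Inr False) \<in> iota_rel True R" by simp
  ultimately show False by simp
qed

section \<open>Compact elements of the lattice of equivalence relations\<close>

definition restr :: "'a set \<Rightarrow> 'a rel \<Rightarrow> 'a set \<Rightarrow> 'a rel" where
  "restr \<Omega> R F = R \<inter> F \<times> F \<union> Id_on \<Omega>"

text \<open>These are the finitely generated equivalence relations, the compact elements of
  \<open>Eq \<Omega>\<close>.\<close>

definition fin_Eq :: "'a set \<Rightarrow> 'a rel set" where
  "fin_Eq \<Omega> = {R \<in> Eq \<Omega>. \<exists>F. finite F \<and> R \<subseteq> F \<times> F \<union> Id}"

lemma fin_Eq_subset: "fin_Eq \<Omega> \<subseteq> Eq \<Omega>"
  by (auto simp: fin_Eq_def)

lemma restr_in_fin_Eq:
  assumes "R \<in> Eq \<Omega>" "finite F"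
  shows "restr \<Omega> R F \<in> fin_Eq \<Omega>"
proof -
  note R = EqD[OF assms(1)]
  have "equiv \<Omega> (restr \<Omega> R F)"
  proof (rule equivI)
    show "restr \<Omega> R F \<subseteq> \<Omega> \<times> \<Omega>" using R(1) by (auto simp: restr_def)
    show "refl_on \<Omega> (restr \<Omega> R F)" by (rule refl_onI) (auto simp: restr_def)
    show "sym (restr \<Omega> R F)"
      unfolding restr_def by (rule symI) (use symD[OF R(3)] in blast)
    show "trans (restr \<Omega> R F)"
      unfolding restr_def by (rule transI) (use transD[OF R(4)] in blast)
  qed
  moreover have "restr \<Omega> R F \<subseteq> F \<times> F \<union> Id" by (auto simp: restr_def)
  ultimately show ?thesis using assms(2) by (auto simp: fin_Eq_def Eq_def)
qed

lemma restr_subset: "R \<in> Eq \<Omega> \<Longrightarrow> restr \<Omega> R F \<subseteq> R"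
  using Id_on_subset_Eq[of R \<Omega>] by (auto simp: restr_def)

lemma restr_mono: "F \<subseteq> F' \<Longrightarrow> restr \<Omega> R F \<subseteq> restr \<Omega> R F'"
  by (auto simp: restr_def)

lemma trancl_restr_mono:
  assumes "F \<subseteq> F'" "(x, y) \<in> trancl (restr \<Omega> R F \<union> restr \<Omega> S F)"
  shows "(x, y) \<in> trancl (restr \<Omega> R F' \<union> restr \<Omega> S F')"
  using assms(2) by (rule trancl_mono) (rule Un_mono[OF restr_mono[OF assms(1)] restr_mono[OF assms(1)]])

lemma trancl_finite_witness:
  assumes "(x, y) \<in> trancl (R \<union> S)"
  shows "\<exists>F. finite F \<and> (x, y) \<in> trancl (restr \<Omega> R F \<union> restr \<Omega> S F)"
  using assms
proof (induction rule: trancl_induct)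
  case (base y)
  then have "(x, y) \<in> restr \<Omega> R {x, y} \<union> restr \<Omega> S {x, y}" by (auto simp: restr_def)
  then have "(x, y) \<in> trancl (restr \<Omega> R {x, y} \<union> restr \<Omega> S {x, y})" by (rule r_into_trancl)
  then show ?case by (intro exI[of _ "{x, y}"]) simp
next
  case (step y z)
  then obtain F where F: "finite F" "(x, y) \<in> trancl (restr \<Omega> R F \<union> restr \<Omega> S F)" by blast
  let ?F = "insert y (insert z F)"
  have "(x, y) \<in> trancl (restr \<Omega> R ?F \<union> restr \<Omega> S ?F)"
    by (rule trancl_restr_mono[OF _ F(2)]) blast
  moreover have "(y, z) \<in> restr \<Omega> R ?F \<union> restr \<Omega> S ?F" using step.hyps by (auto simp: restr_def)
  ultimately have "(x, z) \<in> trancl (restr \<Omega> R ?F \<union> restr \<Omega> S ?F)" by (rule trancl_into_trancl)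
  then show ?case using F(1) by (intro exI[of _ ?F]) simp
qed

text \<open>Only finitely many pairs of \<open>T\<close> are not diagonal by necessity, and each is
  joined by a finite chain; the vertices of these chains make up \<open>F\<close>.\<close>

lemma fin_Eq_compact:
  assumes "T \<in> fin_Eq \<Omega>" "T \<subseteq> trancl (R \<union> S)"
  obtains F where "finite F" "T \<subseteq> trancl (restr \<Omega> R F \<union> restr \<Omega> S F)"
proof -
  obtain F0 where F0: "finite F0" "T \<subseteq> F0 \<times> F0 \<union> Id" "T \<in> Eq \<Omega>"
    using assms(1) by (auto simp: fin_Eq_def)
  have "\<forall>q \<in> T. \<exists>F. finite F \<and> q \<in> trancl (restr \<Omega> R F \<union> restr \<Omega> S F)"
    using trancl_finite_witness[of _ _ R S \<Omega>] assms(2) by (metis subsetD surj_pair)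
  then obtain g where g: "\<And>q. q \<in> T \<Longrightarrow> finite (g q) \<and> q \<in> trancl (restr \<Omega> R (g q) \<union> restr \<Omega> S (g q))"
    by metis
  define F where "F = (\<Union>q \<in> T \<inter> F0 \<times> F0. g q)"
  have "finite F" using F0(1) g by (auto simp: F_def)
  moreover have "T \<subseteq> trancl (restr \<Omega> R F \<union> restr \<Omega> S F)"
  proof (rule subrelI)
    fix x y assume xy: "(x, y) \<in> T"
    show "(x, y) \<in> trancl (restr \<Omega> R F \<union> restr \<Omega> S F)"
    proof (cases "(x, y) \<in> F0 \<times> F0")
      case True
      then have "g (x, y) \<subseteq> F" using xy unfolding F_def by blast
      then show ?thesis by (rule trancl_restr_mono) (use g xy in blast)
    next
      case False
      then have "x = y" "x \<in> \<Omega>" using F0(2) EqD(1)[OF F0(3)] xy by auto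
      then have "(x, y) \<in> restr \<Omega> R F \<union> restr \<Omega> S F" by (simp add: restr_def Id_on_iff)
      then show ?thesis by (rule r_into_trancl)
    qed
  qed
  ultimately show ?thesis by (rule that)
qed

lemma fin_Eq_closed:
  assumes "R \<in> fin_Eq \<Omega>" "S \<in> fin_Eq \<Omega>"
  shows "R \<inter> S \<in> fin_Eq \<Omega>" "trancl (R \<union> S) \<in> fin_Eq \<Omega>"
proof -
  obtain F F' where F: "R \<in> Eq \<Omega>" "S \<in> Eq \<Omega>" "finite F" "finite F'"
      "R \<subseteq> F \<times> F \<union> Id" "S \<subseteq> F' \<times> F' \<union> Id"
    using assms by (auto simp: fin_Eq_def)
  let ?F = "F \<union> F'"
  have "trans (?F \<times> ?F \<union> Id)" by (auto simp: trans_def)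
  moreover have "R \<subseteq> ?F \<times> ?F \<union> Id" "S \<subseteq> ?F \<times> ?F \<union> Id" using F by auto
  ultimately have "trancl (R \<union> S) \<subseteq> ?F \<times> ?F \<union> Id" by (intro trancl_Un_least)
  moreover have "R \<inter> S \<subseteq> ?F \<times> ?F \<union> Id" using F by auto
  moreover have "finite ?F" using F by simp
  ultimately show "R \<inter> S \<in> fin_Eq \<Omega>" "trancl (R \<union> S) \<in> fin_Eq \<Omega>"
    using Eq_closed[OF F(1,2)] unfolding fin_Eq_def by blast+
qed

lemma fin_Eq_lepoll:
  assumes "infinite \<Omega>"
  shows "insert bot (iota b ` fin_Eq \<Omega>) \<lesssim> \<Omega>"
proof -
  obtain p c where "pairing \<Omega> p c" using infinite_pairing[OF assms] by blast
  then interpret pairing \<Omega> p c .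
  have "inj_on (case_prod p) (\<Omega> \<times> \<Omega>)"
    by (rule inj_onI) (clarsimp simp: p_inj)
  moreover have "case_prod p ` (\<Omega> \<times> \<Omega>) \<subseteq> \<Omega>" using p_in by auto
  ultimately have "\<Omega> \<times> \<Omega> \<lesssim> \<Omega>" unfolding lepoll_def by blast
  then have lists: "lists (\<Omega> \<times> \<Omega>) \<lesssim> \<Omega>"
    by (rule lepoll_trans[OF lists_lepoll_mono lists_lepoll])
  \<comment> \<open>The empty list codes \<open>bot\<close>, which may lie outside the image of
    \<open>iota\<close>. Every other list drops its head, so that the diagonal also has a code, with
    a dummy head.\<close>
  define h where "h xs = (if xs = [] then bot else iota b (Id_on \<Omega> \<union> set (tl xs)))" for xs
  have "insert bot (iota b ` fin_Eq \<Omega>) \<subseteq> h ` lists (\<Omega> \<times> \<Omega>)"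
  proof
    fix k assume "k \<in> insert bot (iota b ` fin_Eq \<Omega>)"
    then consider "k = bot" | R where "R \<in> fin_Eq \<Omega>" "k = iota b R" by blast
    then show "k \<in> h ` lists (\<Omega> \<times> \<Omega>)"
    proof cases
      case 1
      then have "k = h []" by (simp add: h_def)
      then show ?thesis by blast
    next
      case 2
      then obtain F where F: "R \<in> Eq \<Omega>" "finite F" "R \<subseteq> F \<times> F \<union> Id" by (auto simp: fin_Eq_def)
      have "finite (R \<inter> F \<times> F)" using F(2) by blast
      then obtain xs where xs: "set xs = R \<inter> F \<times> F" using finite_list by blast
      have R: "R = Id_on \<Omega> \<union> R \<inter> F \<times> F"
        using F(3) Id_on_subset_Eq[OF F(1)] EqD(1)[OF F(1)] by auto
      have "h ((c 0, c 0) # xs) = k" using R 2 by (simp add: h_def xs)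
      moreover have "(c 0, c 0) # xs \<in> lists (\<Omega> \<times> \<Omega>)" using xs EqD(1)[OF F(1)] c_in by auto
      ultimately show ?thesis by blast
    qed
  qed
  from lepoll_trans[OF subset_image_lepoll[OF this] lists] show ?thesis .
qed

lemma compact_sublattice_iota:
  "compact_sublattice (insert bot (iota b ` Eq \<Omega>)) (insert bot (iota b ` fin_Eq \<Omega>))"
proof
  show "bot \<in> insert bot (iota b ` Eq \<Omega>)" "bot \<in> insert bot (iota b ` fin_Eq \<Omega>)" by auto
  have "(bot :: ('a + bool) eqv) \<noteq> top"
  proof
    assume "(bot :: ('a + bool) eqv) = top"
    then have "Rep_eqv (bot :: ('a + bool) eqv) = Rep_eqv top" by simp
    then have "(Inr True, Inr False) \<in> (Id :: ('a + bool) rel)"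
      unfolding Rep_eqv_simps by simp
    then show False by simp
  qed
  then show "top \<notin> insert bot (iota b ` Eq \<Omega>)" using iota_neq_top[of _ \<Omega> b]
    by (metis imageE insertE)
  have Eq: "sup x y \<in> iota b ` Eq \<Omega>" "inf x y \<in> iota b ` Eq \<Omega>"
    if xy: "x \<in> iota b ` Eq \<Omega>" "y \<in> iota b ` Eq \<Omega>" for x y
  proof -
    obtain R S where RS: "R \<in> Eq \<Omega>" "S \<in> Eq \<Omega>" "x = iota b R" "y = iota b S" using xy by blast
    show "sup x y \<in> iota b ` Eq \<Omega>" "inf x y \<in> iota b ` Eq \<Omega>"
      unfolding RS(3,4) iota_sup[OF RS(1,2), symmetric] iota_inf[OF RS(1,2), symmetric]
      using Eq_closed[OF RS(1,2)] by blast+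
  qed
  have fin: "sup x y \<in> iota b ` fin_Eq \<Omega>" "inf x y \<in> iota b ` fin_Eq \<Omega>"
    if xy: "x \<in> iota b ` fin_Eq \<Omega>" "y \<in> iota b ` fin_Eq \<Omega>" for x y
  proof -
    obtain R S where RS: "R \<in> fin_Eq \<Omega>" "S \<in> fin_Eq \<Omega>" "x = iota b R" "y = iota b S" using xy by blast
    then have RS': "R \<in> Eq \<Omega>" "S \<in> Eq \<Omega>" using fin_Eq_subset by blast+
    show "sup x y \<in> iota b ` fin_Eq \<Omega>" "inf x y \<in> iota b ` fin_Eq \<Omega>"
      unfolding RS(3,4) iota_sup[OF RS', symmetric] iota_inf[OF RS', symmetric]
      using fin_Eq_closed[OF RS(1,2)] by blast+
  qed
  show "sup x y \<in> insert bot (iota b ` Eq \<Omega>)" "inf x y \<in> insert bot (iota b ` Eq \<Omega>)"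
    if "x \<in> insert bot (iota b ` Eq \<Omega>)" "y \<in> insert bot (iota b ` Eq \<Omega>)" for x y
    using that by (elim insertE; simp add: Eq)+
  show "sup x y \<in> insert bot (iota b ` fin_Eq \<Omega>)" "inf x y \<in> insert bot (iota b ` fin_Eq \<Omega>)"
    if "x \<in> insert bot (iota b ` fin_Eq \<Omega>)" "y \<in> insert bot (iota b ` fin_Eq \<Omega>)" for x y
    using that by (elim insertE; simp add: fin)+
  show "insert bot (iota b ` fin_Eq \<Omega>) \<subseteq> insert bot (iota b ` Eq \<Omega>)"
    using fin_Eq_subset by blast
  show "x \<le> y" if x: "x \<in> insert bot (iota b ` Eq \<Omega>)"
    and word_le: "\<And>k. k \<in> insert bot (iota b ` fin_Eq \<Omega>) \<Longrightarrow> k \<le> x \<Longrightarrow> k \<le> y" for x y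
  proof (cases "x = bot")
    case False
    then obtain R where R: "R \<in> Eq \<Omega>" "x = iota b R" using x by blast
    have sub: "iota_rel b (restr \<Omega> R F) \<subseteq> Rep_eqv y" if F: "finite F" for F
    proof -
      have S: "restr \<Omega> R F \<in> Eq \<Omega>" "restr \<Omega> R F \<in> fin_Eq \<Omega>"
        using restr_in_fin_Eq[OF R(1) F] fin_Eq_subset by blast+
      then have "iota b (restr \<Omega> R F) \<le> x"
        unfolding R(2) using iota_le_iff[OF S(1) R(1)] restr_subset[OF R(1)] by blast
      then have "iota b (restr \<Omega> R F) \<le> y" using S word_le by blast
      then show ?thesis by (simp add: less_eq_eqv_def Rep_iota[OF S(1)])
    qed
    have "iota_rel b R \<subseteq> Rep_eqv y"
    proof (rule subrelI)
      fix z w assume zw: "(z, w) \<in> iota_rel b R"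
      \<comment> \<open>A pair of old points needs only itself in \<open>F\<close>, and pairs
        involving the additional points belong to every \<open>iota_rel b\<close>.\<close>
      have "\<exists>F. finite F \<and> (z, w) \<in> iota_rel b (restr \<Omega> R F)"
      proof (cases "\<exists>x y. z = Inl x \<and> w = Inl y")
        case True
        then obtain x y where xy: "z = Inl x" "w = Inl y" by blast
        then show ?thesis using zw by (intro exI[of _ "{x, y}"]) (auto simp: restr_def)
      next
        case False
        then show ?thesis using zw by (intro exI[of _ "{}"]) (auto simp: iota_rel_def)
      qed
      then show "(z, w) \<in> Rep_eqv y" using sub by blast
    qed
    then show ?thesis by (simp add: less_eq_eqv_def R(2) Rep_iota[OF R(1)])
  qed simp
  show "\<exists>k1\<in>insert bot (iota b ` fin_Eq \<Omega>). \<exists>k2\<in>insert bot (iota b ` fin_Eq \<Omega>).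
      k1 \<le> x \<and> k2 \<le> y \<and> k \<le> sup k1 k2"
    if k: "k \<in> insert bot (iota b ` fin_Eq \<Omega>)" and x: "x \<in> insert bot (iota b ` Eq \<Omega>)"
      and y: "y \<in> insert bot (iota b ` Eq \<Omega>)" and word_le: "k \<le> sup x y" for k x y
  \<comment> \<open>As \<open>bot\<close> may come from no relation, it is treated apart: the
    supremum then degenerates to one side, or \<open>k\<close> is zero.\<close>
  proof (cases "k = bot \<or> x = bot \<or> y = bot")
    case True
    then have "(bot \<le> x \<and> bot \<le> y \<and> k \<le> sup bot bot) \<or> (bot \<le> x \<and> k \<le> y \<and> k \<le> sup bot k)
        \<or> (k \<le> x \<and> bot \<le> y \<and> k \<le> sup k bot)"
      using word_le by auto
    then show ?thesis using k by blast
  next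
    case False
    then obtain T R S where T: "T \<in> fin_Eq \<Omega>" "k = iota b T" and R: "R \<in> Eq \<Omega>" "x = iota b R"
      and S: "S \<in> Eq \<Omega>" "y = iota b S" using k x y by blast
    have T': "T \<in> Eq \<Omega>" using T fin_Eq_subset by blast
    have "T \<subseteq> trancl (R \<union> S)"
      using word_le iota_le_iff[OF T' Eq_closed(2)[OF R(1) S(1)], of b]
      unfolding T(2) R(2) S(2) iota_sup[OF R(1) S(1), symmetric] by blast
    then obtain F where F: "finite F" "T \<subseteq> trancl (restr \<Omega> R F \<union> restr \<Omega> S F)"
      using fin_Eq_compact[OF T(1)] by blast
    have RF: "restr \<Omega> R F \<in> fin_Eq \<Omega>" and SF: "restr \<Omega> S F \<in> fin_Eq \<Omega>"
      using restr_in_fin_Eq R(1) S(1) F(1) by blast+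
    then have RF': "restr \<Omega> R F \<in> Eq \<Omega>" and SF': "restr \<Omega> S F \<in> Eq \<Omega>"
      using fin_Eq_subset by blast+
    have "k \<le> sup (iota b (restr \<Omega> R F)) (iota b (restr \<Omega> S F))"
      using iota_le_iff[OF T' Eq_closed(2)[OF RF' SF'], of b] F(2)
      unfolding T(2) iota_sup[OF RF' SF', symmetric] by blast
    moreover have "iota b (restr \<Omega> R F) \<le> x" "iota b (restr \<Omega> S F) \<le> y"
      using iota_le_iff[OF RF' R(1), of b] iota_le_iff[OF SF' S(1), of b]
        restr_subset[OF R(1)] restr_subset[OF S(1)] R(2) S(2) by blast+
    ultimately show ?thesis using RF SF by blast
  qed
qed

section \<open>Presented lattices\<close>

locale lattice_presentation =
  fixes G :: "'g set" and Rel :: "('g lterm \<times> 'g lterm) set"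
  assumes Rel_gens: "(s, t) \<in> Rel \<Longrightarrow> lt_gens s \<subseteq> G \<and> lt_gens t \<subseteq> G"
begin

abbreviation C where "C \<equiv> lat_cong G Rel"

abbreviation T where "T \<equiv> {t. lt_gens t \<subseteq> G}"

text \<open>As \<open>LMeet\<close> is the supremum here, absorption of \<open>s\<close> into
  \<open>t\<close> under \<open>LMeet\<close> puts \<open>s\<close> under \<open>t\<close>.\<close>

definition below :: "'g lterm \<Rightarrow> 'g lterm \<Rightarrow> bool" where
  "below s t \<longleftrightarrow> (LMeet s t, t) \<in> C"

lemma C_gens: "(s, t) \<in> C \<Longrightarrow> s \<in> T \<and> t \<in> T"
  by (induction rule: lat_cong.induct) (use Rel_gens in auto)

lemma Meet_idem:
  assumes "p \<in> T"
  shows "(LMeet p p, p) \<in> C"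
proof -
  have p: "lt_gens p \<subseteq> G" using assms by simp
  have "(LMeet p p, LMeet p (LJoin p (LMeet p p))) \<in> C"
    by (rule lat_cong.meet_cong[OF lat_cong.refl[OF p] lat_cong.sym[OF lat_cong.join_absorb[OF p p]]])
  moreover have "(LMeet p (LJoin p (LMeet p p)), p) \<in> C"
    by (rule lat_cong.meet_absorb[OF p]) (use p in simp)
  ultimately show ?thesis by (rule lat_cong.trans)
qed

lemma below_refl: "p \<in> T \<Longrightarrow> below p p"
  by (simp add: below_def Meet_idem)

lemma below_antisym:
  assumes "below p q" "below q p"
  shows "(p, q) \<in> C"
proof -
  have "p \<in> T" "q \<in> T" using assms C_gens by (auto simp: below_def)
  then have "(LMeet q p, LMeet p q) \<in> C" by (auto intro: lat_cong.meet_comm)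
  then show ?thesis
    using assms lat_cong.trans lat_cong.sym unfolding below_def by meson
qed

lemma C_below:
  assumes "(p, q) \<in> C"
  shows "below p q"
proof -
  have q: "q \<in> T" using C_gens[OF assms] by blast
  have "(LMeet p q, LMeet q q) \<in> C"
    using lat_cong.meet_cong[OF assms lat_cong.refl] q by blast
  then show ?thesis unfolding below_def using Meet_idem[OF q] lat_cong.trans by meson
qed

lemma below_gens: "below p q \<Longrightarrow> p \<in> T \<and> q \<in> T"
  using C_gens[of "LMeet p q" q] by (auto simp: below_def)

lemma below_trans:
  assumes pq: "below p q" and qr: "below q r"
  shows "below p r"
proof -
  have g: "lt_gens p \<subseteq> G" "lt_gens q \<subseteq> G" "lt_gens r \<subseteq> G"
    using below_gens[OF pq] below_gens[OF qr] by auto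
  have "(LMeet p r, LMeet p (LMeet q r)) \<in> C"
    using lat_cong.meet_cong[OF lat_cong.refl[OF g(1)] lat_cong.sym[OF qr[unfolded below_def]]] .
  moreover have "(LMeet p (LMeet q r), LMeet (LMeet p q) r) \<in> C"
    using lat_cong.sym[OF lat_cong.meet_assoc[OF g]] .
  moreover have "(LMeet (LMeet p q) r, LMeet q r) \<in> C"
    using lat_cong.meet_cong[OF pq[unfolded below_def] lat_cong.refl[OF g(3)]] .
  ultimately show ?thesis using qr unfolding below_def by (meson lat_cong.trans)
qed

lemma below_MeetL:
  assumes pr: "below p r" and qr: "below q r"
  shows "below (LMeet p q) r"
proof -
  have g: "lt_gens p \<subseteq> G" "lt_gens q \<subseteq> G" "lt_gens r \<subseteq> G"
    using below_gens[OF pr] below_gens[OF qr] by auto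
  have "(LMeet (LMeet p q) r, LMeet p (LMeet q r)) \<in> C" using lat_cong.meet_assoc[OF g] .
  moreover have "(LMeet p (LMeet q r), LMeet p r) \<in> C"
    using lat_cong.meet_cong[OF lat_cong.refl[OF g(1)] qr[unfolded below_def]] .
  ultimately show ?thesis using pr unfolding below_def by (meson lat_cong.trans)
qed

lemma below_Meet1:
  assumes "p \<in> T" "q \<in> T"
  shows "below p (LMeet p q)"
proof -
  have g: "lt_gens p \<subseteq> G" "lt_gens q \<subseteq> G" using assms by auto
  have "(LMeet p (LMeet p q), LMeet (LMeet p p) q) \<in> C"
    using lat_cong.sym[OF lat_cong.meet_assoc[OF g(1,1,2)]] .
  moreover have "(LMeet (LMeet p p) q, LMeet p q) \<in> C"
    using lat_cong.meet_cong[OF Meet_idem[OF assms(1)] lat_cong.refl[OF g(2)]] .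
  ultimately show ?thesis unfolding below_def by (rule lat_cong.trans)
qed

lemma below_Meet2:
  assumes "p \<in> T" "q \<in> T"
  shows "below q (LMeet p q)"
  using below_trans[OF below_Meet1[OF assms(2,1)]] C_below[OF lat_cong.meet_comm] assms by blast

lemma below_Join1:
  assumes "p \<in> T" "q \<in> T"
  shows "below (LJoin p q) p"
proof -
  have g: "lt_gens p \<subseteq> G" "lt_gens q \<subseteq> G" using assms by auto
  have "(LMeet (LJoin p q) p, LMeet p (LJoin p q)) \<in> C"
    by (rule lat_cong.meet_comm) (use g in auto)
  then show ?thesis unfolding below_def using lat_cong.meet_absorb[OF g] by (rule lat_cong.trans)
qed

lemma below_Join2:
  assumes "p \<in> T" "q \<in> T"
  shows "below (LJoin p q) q"
  using below_trans[OF C_below[OF lat_cong.join_comm] below_Join1[OF assms(2,1)]] assms by blast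

lemma below_Join_absorb:
  assumes "below r p"
  shows "(LJoin r p, r) \<in> C"
proof -
  have g: "lt_gens p \<subseteq> G" "lt_gens r \<subseteq> G" using below_gens[OF assms] by auto
  have "(LJoin r p, LJoin r (LMeet r p)) \<in> C"
    using lat_cong.join_cong[OF lat_cong.refl[OF g(2)] lat_cong.sym[OF assms[unfolded below_def]]] .
  then show ?thesis using lat_cong.join_absorb[OF g(2,1)] by (rule lat_cong.trans)
qed

lemma below_JoinR:
  assumes rp: "below r p" and rq: "below r q"
  shows "below r (LJoin p q)"
proof -
  have g: "lt_gens p \<subseteq> G" "lt_gens q \<subseteq> G" "lt_gens r \<subseteq> G"
    using below_gens[OF rp] below_gens[OF rq] by auto
  have "(LJoin r (LJoin p q), LJoin (LJoin r p) q) \<in> C"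
    using lat_cong.sym[OF lat_cong.join_assoc[OF g(3,1,2)]] .
  moreover have "(LJoin (LJoin r p) q, LJoin r q) \<in> C"
    using lat_cong.join_cong[OF below_Join_absorb[OF rp] lat_cong.refl[OF g(2)]] .
  ultimately have "(LJoin r (LJoin p q), r) \<in> C"
    using below_Join_absorb[OF rq] by (meson lat_cong.trans)
  then have "below r (LJoin r (LJoin p q))" by (rule C_below[OF lat_cong.sym])
  moreover have "below (LJoin r (LJoin p q)) (LJoin p q)" by (rule below_Join2) (use g in auto)
  ultimately show ?thesis by (rule below_trans)
qed

end

lemma lt_gens_map: "lt_gens (map_lterm f t) = f ` lt_gens t"
  by (induction t) auto

lemma lat_cong_map:
  assumes f: "f ` G \<subseteq> G'"
    and Rel: "\<And>s t. (s, t) \<in> Rel \<Longrightarrow> (map_lterm f s, map_lterm f t) \<in> lat_cong G' Rel'"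
    and st: "(s, t) \<in> lat_cong G Rel"
  shows "(map_lterm f s, map_lterm f t) \<in> lat_cong G' Rel'"
proof -
  have gens: "lt_gens (map_lterm f t) \<subseteq> G'" if "lt_gens t \<subseteq> G" for t
    using f image_mono[OF that, of f] by (simp add: lt_gens_map)
  from st show ?thesis
  proof (induction rule: lat_cong.induct)
  case (rel s t)
  then show ?case by (rule Rel)
next
  case (sym s t)
  show ?case using sym.IH by (rule lat_cong.sym)
next
  case (trans s t u)
  show ?case using trans.IH by (rule lat_cong.trans)
qed (simp_all add: lat_cong.refl lat_cong.meet_cong lat_cong.join_cong lat_cong.meet_comm
    lat_cong.join_comm lat_cong.meet_assoc lat_cong.join_assoc lat_cong.meet_absorb
    lat_cong.join_absorb gens)
qed

section \<open>The word problem of the coproducts as presented lattices\<close>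

text \<open>One presentation covers both coproducts: if \<open>bot\<close> belongs to
  \<open>G\<close>, the zeros are identified; otherwise \<open>bot\<close> is a new zero that only
  the covers mention.\<close>

definition zero_rels :: "'l::bounded_lattice set \<Rightarrow> (('l + 'l) lterm \<times> ('l + 'l) lterm) set" where
  "zero_rels G = coprod_rels G sup inf G sup inf
     \<union> (if bot \<in> G then {(Gen (Inl bot), Gen (Inr bot))} else {})"

locale pointed_sublattice = proper_sublattice "insert bot G" for G :: "'l::bounded_lattice set" +
  assumes sup_in_G: "x \<in> G \<Longrightarrow> y \<in> G \<Longrightarrow> sup x y \<in> G"
    and inf_in_G: "x \<in> G \<Longrightarrow> y \<in> G \<Longrightarrow> inf x y \<in> G"
begin

sublocale lattice_presentation "coprod_gens G G" "zero_rels G"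
  by unfold_locales
    (auto simp: zero_rels_def coprod_rels_def coprod_gens_def sup_in_G inf_in_G split: if_splits)

abbreviation gen :: "bool \<Rightarrow> 'l \<Rightarrow> ('l + 'l) lterm" where
  "gen b x \<equiv> Gen (if b then Inl x else Inr x)"

lemma terms_T: "t \<in> terms G \<longleftrightarrow> t \<in> T"
  by (simp add: terms_def)

lemma terms_A: "t \<in> terms G \<Longrightarrow> t \<in> terms (insert bot G)"
  using terms_mono[of G "insert bot G"] by blast

lemma gen_in [simp]: "gen b x \<in> terms G \<longleftrightarrow> x \<in> G"
  by simp

lemma C_sup: "x \<in> G \<Longrightarrow> y \<in> G \<Longrightarrow> (gen b (sup x y), LMeet (gen b x) (gen b y)) \<in> C"
  by (rule lat_cong.rel) (auto simp: zero_rels_def coprod_rels_def)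

lemma C_inf: "x \<in> G \<Longrightarrow> y \<in> G \<Longrightarrow> (gen b (inf x y), LJoin (gen b x) (gen b y)) \<in> C"
  by (rule lat_cong.rel) (auto simp: zero_rels_def coprod_rels_def)

lemma C_bot: "bot \<in> G \<Longrightarrow> (gen b bot, gen b' bot) \<in> C"
proof -
  assume bot: "bot \<in> G"
  have 1: "(Gen (Inl bot), Gen (Inr bot)) \<in> C"
    by (rule lat_cong.rel) (simp add: zero_rels_def bot)
  have 2: "(gen b bot, gen b bot) \<in> C" for b
    by (rule lat_cong.refl) (use bot in \<open>auto simp: coprod_gens_def\<close>)
  show ?thesis using 1 lat_cong.sym[OF 1] 2[of True] 2[of False] by (cases b; cases b') simp_all
qed

lemma below_gen_mono:
  assumes "x \<in> G" "y \<in> G" "x \<le> y"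
  shows "below (gen b x) (gen b y)"
proof -
  have "sup x y = y" using assms(3) by (rule sup_absorb2)
  with C_sup[OF assms(1,2), of b] have "(gen b y, LMeet (gen b x) (gen b y)) \<in> C" by (simp only:)
  then show ?thesis unfolding below_def by (rule lat_cong.sym)
qed

lemma below_gen_refl: "x \<in> G \<Longrightarrow> below (gen b x) (gen b x)"
  by (rule below_refl) (auto simp: coprod_gens_def)

text \<open>A lower cover \<open>bot\<close> outside \<open>G\<close> has no generator, hence the
  hypothesis that the cover lies in \<open>G\<close>.\<close>

lemma low_below:
  "t \<in> terms G \<Longrightarrow> low t b \<in> G \<Longrightarrow> below (gen b (low t b)) t"
proof (induction t)
  case (Gen g)
  have *: "below (gen b (if b = c then x else bot)) (gen c x)"
    if "x \<in> G" "(if b = c then x else bot) \<in> G" for c x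
  proof (cases "b = c")
    case True
    then show ?thesis using below_gen_refl[OF that(1), of c] by (simp only: if_True simp_thms)
  next
    case False
    then have bot: "bot \<in> G" using that by simp
    show ?thesis
      using below_trans[OF C_below[OF C_bot[OF bot, of b c]] below_gen_mono[OF bot that(1), of c]] False
      by (simp only: if_False) simp
  qed
  show ?case
  proof (cases g)
    case (Inl x)
    then show ?thesis using *[of x True] Gen by (cases b) simp_all
  next
    case (Inr x)
    then show ?thesis using *[of x False] Gen by (cases b) simp_all
  qed
next
  case (LMeet s t)
  have st: "s \<in> terms G" "t \<in> terms G" using LMeet.prems by simp_all
  then have A: "low s b \<in> insert bot G" "low t b \<in> insert bot G"
    using low_in terms_A by blast+
  have T: "s \<in> T" "t \<in> T" using st terms_T by blast+
  have s: "below (gen b (low s b)) (LMeet s t)" if "low s b \<in> G"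
    using below_trans[OF LMeet.IH(1)[OF st(1) that] below_Meet1[OF T]] .
  have t: "below (gen b (low t b)) (LMeet s t)" if "low t b \<in> G"
    using below_trans[OF LMeet.IH(2)[OF st(2) that] below_Meet2[OF T]] .
  show ?case
  proof (cases "low s b \<in> G \<and> low t b \<in> G")
    case True
    show ?thesis unfolding low.simps
      by (rule below_trans[OF C_below[OF C_sup] below_MeetL[OF s t]]) (use True in blast)+
  next
    case False
    then show ?thesis using A s t LMeet.prems(2) by auto
  qed
next
  case (LJoin s t)
  have st: "s \<in> terms G" "t \<in> terms G" using LJoin.prems by simp_all
  then have A: "low s b \<in> insert bot G" "low t b \<in> insert bot G"
    using low_in terms_A by blast+
  have G: "low s b \<in> G" "low t b \<in> G"
  proof -
    have "low s b \<noteq> bot \<or> bot \<in> G" "low t b \<noteq> bot \<or> bot \<in> G" using LJoin.prems(2) by auto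
    then show "low s b \<in> G" "low t b \<in> G" using A by auto
  qed
  have T: "gen b (low s b) \<in> T" "gen b (low t b) \<in> T" using G terms_T gen_in by blast+
  have "below (LJoin (gen b (low s b)) (gen b (low t b))) (LJoin s t)"
    by (rule below_JoinR[OF below_trans[OF below_Join1[OF T] LJoin.IH(1)[OF st(1) G(1)]]
          below_trans[OF below_Join2[OF T] LJoin.IH(2)[OF st(2) G(2)]]])
  then show ?case unfolding low.simps by (rule below_trans[OF C_below[OF C_inf[OF G]]])
qed

lemma up_below:
  "t \<in> terms G \<Longrightarrow> up t b \<in> insert top G \<and> (up t b \<noteq> top \<longrightarrow> below t (gen b (up t b)))"
proof (induction t arbitrary: b)
  case (Gen g)
  have *: "(if b = c \<or> x = bot then x else top) \<in> insert top G \<and>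
      ((if b = c \<or> x = bot then x else top) \<noteq> top \<longrightarrow>
        below (gen c x) (gen b (if b = c \<or> x = bot then x else top)))"
    if x: "x \<in> G" for c x
  proof (cases "b = c")
    case True
    then show ?thesis using below_gen_refl[OF x, of c] x by (simp only: if_True simp_thms insert_iff)
  next
    case False
    then show ?thesis using x C_below[OF C_bot, of c b] by auto
  qed
  show ?case
  proof (cases g)
    case (Inl x)
    then show ?thesis using *[of x True] Gen by (cases b) simp_all
  next
    case (Inr x)
    then show ?thesis using *[of x False] Gen by (cases b; cases "x = bot") simp_all
  qed
next
  case (LMeet s t)
  have st: "s \<in> terms G" "t \<in> terms G" using LMeet.prems by simp_all
  show ?case
  proof (cases "up s b = top \<or> up t b = top")
    case True
    then show ?thesis by (auto simp: sup_top_left sup_top_right)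
  next
    case False
    then have G: "up s b \<in> G" "up t b \<in> G"
      and b: "below s (gen b (up s b))" "below t (gen b (up t b))"
      using LMeet.IH(1)[OF st(1), of b] LMeet.IH(2)[OF st(2), of b] by auto
    have T: "gen b (up s b) \<in> T" "gen b (up t b) \<in> T" using G terms_T gen_in by blast+
    have "below (LMeet s t) (LMeet (gen b (up s b)) (gen b (up t b)))"
      by (rule below_MeetL[OF below_trans[OF b(1) below_Meet1[OF T]]
            below_trans[OF b(2) below_Meet2[OF T]]])
    then have "below (LMeet s t) (gen b (sup (up s b) (up t b)))"
      using below_trans C_below[OF lat_cong.sym[OF C_sup[OF G]]] by blast
    then show ?thesis using sup_in_G[OF G] unfolding up.simps by blast
  qed
next
  case (LJoin s t)
  have st: "s \<in> terms G" "t \<in> terms G" using LJoin.prems by simp_all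
  have T: "s \<in> T" "t \<in> T" using st terms_T by blast+
  have inf: "inf (up s c) (up t c) \<in> insert top G \<and>
      (inf (up s c) (up t c) \<noteq> top \<longrightarrow> below (LJoin s t) (gen c (inf (up s c) (up t c))))" for c
  proof -
    have s: "below (LJoin s t) (gen c (up s c))" if "up s c \<noteq> top"
      using below_trans[OF below_Join1[OF T]] LJoin.IH(1)[OF st(1), of c] that by blast
    have t: "below (LJoin s t) (gen c (up t c))" if "up t c \<noteq> top"
      using below_trans[OF below_Join2[OF T]] LJoin.IH(2)[OF st(2), of c] that by blast
    consider "up s c = top" | "up t c = top" | "up s c \<noteq> top" "up t c \<noteq> top" by blast
    then show ?thesis
    proof cases
      case 1
      then have eq: "inf (up s c) (up t c) = up t c" by simp
      show ?thesis unfolding eq using t LJoin.IH(2)[OF st(2), of c] by blast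
    next
      case 2
      then have eq: "inf (up s c) (up t c) = up s c" by simp
      show ?thesis unfolding eq using s LJoin.IH(1)[OF st(1), of c] by blast
    next
      case 3
      then have G: "up s c \<in> G" "up t c \<in> G"
        using LJoin.IH(1)[OF st(1), of c] LJoin.IH(2)[OF st(2), of c] by auto
      have "below (LJoin s t) (LJoin (gen c (up s c)) (gen c (up t c)))"
        by (rule below_JoinR[OF s[OF 3(1)] t[OF 3(2)]])
      then have "below (LJoin s t) (gen c (inf (up s c) (up t c)))"
        using below_trans C_below[OF lat_cong.sym[OF C_inf[OF G]]] by blast
      then show ?thesis using inf_in_G[OF G] by blast
    qed
  qed
  show ?case
  proof (cases "inf (up s (\<not> b)) (up t (\<not> b)) = bot")
    case True
    \<comment> \<open>The exceptional clause fires only if \<open>bot\<close> is a cover of the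
      other side and thus belongs to \<open>G\<close>. The zeros are then identified, so zero bounds
      the infimum in either factor.\<close>
    have "bot \<noteq> (top :: 'l)" using top_notin by auto
    then have bot: "bot \<in> G" "below (LJoin s t) (gen (\<not> b) bot)"
      using inf[of "\<not> b"] True by auto
    then have "below (LJoin s t) (gen b bot)" using below_trans C_below[OF C_bot] by blast
    then show ?thesis using bot(1) unfolding up.simps if_P[OF True] by blast
  next
    case False
    show ?thesis using inf[of b] unfolding up.simps if_not_P[OF False] by blast
  qed
qed

text \<open>Every rule is derivable from the presentation. In the cover rule both covers are
  generators: the upper one is not \<open>top\<close>, and if the lower one is zero, it equals the
  upper one.\<close>

lemma word_le_below: "word_le p q \<Longrightarrow> p \<in> terms G \<Longrightarrow> q \<in> terms G \<Longrightarrow> below p q"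
proof (induction rule: word_le.induct)
  case (cov p b q)
  have A: "low q b \<in> insert bot G" using low_in terms_A cov.prems(2) by blast
  then have "low q b \<noteq> top" using top_notin by auto
  then have "up p b \<noteq> top" using cov.hyps by (auto simp: top_unique)
  then have up: "up p b \<in> G" "below p (gen b (up p b))"
    using up_below[OF cov.prems(1), of b] by auto
  have low: "low q b \<in> G"
  proof (cases "low q b = bot")
    case True
    then have "up p b = bot" using cov.hyps by (metis bot.extremum_uniqueI)
    then show ?thesis using up(1) True by simp
  qed (use A in auto)
  show ?case
    using below_trans[OF up(2) below_trans[OF below_gen_mono[OF up(1) low cov.hyps]
          low_below[OF cov.prems(2) low]]] .
next
  case (MeetL p r q)
  then show ?case by (simp add: below_MeetL)
next
  case (JoinR r p q)
  then show ?case by (simp add: below_JoinR)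
next
  case (MeetR1 r p q)
  then have "below p (LMeet p q)" using below_Meet1 terms_T by simp
  then show ?case using MeetR1 below_trans unfolding terms_simps by blast
next
  case (MeetR2 r q p)
  then have "below q (LMeet p q)" using below_Meet2 terms_T by simp
  then show ?case using MeetR2 below_trans unfolding terms_simps by blast
next
  case (JoinL1 p r q)
  then have "below (LJoin p q) p" using below_Join1 terms_T by simp
  then show ?case using JoinL1 below_trans unfolding terms_simps by blast
next
  case (JoinL2 q r p)
  then have "below (LJoin p q) q" using below_Join2 terms_T by simp
  then show ?case using JoinL2 below_trans unfolding terms_simps by blast
qed

text \<open>For both sides of a defining relation, the lower and upper covers in one factor all
  coincide, so the cover rule applies in both directions.\<close>

lemma rel_le:
  assumes "(s, t) \<in> zero_rels G"
  shows "word_le s t \<and> word_le t s"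
proof -
  \<comment> \<open>This keeps the exceptional clause of \<open>up\<close> from firing for an
    infimum of two nonzero generators.\<close>
  have top: "inf top top \<noteq> (bot :: 'l)" using top_notin by auto
  have Inl: "word_le s t \<and> word_le t s" if "low s True = up s True" "low t True = up t True" "low s True = low t True"
    for s t :: "('l + 'l) lterm" using that cov[of s True t] cov[of t True s] by simp
  have Inr: "word_le s t \<and> word_le t s" if "low s False = up s False" "low t False = up t False" "low s False = low t False"
    for s t :: "('l + 'l) lterm" using that cov[of s False t] cov[of t False s] by simp
  consider "\<exists>x y. s = Gen (Inl (sup x y)) \<and> t = LMeet (Gen (Inl x)) (Gen (Inl y))"
    | "\<exists>x y. s = Gen (Inl (inf x y)) \<and> t = LJoin (Gen (Inl x)) (Gen (Inl y))"
    | "\<exists>x y. s = Gen (Inr (sup x y)) \<and> t = LMeet (Gen (Inr x)) (Gen (Inr y))"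
    | "\<exists>x y. s = Gen (Inr (inf x y)) \<and> t = LJoin (Gen (Inr x)) (Gen (Inr y))"
    | "s = Gen (Inl bot) \<and> t = Gen (Inr bot)"
    using assms unfolding zero_rels_def coprod_rels_def by (auto split: if_splits)
  then show ?thesis
  proof cases
    case 1
    then show ?thesis by (intro Inl) auto
  next
    case 2
    then show ?thesis using top by (intro Inl) auto
  next
    case 3
    then show ?thesis by (intro Inr) auto
  next
    case 4
    then show ?thesis using top by (intro Inr) auto
  next
    case 5
    then show ?thesis by (intro Inl) auto
  qed
qed

text \<open>Cut elimination pays off here: transitivity of the congruence becomes
  \<open>word_le_trans\<close>.\<close>

lemma C_le: "(s, t) \<in> C \<Longrightarrow> word_le s t \<and> word_le t s"
proof (induction rule: lat_cong.induct)
  case (rel s t)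
  then show ?case by (rule rel_le)
next
  case (trans s t u)
  have "s \<in> terms (insert bot G)" "t \<in> terms (insert bot G)" "u \<in> terms (insert bot G)"
    using C_gens[OF trans.hyps(1)] C_gens[OF trans.hyps(2)] terms_T terms_A by blast+
  then show ?case using trans.IH word_le_trans by blast
next
  case (meet_assoc s t u)
  show ?case by (intro conjI MeetL) (simp_all add: MeetR1 MeetR2 word_le_refl)
next
  case (join_assoc s t u)
  show ?case by (intro conjI JoinR) (simp_all add: JoinL1 JoinL2 word_le_refl)
qed (auto intro: word_le_refl MeetL JoinR MeetR1 MeetR2 JoinL1 JoinL2)

lemma C_iff_le:
  assumes "s \<in> terms G" "t \<in> terms G"
  shows "(s, t) \<in> C \<longleftrightarrow> word_le s t \<and> word_le t s"
  using C_le below_antisym[OF word_le_below word_le_below] assms by blast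

end

section \<open>The embeddings\<close>

definition iota_gen :: "bool \<Rightarrow> 'a rel + 'a rel \<Rightarrow> ('a + bool) eqv + ('a + bool) eqv" where
  "iota_gen b = map_sum (iota b) (iota b)"

text \<open>\<open>b\<close> distinguishes the plain coproduct from the coproduct with common unit.\<close>
definition coprodb_rels :: "bool \<Rightarrow> 'a set \<Rightarrow> (('a rel + 'a rel) lterm \<times> ('a rel + 'a rel) lterm) set" where
  "coprodb_rels b \<Omega> = (if b then coprod_rels (Eq \<Omega>) eqop_meet eqop_join (Eq \<Omega>) eqop_meet eqop_join
     else coprod1_rels (Eq \<Omega>) eqop_meet eqop_join (eqop_top \<Omega>)
            (Eq \<Omega>) eqop_meet eqop_join (eqop_top \<Omega>))"

lemma pointed_sublattice_iota: "pointed_sublattice (iota b ` Eq \<Omega>)"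
proof -
  interpret compact_sublattice "insert bot (iota b ` Eq \<Omega>)" "insert bot (iota b ` fin_Eq \<Omega>)"
    by (rule compact_sublattice_iota)
  show ?thesis
  proof
    fix x y assume "x \<in> iota b ` Eq \<Omega>" "y \<in> iota b ` Eq \<Omega>"
    then obtain R S where RS: "R \<in> Eq \<Omega>" "S \<in> Eq \<Omega>" "x = iota b R" "y = iota b S" by blast
    show "sup x y \<in> iota b ` Eq \<Omega>" "inf x y \<in> iota b ` Eq \<Omega>"
      unfolding RS(3,4) iota_sup[OF RS(1,2), symmetric] iota_inf[OF RS(1,2), symmetric]
      using Eq_closed[OF RS(1,2)] by blast+
  qed
qed

lemma iota_gen_image: "iota_gen b ` coprod_gens (Eq \<Omega>) (Eq \<Omega>) = coprod_gens (iota b ` Eq \<Omega>) (iota b ` Eq \<Omega>)"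
  by (simp add: coprod_gens_def iota_gen_def image_Un image_image)

lemma map_iota_terms:
  "lt_gens s \<subseteq> coprod_gens (Eq \<Omega>) (Eq \<Omega>) \<Longrightarrow> map_lterm (iota_gen b) s \<in> terms (iota b ` Eq \<Omega>)"
  using image_mono[of "lt_gens s" "coprod_gens (Eq \<Omega>) (Eq \<Omega>)" "iota_gen b"]
  by (simp add: terms_def lt_gens_map iota_gen_image)

lemma bot_in_iota: "bot \<in> iota b ` Eq \<Omega> \<longleftrightarrow> \<not> b"
proof (cases b)
  case True
  then show ?thesis using iota_True_neq_bot[of _ \<Omega>] by fastforce
next
  case False
  then show ?thesis using iota_False_bot[of \<Omega>] Id_on_in_Eq[of \<Omega>] by (metis imageI)
qed

lemma coprodb_rels_iota:
  assumes "(s, t) \<in> coprodb_rels b \<Omega>"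
  shows "(map_lterm (iota_gen b) s, map_lterm (iota_gen b) t) \<in> zero_rels (iota b ` Eq \<Omega>)"
  using assms unfolding coprodb_rels_def coprod1_rels_def coprod_rels_def zero_rels_def
  by (auto simp: bot_in_iota iota_gen_def eqop_meet_def eqop_join_def eqop_top_def
      iota_sup[of _ \<Omega>] iota_inf[of _ \<Omega>] iota_False_bot split: if_splits)

lemma zero_rels_inv_iota:
  fixes \<Omega> :: "'a set" and b :: bool
  defines "g \<equiv> map_sum (inv_into (Eq \<Omega>) (iota b)) (inv_into (Eq \<Omega>) (iota b))"
  assumes "(s, t) \<in> zero_rels (iota b ` Eq \<Omega>)"
  shows "(map_lterm g s, map_lterm g t) \<in> coprodb_rels b \<Omega>"
proof -
  have inv: "inv_into (Eq \<Omega>) (iota b) (iota b R) = R" if "R \<in> Eq \<Omega>" for R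
    using inv_into_f_f[OF iota_inj that] .
  have sup: "inv_into (Eq \<Omega>) (iota b) (sup (iota b R) (iota b S)) = trancl (R \<union> S)"
    and inf: "inv_into (Eq \<Omega>) (iota b) (inf (iota b R) (iota b S)) = R \<inter> S"
    if "R \<in> Eq \<Omega>" "S \<in> Eq \<Omega>" for R S
    using inv[OF Eq_closed(1)[OF that]] inv[OF Eq_closed(2)[OF that]]
    by (simp_all add: iota_sup[OF that] iota_inf[OF that])
  have bot: "inv_into (Eq \<Omega>) (iota b) bot = Id_on \<Omega>" if "\<not> b"
    using inv[OF Id_on_in_Eq] iota_False_bot[of \<Omega>] that by simp
  have sub: "coprod_rels (Eq \<Omega>) eqop_meet eqop_join (Eq \<Omega>) eqop_meet eqop_join \<subseteq> coprodb_rels b \<Omega>"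
    by (auto simp: coprodb_rels_def coprod1_rels_def)
  have "\<exists>R\<in>Eq \<Omega>. \<exists>S\<in>Eq \<Omega>.
      s = Gen (Inl (sup (iota b R) (iota b S))) \<and> t = LMeet (Gen (Inl (iota b R))) (Gen (Inl (iota b S)))
      \<or> s = Gen (Inl (inf (iota b R) (iota b S))) \<and> t = LJoin (Gen (Inl (iota b R))) (Gen (Inl (iota b S)))
      \<or> s = Gen (Inr (sup (iota b R) (iota b S))) \<and> t = LMeet (Gen (Inr (iota b R))) (Gen (Inr (iota b S)))
      \<or> s = Gen (Inr (inf (iota b R) (iota b S))) \<and> t = LJoin (Gen (Inr (iota b R))) (Gen (Inr (iota b S)))"
    if "\<not> (\<not> b \<and> s = Gen (Inl bot) \<and> t = Gen (Inr bot))"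
    using assms(2) that unfolding zero_rels_def bot_in_iota coprod_rels_def by (cases b) auto
  moreover have "(map_lterm g s, map_lterm g t) \<in> coprodb_rels b \<Omega>"
    if "\<not> b \<and> s = Gen (Inl bot) \<and> t = Gen (Inr bot)"
    using that bot by (cases b) (simp_all add: g_def coprodb_rels_def coprod1_rels_def eqop_top_def)
  moreover have "(map_lterm g s, map_lterm g t) \<in> coprodb_rels b \<Omega>"
    if "R \<in> Eq \<Omega>" "S \<in> Eq \<Omega>"
      "s = Gen (Inl (sup (iota b R) (iota b S))) \<and> t = LMeet (Gen (Inl (iota b R))) (Gen (Inl (iota b S)))
      \<or> s = Gen (Inl (inf (iota b R) (iota b S))) \<and> t = LJoin (Gen (Inl (iota b R))) (Gen (Inl (iota b S)))
      \<or> s = Gen (Inr (sup (iota b R) (iota b S))) \<and> t = LMeet (Gen (Inr (iota b R))) (Gen (Inr (iota b S)))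
      \<or> s = Gen (Inr (inf (iota b R) (iota b S))) \<and> t = LJoin (Gen (Inr (iota b R))) (Gen (Inr (iota b S)))"
    for R S
  proof (rule subsetD[OF sub])
    have rels: "(Gen (Inl (trancl (R \<union> S))), LMeet (Gen (Inl R)) (Gen (Inl S))) \<in> coprod_rels (Eq \<Omega>) eqop_meet eqop_join (Eq \<Omega>) eqop_meet eqop_join"
      "(Gen (Inl (R \<inter> S)), LJoin (Gen (Inl R)) (Gen (Inl S))) \<in> coprod_rels (Eq \<Omega>) eqop_meet eqop_join (Eq \<Omega>) eqop_meet eqop_join"
      "(Gen (Inr (trancl (R \<union> S))), LMeet (Gen (Inr R)) (Gen (Inr S))) \<in> coprod_rels (Eq \<Omega>) eqop_meet eqop_join (Eq \<Omega>) eqop_meet eqop_join"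
      "(Gen (Inr (R \<inter> S)), LJoin (Gen (Inr R)) (Gen (Inr S))) \<in> coprod_rels (Eq \<Omega>) eqop_meet eqop_join (Eq \<Omega>) eqop_meet eqop_join"
      using that(1,2) unfolding coprod_rels_def eqop_meet_def eqop_join_def by blast+
    show "(map_lterm g s, map_lterm g t) \<in> coprod_rels (Eq \<Omega>) eqop_meet eqop_join (Eq \<Omega>) eqop_meet eqop_join"
      using that(3) by (elim disjE conjE) (simp_all only: g_def lterm.map map_sum.simps
          inv[OF that(1)] inv[OF that(2)] sup[OF that(1,2)] inf[OF that(1,2)] rels)
  qed
  ultimately show ?thesis by blast
qed

text \<open>Renaming generators along \<open>iota\<close> and back identifies the two presentations.
  The diagonal becomes \<open>bot\<close> if \<open>b\<close> is false, which matches the common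
  unit, and \<open>bot\<close> stays outside the image if \<open>b\<close> is true.\<close>

lemma lat_cong_iff_le:
  fixes \<Omega> :: "'a set" and b :: bool
  assumes s: "lt_gens s \<subseteq> coprod_gens (Eq \<Omega>) (Eq \<Omega>)"
    and t: "lt_gens t \<subseteq> coprod_gens (Eq \<Omega>) (Eq \<Omega>)"
  shows "(s, t) \<in> lat_cong (coprod_gens (Eq \<Omega>) (Eq \<Omega>)) (coprodb_rels b \<Omega>) \<longleftrightarrow>
    word_le (map_lterm (iota_gen b) s) (map_lterm (iota_gen b) t) \<and>
    word_le (map_lterm (iota_gen b) t) (map_lterm (iota_gen b) s)"
proof -
  interpret pointed_sublattice "iota b ` Eq \<Omega>" by (rule pointed_sublattice_iota)
  let ?G = "coprod_gens (Eq \<Omega>) (Eq \<Omega>)"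
  let ?inv = "inv_into (Eq \<Omega>) (iota b)"
  let ?g = "map_sum ?inv ?inv"
  have inv: "?g (iota_gen b x) = x" if "x \<in> ?G" for x
    using that by (auto simp: coprod_gens_def iota_gen_def inv_into_f_f[OF iota_inj])
  have inv_map: "map_lterm ?g (map_lterm (iota_gen b) u) = u" if "lt_gens u \<subseteq> ?G" for u
    using that by (induction u) (simp_all add: inv)
  have "(s, t) \<in> lat_cong ?G (coprodb_rels b \<Omega>) \<longleftrightarrow>
      (map_lterm (iota_gen b) s, map_lterm (iota_gen b) t) \<in> C"
  proof
    assume st: "(s, t) \<in> lat_cong ?G (coprodb_rels b \<Omega>)"
    show "(map_lterm (iota_gen b) s, map_lterm (iota_gen b) t) \<in> C"
      by (rule lat_cong_map[OF _ _ st]) (simp_all add: iota_gen_image lat_cong.rel coprodb_rels_iota)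
  next
    assume st: "(map_lterm (iota_gen b) s, map_lterm (iota_gen b) t) \<in> C"
    have "?g ` coprod_gens (iota b ` Eq \<Omega>) (iota b ` Eq \<Omega>) \<subseteq> ?G"
      unfolding iota_gen_image[symmetric] using inv by auto
    then have "(map_lterm ?g (map_lterm (iota_gen b) s), map_lterm ?g (map_lterm (iota_gen b) t))
        \<in> lat_cong ?G (coprodb_rels b \<Omega>)"
      by (rule lat_cong_map[OF _ _ st]) (rule lat_cong.rel[OF zero_rels_inv_iota])
    then show "(s, t) \<in> lat_cong ?G (coprodb_rels b \<Omega>)" using inv_map s t by simp
  qed
  then show ?thesis using C_iff_le map_iota_terms s t by blast
qed

lemma eqop_embedding:
  fixes \<Omega> :: "'a set"
  assumes inf: "infinite \<Omega>"
  shows "\<exists>h1 h2. eqop_pres_embedding \<Omega> (coprodb_rels b \<Omega>) (coprod_bot \<Omega>)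
    (if b then coprod_top \<Omega> else coprod1_top \<Omega>) h1 h2"
proof -
  let ?A = "insert bot (iota b ` Eq \<Omega>)" and ?K = "insert bot (iota b ` fin_Eq \<Omega>)"
  let ?G = "coprod_gens (Eq \<Omega>) (Eq \<Omega>)"
  let ?m = "map_lterm (iota_gen b)"
  interpret compact_sublattice ?A ?K by (rule compact_sublattice_iota)
  \<comment> \<open>The unit of the plain coproduct is the least term in the order of relations, so
    it is the one to be turned into the diagonal. It serves for both values of
    \<open>b\<close>.\<close>
  define \<beta> where "\<beta> = ?m (coprod_top \<Omega>)"
  have \<beta>: "\<beta> = LJoin (Gen (Inl (iota b (Id_on \<Omega>)))) (Gen (Inr (iota b (Id_on \<Omega>))))"
    by (simp add: \<beta>_def coprod_top_def eqop_top_def iota_gen_def)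
  have \<beta>_in: "\<beta> \<in> terms ?A" using Id_on_in_Eq[of \<Omega>] by (simp add: \<beta>)
  have m_in: "?m s \<in> terms ?A" if "lt_gens s \<subseteq> ?G" for s
    using map_iota_terms[OF that] terms_mono[of "iota b ` Eq \<Omega>" ?A] by blast
  have \<beta>_le: "word_le \<beta> (?m s)" if "lt_gens s \<subseteq> ?G" for s
    using that
  proof (induction s)
    case (Gen g)
    then consider R where "g = Inl R" "R \<in> Eq \<Omega>" | R where "g = Inr R" "R \<in> Eq \<Omega>"
      by (auto simp: coprod_gens_def)
    then show ?case
    proof cases
      case 1
      then have "iota b (Id_on \<Omega>) \<le> iota b R"
        using iota_le_iff[OF Id_on_in_Eq 1(2)] Id_on_subset_Eq by blast
      then show ?thesis using 1 by (simp add: \<beta> iota_gen_def JoinL1 word_le_Gen_mono)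
    next
      case 2
      then have "iota b (Id_on \<Omega>) \<le> iota b R"
        using iota_le_iff[OF Id_on_in_Eq 2(2)] Id_on_subset_Eq by blast
      then show ?thesis using 2 by (simp add: \<beta> iota_gen_def JoinL2 word_le_Gen_mono)
    qed
  qed (simp_all add: MeetR1 JoinR)
  obtain a c where ac: "a \<in> \<Omega>" "c \<in> \<Omega>" "a \<noteq> c"
  proof -
    obtain a where a: "a \<in> \<Omega>" using infinite_imp_nonempty[OF inf] by blast
    have "infinite (\<Omega> - {a})" using inf by simp
    then obtain c where "c \<in> \<Omega> - {a}" using infinite_imp_nonempty by blast
    then show ?thesis using that a by blast
  qed
  \<comment> \<open>Identifying a single pair gives a compact relation other than the diagonal, as
    needed for the label \<open>\<kappa>\<close> of points that stay apart in the quotient.\<close>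
  define P where "P = restr \<Omega> (\<Omega> \<times> \<Omega>) {a, c}"
  have P: "P \<in> fin_Eq \<Omega>" unfolding P_def by (rule restr_in_fin_Eq[OF full_in_Eq]) simp
  define \<kappa> where "\<kappa> = Gen (Inl (iota b P) :: ('a + bool) eqv + ('a + bool) eqv)"
  have \<kappa>_in: "\<kappa> \<in> terms ?K" using P by (simp add: \<kappa>_def)
  have "(a, c) \<in> P" using ac by (simp add: P_def restr_def)
  then have "(Inl a, Inl c) \<in> Rep_eqv (iota b P)" by (simp add: Rep_iota[OF subsetD[OF fin_Eq_subset P]])
  then have "iota b P \<noteq> bot" using ac(3) by (auto simp: Rep_eqv_simps)
  \<comment> \<open>The lower cover of \<open>\<beta>\<close> in the first factor is zero, because
    one part of this infimum is a generator of the second factor.\<close>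
  then have \<kappa>_not: "\<not> word_le \<kappa> \<beta>"
    using low_mono[OF _ \<beta>_in, of \<kappa> True] by (auto simp: \<kappa>_def \<beta> bot_unique)
  obtain \<Phi> :: "(('a + bool) eqv + ('a + bool) eqv) lterm \<Rightarrow> 'a rel" where
    equiv: "\<And>t. t \<in> terms ?A \<Longrightarrow> word_le \<beta> t \<Longrightarrow> equiv \<Omega> (\<Phi> t)"
    and Meet: "\<And>s t. s \<in> terms ?A \<Longrightarrow> t \<in> terms ?A \<Longrightarrow> word_le \<beta> s \<Longrightarrow> word_le \<beta> t \<Longrightarrow>
      \<Phi> (LMeet s t) = trancl (\<Phi> s \<union> \<Phi> t)"
    and Join: "\<And>s t. s \<in> terms ?A \<Longrightarrow> t \<in> terms ?A \<Longrightarrow> word_le \<beta> s \<Longrightarrow> word_le \<beta> t \<Longrightarrow>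
      \<Phi> (LJoin s t) = \<Phi> s \<inter> \<Phi> t"
    and sub: "\<And>s t. s \<in> terms ?A \<Longrightarrow> t \<in> terms ?A \<Longrightarrow> word_le \<beta> s \<Longrightarrow> word_le \<beta> t \<Longrightarrow>
      \<Phi> s \<subseteq> \<Phi> t \<longleftrightarrow> word_le s t"
    and \<Phi>_\<beta>: "\<Phi> \<beta> = Id_on \<Omega>"
    and full: "\<And>t. t \<in> terms ?A \<Longrightarrow> (\<And>k. k \<in> terms ?K \<Longrightarrow> word_le k t) \<Longrightarrow> \<Phi> t = \<Omega> \<times> \<Omega>"
    using faithful_representation[OF inf fin_Eq_lepoll[OF inf] \<beta>_in \<kappa>_in \<kappa>_not] by blast
  define h1 where "h1 R = \<Phi> (Gen (Inl (iota b R)))" for R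
  define h2 where "h2 R = \<Phi> (Gen (Inr (iota b R)))" for R
  have eval: "eqop_eval h1 h2 s = \<Phi> (?m s)" if "lt_gens s \<subseteq> ?G" for s
    using that
  proof (induction s)
    case (Gen g)
    then show ?case by (cases g) (simp_all add: eqop_eval_def h1_def h2_def iota_gen_def)
  next
    case (LMeet s t)
    then show ?case
      by (simp add: eqop_eval_def eqop_meet_def Meet m_in \<beta>_le)
  next
    case (LJoin s t)
    then show ?case
      by (simp add: eqop_eval_def eqop_join_def Join m_in \<beta>_le)
  qed
  have eq_iff: "\<Phi> (?m s) = \<Phi> (?m t) \<longleftrightarrow> word_le (?m s) (?m t) \<and> word_le (?m t) (?m s)"
    if "lt_gens s \<subseteq> ?G" "lt_gens t \<subseteq> ?G" for s t
    using sub[OF m_in[OF that(1)] m_in[OF that(2)] \<beta>_le[OF that(1)] \<beta>_le[OF that(2)]]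
      sub[OF m_in[OF that(2)] m_in[OF that(1)] \<beta>_le[OF that(2)] \<beta>_le[OF that(1)]] by blast
  have gens: "lt_gens (coprod_bot \<Omega>) \<subseteq> ?G" "lt_gens (coprod_top \<Omega>) \<subseteq> ?G"
    "lt_gens (coprod1_top \<Omega>) \<subseteq> ?G"
    using Id_on_in_Eq[of \<Omega>] full_in_Eq[of \<Omega>]
    by (simp_all add: coprod_bot_def coprod_top_def coprod1_top_def coprod_gens_def eqop_bot_def
        eqop_top_def)
  have bot: "eqop_eval h1 h2 (coprod_bot \<Omega>) = eqop_bot \<Omega>"
  proof -
    \<comment> \<open>The supremum of the two full relations lies above every generator, hence above
      every compact term and so above all distances.\<close>
    have k_le: "word_le k (?m (coprod_bot \<Omega>))" if "k \<in> terms ?K" for k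
      using that
    proof (induction k)
      case (Gen g)
      have *: "x \<le> iota b (\<Omega> \<times> \<Omega>)" if x: "x \<in> ?K" for x
      proof (cases "x = bot")
        case False
        then obtain R where R: "R \<in> fin_Eq \<Omega>" "x = iota b R" using x by blast
        then have "R \<in> Eq \<Omega>" using fin_Eq_subset by blast
        then show ?thesis using iota_le_iff[OF _ full_in_Eq] EqD(1) R(2) by blast
      qed simp
      show ?case
      proof (cases g)
        case (Inl x)
        then have "x \<le> iota b (\<Omega> \<times> \<Omega>)" using Gen * by (simp del: insert_iff)
        then show ?thesis unfolding Inl coprod_bot_def eqop_bot_def
          by (simp add: iota_gen_def MeetR1 word_le_Gen_mono)
      next
        case (Inr x)
        then have "x \<le> iota b (\<Omega> \<times> \<Omega>)" using Gen * by (simp del: insert_iff)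
        then show ?thesis unfolding Inr coprod_bot_def eqop_bot_def
          by (simp add: iota_gen_def MeetR2 word_le_Gen_mono)
      qed
    next
      case (LMeet s t)
      then show ?case by (simp add: MeetL)
    next
      case (LJoin s t)
      then show ?case by (simp add: JoinL1)
    qed
    show ?thesis unfolding eval[OF gens(1)] eqop_bot_def
      by (rule full[OF m_in[OF gens(1)] k_le])
  qed
  have top: "eqop_eval h1 h2 (coprod_top \<Omega>) = eqop_top \<Omega>"
    unfolding eval[OF gens(2)] eqop_top_def \<beta>_def[symmetric] by (rule \<Phi>_\<beta>)
  \<comment> \<open>With a common unit the diagonal becomes \<open>bot\<close>, so the term of the
    unit is zero and hence equivalent to \<open>\<beta>\<close>.\<close>
  have top1: "eqop_eval h1 h2 (coprod1_top \<Omega>) = eqop_top \<Omega>" if "\<not> b"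
  proof -
    have "word_le (?m (coprod1_top \<Omega>)) (?m (coprod_top \<Omega>))"
      using that iota_False_bot[of \<Omega>]
      by (simp add: coprod1_top_def eqop_top_def iota_gen_def word_le_Gen_bot)
    moreover have "word_le (?m (coprod_top \<Omega>)) (?m (coprod1_top \<Omega>))"
      using \<beta>_le[OF gens(3)] unfolding \<beta>_def .
    ultimately have "\<Phi> (?m (coprod1_top \<Omega>)) = \<Phi> (?m (coprod_top \<Omega>))"
      using eq_iff[OF gens(3,2)] by blast
    then show ?thesis using top unfolding eval[OF gens(2)] eval[OF gens(3)] by simp
  qed
  have "h1 R \<in> Eq \<Omega>" "h2 R \<in> Eq \<Omega>" if R: "R \<in> Eq \<Omega>" for R
  proof -
    have g: "lt_gens (Gen (Inl R)) \<subseteq> ?G" "lt_gens (Gen (Inr R)) \<subseteq> ?G"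
      using R by (auto simp: coprod_gens_def)
    show "h1 R \<in> Eq \<Omega>" "h2 R \<in> Eq \<Omega>"
      using equiv[OF m_in[OF g(1)] \<beta>_le[OF g(1)]] equiv[OF m_in[OF g(2)] \<beta>_le[OF g(2)]]
      by (simp_all add: h1_def h2_def Eq_def iota_gen_def)
  qed
  then have "eqop_pres_embedding \<Omega> (coprodb_rels b \<Omega>) (coprod_bot \<Omega>)
      (if b then coprod_top \<Omega> else coprod1_top \<Omega>) h1 h2"
    unfolding eqop_pres_embedding_def
    using bot top top1 by (auto simp: eval eq_iff lat_cong_iff_le)
  then show ?thesis by blast
qed

theorem theorem6p5:
  fixes \<Omega> :: "'a set"
  assumes "infinite \<Omega>"
  shows "(\<exists>h1 h2. eqop_pres_embedding \<Omega>
            (coprod1_rels (Eq \<Omega>) eqop_meet eqop_join (eqop_top \<Omega>)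
                          (Eq \<Omega>) eqop_meet eqop_join (eqop_top \<Omega>))
            (coprod_bot \<Omega>) (coprod1_top \<Omega>) h1 h2)
       \<and> (\<exists>h1 h2. eqop_pres_embedding \<Omega>
            (coprod_rels (Eq \<Omega>) eqop_meet eqop_join (Eq \<Omega>) eqop_meet eqop_join)
            (coprod_bot \<Omega>) (coprod_top \<Omega>) h1 h2)"
  using eqop_embedding[OF assms, of False] eqop_embedding[OF assms, of True]
  by (simp add: coprodb_rels_def)

end
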